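(* Let $\Gamma_1,\Gamma_2$ be two locally perturbed sound-hard surfaces (Neumann boundary condition) with regions $\Omega_j=\{x\in\mathbb R^3: x_3>f_j(\tilde x)\}$, $j=1,2$. Let $d\in\mathbb S^2_-$ and suppose $u^{sc}_{1,\infty}(\hat x;d)=u^{sc}_{2,\infty}(\hat x;d)$ for all $\hat x\in\mathbb S^2_+$. Then $u^{sc}_1(x;d)=u^{sc}_2(x;d)$ for all $x\in\Omega_1\cap\Omega_2$.
   Context: Fix a wave number $k>0$. Write $x=(\tilde x,x_3)\in\mathbb R^3$ with $\tilde x=(x_1,x_2)$, and $\mathbb S^2_\pm=\{x\in\mathbb R^3:|x|=1,\ \pm x_3>0\}$. A locally perturbed surface is $\Gamma=\{(\tilde x,f(\tilde x)):\tilde x\in\mathbb R^2\}$, where $f:\mathbb R^2\to\mathbb R$ is Lipschitz continuous and $f(\tilde x)=0$ for $|\tilde x|>R$ for some $R>\max|f|$; $\Omega=\{x:x_3>f(\tilde x)\}$ is the region above $\Gamma$ and $\nu$ is the unit normal on $\Gamma$ pointing into $\Omega$. For $d=(\alpha,\beta,-\gamma)\in\mathbb S^2_-$ the incident plane wave is $u^{in}(x;d)=e^{ikx\cdot d}$ and its reflected wave from the flat plane $\{x_3=0\}$ is $u^{re}(x;d)=-e^{ik(\alpha x_1+\beta x_2+\gamma x_3)}$ in the Dirichlet case and $u^{re}(x;d)=+e^{ik(\alpha x_1+\beta x_2+\gamma x_3)}$ in the Neumann case. The total field is $u=u^{in}+u^{re}+u^{sc}$, where $u$ satisfies $\Delta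 u+k^2u=0$ in $\Omega$, the boundary condition $u=0$ on $\Gamma$ (sound-soft/Dirichlet) or $\partial_\nu u=0$ on $\Gamma$ (sound-hard/Neumann), and the scattered field $u^{sc}$ satisfies the Sommerfeld radiation condition $\lim_{r\to\infty}r(\partial_ru^{sc}-iku^{sc})=0$, $r=|x|$, $x\in\Omega$; this problem is uniquely solvable. Then $u^{sc}(x;d)=\frac{e^{ik|x|}}{|x|}\{u^{sc}_\infty(\hat x;d)+O(1/|x|)\}$ as $|x|\to\infty$ in $\Omega$, $\hat x=x/|x|\in\mathbb S^2_+$, and $u^{sc}_\infty(\cdot;d)$ is the far-field pattern. Quantities associated with a surface $\Gamma_j=\{x_3=f_j(\tilde x)\}$ carry the index $j$. *)

theory Defs
  imports "HOL-Analysis.Analysis"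
begin

definition horiz :: "real^3 \<Rightarrow> real^2" where
  "horiz x = vector [x$1, x$2]"

definition locally_perturbed :: "(real^2 \<Rightarrow> real) \<Rightarrow> bool" where
  "locally_perturbed f \<longleftrightarrow>
     (\<exists>L. L-lipschitz_on UNIV f) \<and>
     (\<exists>R. (\<forall>y. \<bar>f y\<bar> < R) \<and> (\<forall>y. norm y > R \<longrightarrow> f y = 0))"

definition region :: "(real^2 \<Rightarrow> real) \<Rightarrow> (real^3) set" where
  "region f = {x. x$3 > f (horiz x)}"

definition lower_sphere :: "(real^3) set" where
  "lower_sphere = {d. norm d = 1 \<and> d$3 < 0}"

definition upper_sphere :: "(real^3) set" where
  "upper_sphere = {d. norm d = 1 \<and> d$3 > 0}"

definition u_in :: "real \<Rightarrow> real^3 \<Rightarrow> real^3 \<Rightarrow> complex" where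
  "u_in k d x = exp (\<i> * of_real (k * (x \<bullet> d)))"

text \<open>Reflected wave, Neumann case: + exp(ik(alpha x1 + beta x2 + gamma x3))
  with d = (alpha, beta, -gamma).\<close>
definition u_re_neumann :: "real \<Rightarrow> real^3 \<Rightarrow> real^3 \<Rightarrow> complex" where
  "u_re_neumann k d x = exp (\<i> * of_real (k * (d$1 * x$1 + d$2 * x$2 - d$3 * x$3)))"

definition has_partial_on ::
  "(real^3 \<Rightarrow> 'b::real_normed_vector) \<Rightarrow> 3 \<Rightarrow> (real^3 \<Rightarrow> 'b) \<Rightarrow> (real^3) set \<Rightarrow> bool" where
  "has_partial_on u i g S \<longleftrightarrow>
     (\<forall>x\<in>S. ((\<lambda>t. u (x + t *\<^sub>R axis i 1)) has_vector_derivative g x) (at 0))"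

definition helmholtz_C2 ::
  "real \<Rightarrow> (real^3) set \<Rightarrow> (real^3 \<Rightarrow> complex) \<Rightarrow> (3 \<Rightarrow> real^3 \<Rightarrow> complex) \<Rightarrow> bool" where
  "helmholtz_C2 k S u p \<longleftrightarrow>
     continuous_on S u \<and>
     (\<forall>i. has_partial_on u i (p i) S \<and> continuous_on S (p i)) \<and>
     (\<exists>q. (\<forall>i j. has_partial_on (p i) j (q i j) S \<and> continuous_on S (q i j)) \<and>
          (\<forall>x\<in>S. (\<Sum>i\<in>UNIV. q i i x) + of_real (k^2) * u x = 0))"

definition test_fun :: "(real^3 \<Rightarrow> real) \<Rightarrow> (3 \<Rightarrow> real^3 \<Rightarrow> real) \<Rightarrow> bool" where
  "test_fun \<phi> D\<phi> \<longleftrightarrow>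
     (\<forall>i. has_partial_on \<phi> i (D\<phi> i) UNIV \<and> continuous_on UNIV (D\<phi> i)) \<and>
     bounded {x. \<phi> x \<noteq> 0}"

text \<open>Sound-hard (Neumann) boundary condition on the Lipschitz surface, in the
  standard variational sense: u and grad u are locally square integrable up to the
  boundary, and int_Omega (grad u . grad phi - k^2 u phi) = 0 for all test functions
  phi on R^3 (not required to vanish on the boundary).\<close>
definition weak_neumann ::
  "real \<Rightarrow> (real^3) set \<Rightarrow> (real^3 \<Rightarrow> complex) \<Rightarrow> (3 \<Rightarrow> real^3 \<Rightarrow> complex) \<Rightarrow> bool" where
  "weak_neumann k S u p \<longleftrightarrow>
     (\<forall>r>0. set_integrable lborel (S \<inter> ball 0 r) (\<lambda>x. (cmod (u x))^2) \<and>
            (\<forall>i. set_integrable lborel (S \<inter> ball 0 r) (\<lambda>x. (cmod (p i x))^2))) \<and>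
     (\<forall>\<phi> D\<phi>. test_fun \<phi> D\<phi> \<longrightarrow>
        (let g = (\<lambda>x. (\<Sum>i\<in>UNIV. p i x * of_real (D\<phi> i x)) - of_real (k^2) * u x * of_real (\<phi> x))
         in set_integrable lborel S g \<and> (LINT x:S|lborel. g x) = 0))"

definition radial_deriv :: "(real^3 \<Rightarrow> complex) \<Rightarrow> real^3 \<Rightarrow> complex" where
  "radial_deriv v x = vector_derivative (\<lambda>t. v (t *\<^sub>R sgn x)) (at (norm x))"

definition sommerfeld :: "real \<Rightarrow> (real^3) set \<Rightarrow> (real^3 \<Rightarrow> complex) \<Rightarrow> bool" where
  "sommerfeld k S v \<longleftrightarrow>
     (\<forall>e>0. \<exists>\<rho>. \<forall>x\<in>S. norm x > \<rho> \<longrightarrow>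
        norm x * cmod (radial_deriv v x - \<i> * of_real k * v x) < e)"

definition neumann_scattered ::
  "real \<Rightarrow> (real^2 \<Rightarrow> real) \<Rightarrow> real^3 \<Rightarrow> (real^3 \<Rightarrow> complex) \<Rightarrow> bool" where
  "neumann_scattered k f d usc \<longleftrightarrow>
     (let u = (\<lambda>x. u_in k d x + u_re_neumann k d x + usc x)
      in (\<exists>p. helmholtz_C2 k (region f) u p \<and> weak_neumann k (region f) u p) \<and>
         sommerfeld k (region f) usc)"

text \<open>F is the far-field pattern of v: v(x) = e^{ik|x|}/|x| (F(xhat) + O(1/|x|));
  we record the (implied) directional limit for every xhat in the upper hemisphere.\<close>
definition has_far_field :: "real \<Rightarrow> (real^3 \<Rightarrow> complex) \<Rightarrow> (real^3 \<Rightarrow> complex) \<Rightarrow> bool" where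
  "has_far_field k v F \<longleftrightarrow>
     (\<forall>xh\<in>upper_sphere.
        ((\<lambda>r. of_real r * exp (- \<i> * of_real (k * r)) * v (r *\<^sub>R xh)) \<longlongrightarrow> F xh) at_top)"

end

theory Submission
  imports Defs "HOL-Complex_Analysis.Conformal_Mappings"
begin

text \<open>
  Outside a large ball both total fields satisfy the Neumann condition on the flat plane, so their
  difference extends by even reflection to a weak solution of the Helmholtz equation in the exterior
  of a ball, and mollification turns it into a radiating solution \<open>w\<close>. Conservation of energy and
  the radiation condition bound the mean square of \<open>w\<close> over large shells; hence the outer shell
  disappears from Green's formula, \<open>w\<close> is represented by its values in a bounded shell, and
  \<open>r exp (- \<i> k r) w (r \<theta>)\<close> extends to a holomorphic function of \<open>1 / r\<close> near \<open>0\<close>. Its value at \<open>0\<close>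
  is the difference of the far-field patterns. If the first \<open>m\<close> Taylor coefficients vanish on an
  open set of directions, the next one is the leading term of \<open>w\<close>; testing the equation with
  \<open>exp (- \<i> k r) / r\<close> times a bump that moves to infinity leaves, in the limit, \<open>m\<close> times the
  integral of this term against the bump, so it vanishes as well. Thus \<open>w = 0\<close> far out in the upper
  half space. Finally, Green's formula in small balls shows that solutions are analytic along lines,
  and the region above both graphs contains the upward ray from each of its points.
\<close>

section \<open>Derivatives and parametric integrals\<close>

lemma has_vector_derivative_iff_difference_quotient:
  fixes f :: "real \<Rightarrow> 'a::real_normed_vector"
  shows "(f has_vector_derivative f') (at x) \<longleftrightarrow> ((\<lambda>t. (f (x + t) - f x) /\<^sub>R t) \<longlongrightarrow> f') (at 0)"
proof -
  have quotient: "norm (f (x + t) - f x - t *\<^sub>R f') / norm t = norm ((f (x + t) - f x) /\<^sub>R t - f')"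
    if "t \<noteq> 0" for t
  proof -
    have "(f (x + t) - f x) /\<^sub>R t - f' = inverse t *\<^sub>R (f (x + t) - f x - t *\<^sub>R f')"
      using that by (simp add: scaleR_diff_right)
    then show ?thesis by (simp add: divide_inverse_commute)
  qed
  have "(f has_vector_derivative f') (at x) \<longleftrightarrow>
      ((\<lambda>t. norm (f (x + t) - f x - t *\<^sub>R f') / norm t) \<longlongrightarrow> 0) (at 0)"
    by (simp add: has_vector_derivative_def has_derivative_at bounded_linear_scaleR_left)
  also have "\<dots> \<longleftrightarrow> ((\<lambda>t. norm ((f (x + t) - f x) /\<^sub>R t - f')) \<longlongrightarrow> 0) (at 0)"
    using quotient by (intro Lim_cong_within) auto
  finally show ?thesis by (simp add: tendsto_norm_zero_iff LIM_zero_iff)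
qed

lemma norm_diff_le_vector_derivative_bound:
  fixes f :: "real \<Rightarrow> 'a::real_normed_vector"
  assumes "\<And>t. t \<in> closed_segment a b \<Longrightarrow> (f has_vector_derivative f' t) (at t)"
    and "\<And>t. t \<in> closed_segment a b \<Longrightarrow> norm (f' t) \<le> B"
  shows "norm (f b - f a) \<le> B * \<bar>b - a\<bar>"
proof -
  have "norm (f b - f a) \<le> B * norm (b - a)"
  proof (rule differentiable_bound[of "closed_segment a b" f "\<lambda>t h. h *\<^sub>R f' t"])
    show "(f has_derivative (\<lambda>h. h *\<^sub>R f' t)) (at t within closed_segment a b)"
      if "t \<in> closed_segment a b" for t
      using assms(1)[OF that] has_derivative_at_withinI unfolding has_vector_derivative_def by blast
    show "onorm (\<lambda>h. h *\<^sub>R f' t) \<le> B" if "t \<in> closed_segment a b" for t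
      using assms(2)[OF that] by (intro onorm_le) (simp add: mult_left_mono mult.commute[of B])
  qed auto
  then show ?thesis by simp
qed

lemma tendsto_integral_dominated:
  fixes F :: "'a::first_countable_topology \<Rightarrow> 'm \<Rightarrow> 'b::{banach, second_countable_topology}"
  assumes "integrable M g"
    and "\<And>t. t \<in> S - {a} \<Longrightarrow> F t \<in> borel_measurable M"
    and "\<And>t y. t \<in> S - {a} \<Longrightarrow> norm (F t y) \<le> g y"
    and lim: "\<And>y. ((\<lambda>t. F t y) \<longlongrightarrow> L y) (at a within S)"
  shows "((\<lambda>t. LINT y|M. F t y) \<longlongrightarrow> (LINT y|M. L y)) (at a within S)"
  unfolding tendsto_at_iff_sequentially
proof (intro allI impI)
  fix T assume T: "\<forall>n. T n \<in> S - {a}" "T \<longlonglongrightarrow> a"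
  have lim_seq: "(\<lambda>n. F (T n) y) \<longlonglongrightarrow> L y" for y
    using lim[of y] T unfolding tendsto_at_iff_sequentially by (auto simp: o_def)
  have meas: "F (T n) \<in> borel_measurable M" for n using assms(2) T(1) by blast
  have "L \<in> borel_measurable M" by (rule borel_measurable_LIMSEQ_metric[OF meas lim_seq])
  then have "(\<lambda>n. LINT y|M. F (T n) y) \<longlonglongrightarrow> (LINT y|M. L y)"
    by (rule integral_dominated_convergence[OF _ meas assms(1)]) (use T assms(3) lim_seq in auto)
  then show "((\<lambda>t. LINT y|M. F t y) \<circ> T) \<longlonglongrightarrow> (LINT y|M. L y)" by (simp add: o_def)
qed

lemma has_vector_derivative_integral:
  fixes F :: "real \<Rightarrow> 'm \<Rightarrow> 'b::{banach, second_countable_topology}"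
  assumes "d > 0" and integrable: "\<And>t. \<bar>t - t0\<bar> < d \<Longrightarrow> integrable M (F t)" and g: "integrable M g"
    and lipschitz: "\<And>t y. \<bar>t - t0\<bar> < d \<Longrightarrow> norm (F t y - F t0 y) \<le> \<bar>t - t0\<bar> * g y"
    and deriv: "\<And>y. ((\<lambda>t. F t y) has_vector_derivative F' y) (at t0)"
  shows "((\<lambda>t. LINT y|M. F t y) has_vector_derivative (LINT y|M. F' y)) (at t0)"
proof -
  let ?Q = "\<lambda>s y. (F (t0 + s) y - F t0 y) /\<^sub>R s"
  have integrable_shift: "integrable M (F (t0 + s))" if "s \<in> ball 0 d" for s
    using integrable[of "t0 + s"] that by simp
  have integrable_0: "integrable M (F t0)" using integrable assms(1) by simp
  have "((\<lambda>s. LINT y|M. ?Q s y) \<longlongrightarrow> (LINT y|M. F' y)) (at 0 within ball 0 d)"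
  proof (rule tendsto_integral_dominated[OF g])
    show "?Q s \<in> borel_measurable M" if "s \<in> ball 0 d - {0}" for s
      using integrable_shift[of s] integrable_0 that
      by (intro borel_measurable_scaleR borel_measurable_diff) auto
    show "norm (?Q s y) \<le> g y" if "s \<in> ball 0 d - {0}" for s y
      using lipschitz[of "t0 + s" y] that
      by (auto simp: divide_inverse_commute[symmetric] pos_divide_le_eq mult.commute)
    show "((\<lambda>s. ?Q s y) \<longlongrightarrow> F' y) (at 0 within ball 0 d)" for y
      using deriv[of y] unfolding has_vector_derivative_iff_difference_quotient
      by (rule tendsto_mono[OF at_le[OF subset_UNIV]])
  qed
  then have "((\<lambda>s. LINT y|M. ?Q s y) \<longlongrightarrow> (LINT y|M. F' y)) (at 0)"
    using assms(1) by (simp add: at_within_open[OF _ open_ball])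
  moreover have "\<forall>\<^sub>F s in at 0. (LINT y|M. ?Q s y)
      = ((LINT y|M. F (t0 + s) y) - (LINT y|M. F t0 y)) /\<^sub>R s"
    unfolding eventually_at using assms(1) integrable_shift integrable_0 by (intro exI[of _ d]) auto
  ultimately show ?thesis
    unfolding has_vector_derivative_iff_difference_quotient by (rule Lim_transform_eventually)
qed

lemma continuous_on_integral_dominated:
  fixes F :: "'a::first_countable_topology \<Rightarrow> 'm \<Rightarrow> 'b::{banach, second_countable_topology}"
  assumes "integrable M g" and "\<And>t. t \<in> S \<Longrightarrow> F t \<in> borel_measurable M"
    and "\<And>t y. t \<in> S \<Longrightarrow> norm (F t y) \<le> g y" and "\<And>y. continuous_on S (\<lambda>t. F t y)"
  shows "continuous_on S (\<lambda>t. LINT y|M. F t y)"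
  using assms unfolding continuous_on_def by (blast intro: tendsto_integral_dominated)

lemma deriv_norm_le_on_cball:
  assumes "f holomorphic_on S" "open S" "cball a r \<subseteq> S" "r > 0" "\<And>z. z \<in> cball a r \<Longrightarrow> cmod (f z) \<le> B"
  shows "cmod (deriv f a) \<le> B / r"
proof -
  have "cmod ((deriv ^^ 1) f a) \<le> fact 1 * B / r ^ 1"
  proof (rule Cauchy_inequality[OF _ _ assms(4)])
    show "f holomorphic_on ball a r" using assms(1,3) ball_subset_cball
      by (blast intro: holomorphic_on_subset)
    show "continuous_on (cball a r) f"
      using assms(1,3) by (blast intro: continuous_on_subset holomorphic_on_imp_continuous_on)
    show "cmod (f z) \<le> B" if "cmod (a - z) = r" for z using assms(5) that by (simp add: dist_norm)
  qed
  then show ?thesis by simp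
qed

lemma holomorphic_quotient_norm_le:
  assumes hol: "f holomorphic_on S" "open S" and r: "r > 0" "cball a r \<subseteq> S" "\<And>z. z \<in> cball a r \<Longrightarrow>
      cmod (f z) \<le> B"
    and u: "u \<in> ball a (r / 2) - {a}"
  shows "cmod ((f u - f a) / (u - a)) \<le> B / (r / 2)"
proof -
  have sub: "cball v (r / 2) \<subseteq> cball a r" if "v \<in> ball a (r / 2)" for v
    using that by (subst cball_subset_cball_iff) (auto simp: dist_commute)
  have "cmod (f u - f a) \<le> B / (r / 2) * cmod (u - a)"
  proof (rule field_differentiable_bound[OF convex_ball])
    fix v assume v: "v \<in> ball a (r / 2)"
    then have "v \<in> S" by (intro subsetD[OF r(2)]) (use r(1) in auto)
    then show "(f has_field_derivative deriv f v) (at v within ball a (r / 2))"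
      using holomorphic_derivI[OF hol] has_field_derivative_at_within by blast
    show "cmod (deriv f v) \<le> B / (r / 2)"
      using sub[OF v] r by (intro deriv_norm_le_on_cball[OF hol]) auto
  qed (use u r(1) in auto)
  then show ?thesis using u by (simp add: norm_divide pos_divide_le_eq)
qed

lemma holomorphic_on_integral_dominated:
  fixes f :: "complex \<Rightarrow> 'm \<Rightarrow> complex"
  assumes "open S" and g: "\<And>a. a \<in> S \<Longrightarrow> \<exists>r>0. cball a r
      \<subseteq> S \<and> (\<exists>g. integrable M g \<and> (\<forall>z\<in>cball a r. \<forall>y. cmod (f z y) \<le> g y))"
    and meas: "\<And>z. z \<in> S \<Longrightarrow> f z \<in> borel_measurable M" and hol: "\<And>y. (\<lambda>z. f z y) holomorphic_on S"
  shows "(\<lambda>z. LINT y|M. f z y) holomorphic_on S"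
  unfolding holomorphic_on_open[OF assms(1)]
proof (intro ballI exI)
  fix a assume a: "a \<in> S"
  obtain r g where r: "r > 0" "cball a r \<subseteq> S" and g: "integrable M g" "\<And>z y. z \<in> cball a r \<Longrightarrow>
      cmod (f z y) \<le> g y"
    using g[OF a] by blast
  let ?Q = "\<lambda>u y. (f u y - f a y) / (u - a)"
  have integrable: "integrable M (f z)" if "z \<in> cball a r" for z
    using that r(2) by (intro Bochner_Integration.integrable_bound[OF g(1) meas])
      (auto intro!: AE_I2 order_trans[OF g(2)])
  have "((\<lambda>u. LINT y|M. ?Q u y) \<longlongrightarrow> (LINT y|M. deriv (\<lambda>z. f z y) a)) (at a within ball a (r / 2))"
  proof (rule tendsto_integral_dominated[where g="\<lambda>y. g y / (r / 2)"])
    show "?Q u \<in> borel_measurable M" if "u \<in> ball a (r / 2) - {a}" for u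
    proof -
      have "u \<in> S" by (rule subsetD[OF r(2)]) (use that r(1) in auto)
      then show ?thesis using meas a by simp
    qed
    show "cmod (?Q u y) \<le> g y / (r / 2)" if "u \<in> ball a (r / 2) - {a}" for u y
      by (rule holomorphic_quotient_norm_le[OF hol assms(1) r g(2) that])
    show "((\<lambda>u. ?Q u y) \<longlongrightarrow> deriv (\<lambda>z. f z y) a) (at a within ball a (r / 2))" for y
      using has_field_derivative_at_within[OF holomorphic_derivI[OF hol assms(1) a]]
      unfolding has_field_derivative_iff .
  qed (use g(1) in auto)
  then have "((\<lambda>u. LINT y|M. ?Q u y) \<longlongrightarrow> (LINT y|M. deriv (\<lambda>z. f z y) a)) (at a)"
    using r(1) by (simp add: at_within_open[OF _ open_ball])
  moreover have "\<forall>\<^sub>F u in at a. (LINT y|M. ?Q u y) = ((LINT y|M. f u y) - (LINT y|M. f a y)) / (u - a)"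
    unfolding eventually_at using r(1) integrable by (intro exI[of _ r]) (auto simp: dist_commute)
  ultimately show "((\<lambda>z. LINT y|M. f z y) has_field_derivative (LINT y|M. deriv (\<lambda>z. f z y) a)) (at a)"
    unfolding has_field_derivative_iff by (rule Lim_transform_eventually)
qed

section \<open>Lebesgue integrals on Euclidean space\<close>

lemma set_integrable_continuous_compact:
  fixes f :: "'a::euclidean_space \<Rightarrow> 'b::{banach, second_countable_topology}"
  assumes "continuous_on S f" "compact K" "K \<subseteq> S"
  shows "set_integrable lborel K f"
  unfolding set_integrable_def
  by (rule borel_integrable_compact[OF assms(2) continuous_on_subset[OF assms(1,3)]])

lemma integrable_continuous_compact_support:
  fixes f :: "'a::euclidean_space \<Rightarrow> 'b::{banach, second_countable_topology}"
  assumes "continuous_on S f" "compact K" "K \<subseteq> S" "\<And>x. x \<notin> K \<Longrightarrow> f x = 0"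
  shows "integrable lborel f"
proof -
  have "(\<lambda>x. indicator K x *\<^sub>R f x) = f" using assms(4) by (auto simp: indicator_def fun_eq_iff)
  then show ?thesis using set_integrable_continuous_compact[OF assms(1-3)]
    by (simp add: set_integrable_def)
qed

lemma bounded_continuous_compact_support:
  fixes f :: "'a::topological_space \<Rightarrow> 'b::real_normed_vector"
  assumes "continuous_on UNIV f" "compact K" "\<And>x. x \<notin> K \<Longrightarrow> f x = 0"
  obtains B where "B > 0" "\<And>x. norm (f x) \<le> B"
proof -
  have "bounded (f ` K)"
    using assms by (intro compact_imp_bounded compact_continuous_image)
      (auto intro: continuous_on_subset)
  then obtain B where "B > 0" "\<forall>x\<in>K. norm (f x) \<le> B" unfolding bounded_pos by auto
  then show ?thesis using that[of B] assms(3) by (metis less_imp_le norm_zero)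
qed

lemma integrable_mult_compact_support:
  fixes f g :: "'a::euclidean_space \<Rightarrow> complex"
  assumes f: "set_integrable lborel K f" and g: "continuous_on UNIV g" "compact K" "\<And>x. x \<notin> K \<Longrightarrow> g x = 0"
  shows "integrable lborel (\<lambda>x. f x * g x)"
proof -
  obtain B where B: "B > 0" "\<And>x. norm (g x) \<le> B" using bounded_continuous_compact_support[OF g] by blast
  let ?f = "\<lambda>x. indicator K x *\<^sub>R f x"
  have integrable_f: "integrable lborel ?f" using f by (simp add: set_integrable_def)
  have "integrable lborel (\<lambda>x. ?f x * g x)"
  proof (rule Bochner_Integration.integrable_bound)
    show "integrable lborel (\<lambda>x. B * norm (?f x))"
      using integrable_f by (intro integrable_mult_right integrable_norm)
    show "(\<lambda>x. ?f x * g x) \<in> borel_measurable lborel"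
      using borel_measurable_integrable[OF integrable_f] borel_measurable_continuous_onI[OF g(1)]
      by (intro borel_measurable_times) auto
    have "norm (?f x) * norm (g x) \<le> norm (?f x) * B" for x by (intro mult_left_mono B(2)) simp
    then show "AE x in lborel. norm (?f x * g x) \<le> norm (B * norm (?f x))"
      using B(1) by (intro AE_I2) (simp add: norm_mult mult_ac)
  qed
  moreover have "(\<lambda>x. f x * g x) = (\<lambda>x. ?f x * g x)" using g(3) by (auto simp: indicator_def)
  ultimately show ?thesis by simp
qed

lemma integrable_indicator_compact:
  fixes K :: "'a::euclidean_space set"
  assumes "compact K"
  shows "integrable lborel (\<lambda>x. c * indicator K x :: real)"
  using assms emeasure_compact_finite[OF assms]
  by (intro integrable_mult_right integrable_real_indicator) (auto simp: borel_compact)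

lemma integral_pos_continuous:
  fixes g :: "'a::euclidean_space \<Rightarrow> real"
  assumes g: "continuous_on UNIV g" "integrable lborel g" "\<And>x. g x \<ge> 0" "g a > 0"
  shows "(LINT x|lborel. g x) > 0"
proof -
  have "open {x. g x > g a / 2}"
    using g(1) by (intro open_Collect_less continuous_intros)
  moreover have "a \<in> {x. g x > g a / 2}" using g(4) by simp
  ultimately obtain r where r: "r > 0" "cball a r \<subseteq> {x. g x > g a / 2}"
    using open_contains_cball_eq by blast
  have "0 < g a / 2 * measure lborel (cball a r)"
    using g(4) content_cball_pos[OF r(1), of a] by simp
  also have "\<dots> = (LINT x|lborel. g a / 2 * indicator (cball a r) x)"
    by simp
  also have "\<dots> \<le> (LINT x|lborel. g x)"
  proof (rule integral_mono[OF integrable_indicator_compact[OF compact_cball] g(2)])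
    show "g a / 2 * indicator (cball a r) x \<le> g x" for x
      using r(2) g(3)[of x] by (auto simp: indicator_def)
  qed
  finally show ?thesis .
qed

lemma integrable_lborel_translate:
  fixes f :: "'a::euclidean_space \<Rightarrow> 'b::{banach, second_countable_topology}"
  assumes "integrable lborel f"
  shows "integrable lborel (\<lambda>x. f (x + c))"
proof -
  have "integrable (distr lborel borel ((+) c)) f" using assms by (simp add: lborel_distr_plus)
  from integrable_distr[OF _ this] show ?thesis by (simp add: add.commute)
qed

lemma lborel_integral_affine:
  fixes f :: "'a::euclidean_space \<Rightarrow> 'b::{banach, second_countable_topology}"
  assumes "f \<in> borel_measurable borel" "c \<noteq> 0"
  shows "(LINT y|lborel. f y) = \<bar>c\<bar> ^ DIM('a) *\<^sub>R (LINT x|lborel. f (t + c *\<^sub>R x))"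
proof -
  have "(LINT y|lborel. f y) = (LINT y|density (distr lborel borel (\<lambda>x. t + c *\<^sub>R x))
      (\<lambda>_. \<bar>c\<bar> ^ DIM('a)). f y)"
    by (subst lborel_affine[of c t, symmetric]) (use assms in auto)
  also have "\<dots> = (LINT y|distr lborel borel (\<lambda>x. t + c *\<^sub>R x). \<bar>c\<bar> ^ DIM('a) *\<^sub>R f y)"
    by (rule integral_density) (use assms in auto)
  also have "\<dots> = (LINT x|lborel. \<bar>c\<bar> ^ DIM('a) *\<^sub>R f (t + c *\<^sub>R x))"
    by (rule integral_distr) (use assms in auto)
  finally show ?thesis by simp
qed

lemma holomorphic_on_integral_kernel:
  fixes H :: "complex \<Rightarrow> 'a::euclidean_space \<Rightarrow> complex"
  assumes "open S" "compact K" and cont: "continuous_on (S \<times> K) (\<lambda>(z, y). H z y)"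
    and hol: "\<And>y. y \<in> K \<Longrightarrow> (\<lambda>z. H z y) holomorphic_on S"
  shows "(\<lambda>z. LINT y:K|lborel. H z y) holomorphic_on S"
  unfolding set_lebesgue_integral_def
proof (rule holomorphic_on_integral_dominated[OF assms(1)])
  fix a assume "a \<in> S"
  then obtain r where r: "r > 0" "cball a r \<subseteq> S" using assms(1) open_contains_cball_eq by blast
  have "bounded ((\<lambda>(z, y). H z y) ` (cball a r \<times> K))"
    using r by (intro compact_imp_bounded compact_continuous_image
      continuous_on_subset[OF cont] compact_Times
        compact_cball assms(2)) auto
  then obtain B where B: "B > 0" "\<And>z y. z \<in> cball a r \<Longrightarrow> y \<in> K \<Longrightarrow> cmod (H z y) \<le> B"
    unfolding bounded_pos by auto
  have "integrable lborel (\<lambda>y. B * indicator K y)"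
    by (rule integrable_indicator_compact[OF assms(2)])
  moreover have "cmod (indicator K y *\<^sub>R H z y) \<le> B * indicator K y" if "z \<in> cball a r" for z y
    using B(2)[OF that] by (cases "y \<in> K") auto
  ultimately show "\<exists>r>0. cball a r \<subseteq> S \<and>
      (\<exists>g. integrable lborel g \<and> (\<forall>z\<in>cball a r. \<forall>y. cmod (indicator K y *\<^sub>R H z y) \<le> g y))"
    using r by (intro exI[of _ r] exI[of _ "\<lambda>y. B * indicator K y"] conjI ballI allI) auto
next
  fix z assume z: "z \<in> S"
  have "continuous_on K (\<lambda>y. case (z, y) of (z, y) \<Rightarrow> H z y)"
    by (rule continuous_on_compose2[OF cont]) (use z in \<open>auto intro!: continuous_intros\<close>)
  then have "integrable lborel (\<lambda>y. indicator K y *\<^sub>R H z y)"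
    using borel_integrable_compact[OF assms(2), of "H z"] by simp
  then show "(\<lambda>y. indicator K y *\<^sub>R H z y) \<in> borel_measurable lborel"
    by (rule borel_measurable_integrable)
next
  show "(\<lambda>z. indicator K y *\<^sub>R H z y) holomorphic_on S" for y
    using hol by (cases "y \<in> K") auto
qed

lemma norm_set_integral_le:
  fixes f :: "'a::euclidean_space \<Rightarrow> 'b::{banach, second_countable_topology}"
  assumes "compact K" "\<And>y. y \<in> K \<Longrightarrow> norm (f y) \<le> B"
  shows "norm (LINT y:K|lborel. f y) \<le> B * measure lborel K"
proof -
  have "norm (LINT y:K|lborel. f y) \<le> (LINT y|lborel. B * indicator K y)"
    unfolding set_lebesgue_integral_def
  proof (rule order_trans[OF integral_norm_bound integral_mono'])
    show "integrable lborel (\<lambda>y. B * indicator K y)"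
      by (rule integrable_indicator_compact[OF assms(1)])
    show "norm (indicator K y *\<^sub>R f y) \<le> B * indicator K y" for y
      using assms(2) by (cases "y \<in> K") auto
    show "0 \<le> B * indicator K y" for y
      using order_trans[OF norm_ge_zero assms(2)] by (cases "y \<in> K") auto
  qed
  then show ?thesis using assms(1) by (simp add: borel_compact)
qed

section \<open>Partial derivatives\<close>

lemma has_partial_on_line:
  assumes "has_partial_on f i f' S" "x + t *\<^sub>R axis i 1 \<in> S"
  shows "((\<lambda>t. f (x + t *\<^sub>R axis i 1)) has_vector_derivative f' (x + t *\<^sub>R axis i 1)) (at t)"
proof -
  let ?x = "x + t *\<^sub>R axis i 1"
  have "((\<lambda>s. f (?x + s *\<^sub>R axis i 1)) has_vector_derivative f' ?x) (at 0)"
    using assms unfolding has_partial_on_def by blast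
  then show ?thesis
    unfolding has_vector_derivative_iff_difference_quotient by (simp add: algebra_simps)
qed

lemma has_partial_on_mult:
  fixes f g :: "real^3 \<Rightarrow> complex"
  assumes "has_partial_on f i f' S" "has_partial_on g i g' S"
  shows "has_partial_on (\<lambda>x. f x * g x) i (\<lambda>x. f' x * g x + f x * g' x) S"
  using assms unfolding has_partial_on_def
  by (auto intro!: derivative_eq_intros simp: add.commute)

lemma has_partial_on_add:
  assumes "has_partial_on f i f' S" "has_partial_on g i g' S"
  shows "has_partial_on (\<lambda>x. f x + g x) i (\<lambda>x. f' x + g' x) S"
  using assms unfolding has_partial_on_def by (auto intro!: derivative_intros)

lemma has_partial_on_diff:
  assumes "has_partial_on f i f' S" "has_partial_on g i g' S"
  shows "has_partial_on (\<lambda>x. f x - g x) i (\<lambda>x. f' x - g' x) S"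
  using assms unfolding has_partial_on_def by (auto intro!: derivative_intros)

lemma has_partial_on_const: "has_partial_on (\<lambda>x. c) i (\<lambda>x. 0) S"
  by (auto simp: has_partial_on_def)

lemma has_partial_on_subset: "has_partial_on f i f' S \<Longrightarrow> T \<subseteq> S \<Longrightarrow> has_partial_on f i f' T"
  by (auto simp: has_partial_on_def)

lemma has_partial_on_cong:
  assumes "has_partial_on f i f' S" "open S" "\<And>x. x \<in> S \<Longrightarrow> f x = g x" "\<And>x. x \<in> S \<Longrightarrow> f' x = g' x"
  shows "has_partial_on g i g' S"
  unfolding has_partial_on_def
proof
  fix x assume x: "x \<in> S"
  have "open ((\<lambda>t. x + t *\<^sub>R axis i 1) -` S)"
    by (intro open_vimage assms continuous_intros)
  moreover have "((\<lambda>t. f (x + t *\<^sub>R axis i 1)) has_vector_derivative g' x) (at 0)"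
    using assms(1,4) x unfolding has_partial_on_def by auto
  ultimately show "((\<lambda>t. g (x + t *\<^sub>R axis i 1)) has_vector_derivative g' x) (at 0)"
    using assms(3) x by (elim has_vector_derivative_transform_within_open) auto
qed

lemma has_partial_on_unique:
  assumes "has_partial_on f i f' S" "has_partial_on f i g' S" "x \<in> S"
  shows "f' x = g' x"
  using assms unfolding has_partial_on_def by (meson vector_derivative_unique_at)

lemma partial_eq_0_where_const:
  assumes "has_partial_on f i f' S" "open T" "T \<subseteq> S" "\<And>x. x \<in> T \<Longrightarrow> f x = c" "x \<in> T"
  shows "f' x = 0"
proof -
  have "has_partial_on f i (\<lambda>x. 0) T"
    by (rule has_partial_on_cong[OF has_partial_on_const]) (use assms in auto)
  then show ?thesis
    using has_partial_on_unique[OF has_partial_on_subset[OF assms(1,3)]] assms(5) by blast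
qed

lemma partial_eq_0_outside:
  assumes "has_partial_on f i f' UNIV" "compact K" "\<And>x. x \<notin> K \<Longrightarrow> f x = 0" "x \<notin> K"
  shows "f' x = 0"
  by (rule partial_eq_0_where_const[OF assms(1), of "- K" 0])
    (use assms in \<open>auto simp: compact_imp_closed\<close>)

lemma norm_partial_increment_le:
  assumes f: "has_partial_on f i f' S" and S: "\<And>t. \<bar>t\<bar> \<le> \<bar>h\<bar> \<Longrightarrow> x + t *\<^sub>R axis i 1 \<in> S"
    and bound: "\<And>t. \<bar>t\<bar> \<le> \<bar>h\<bar> \<Longrightarrow> norm (f' (x + t *\<^sub>R axis i 1) - c) \<le> B"
  shows "norm (f (x + h *\<^sub>R axis i 1) - f x - h *\<^sub>R c) \<le> B * \<bar>h\<bar>"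
proof -
  let ?f = "\<lambda>t. f (x + t *\<^sub>R axis i 1) - t *\<^sub>R c"
  have le: "\<bar>t\<bar> \<le> \<bar>h\<bar>" if "t \<in> closed_segment 0 h" for t
    using that by (auto simp: closed_segment_eq_real_ivl split: if_splits)
  have deriv: "(?f has_vector_derivative f' (x + t *\<^sub>R axis i 1) - c) (at t)"
    if "t \<in> closed_segment 0 h" for t
    using has_partial_on_line[OF f S[OF le[OF that]]] by (auto intro!: derivative_eq_intros)
  have "norm (?f h - ?f 0) \<le> B * \<bar>h - 0\<bar>"
    by (rule norm_diff_le_vector_derivative_bound[OF deriv bound[OF le]])
  then show ?thesis by (simp add: algebra_simps)
qed

definition C1_on :: "(real^3) set \<Rightarrow> (real^3 \<Rightarrow> complex) \<Rightarrow> (3 \<Rightarrow> real^3 \<Rightarrow> complex) \<Rightarrow> bool" where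
  "C1_on S f Df \<longleftrightarrow> continuous_on S f \<and> (\<forall>i. has_partial_on f i (Df i) S \<and> continuous_on S (Df i))"

lemma C1_onD:
  assumes "C1_on S f Df"
  shows "continuous_on S f" "has_partial_on f i (Df i) S" "continuous_on S (Df i)"
  using assms by (auto simp: C1_on_def)

lemma C1_on_subset: "C1_on S f Df \<Longrightarrow> T \<subseteq> S \<Longrightarrow> C1_on T f Df"
  unfolding C1_on_def by (blast intro: continuous_on_subset has_partial_on_subset)

lemma C1_on_const: "C1_on S (\<lambda>x. c) (\<lambda>i x. 0)"
  unfolding C1_on_def by (simp add: has_partial_on_const)

lemma C1_on_add:
  assumes "C1_on S f Df" "C1_on S g Dg"
  shows "C1_on S (\<lambda>x. f x + g x) (\<lambda>i x. Df i x + Dg i x)"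
  using assms unfolding C1_on_def by (auto intro!: has_partial_on_add continuous_intros)

lemma C1_on_diff:
  assumes "C1_on S f Df" "C1_on S g Dg"
  shows "C1_on S (\<lambda>x. f x - g x) (\<lambda>i x. Df i x - Dg i x)"
  using assms unfolding C1_on_def by (auto intro!: has_partial_on_diff continuous_intros)

lemma C1_on_mult:
  assumes "C1_on S f Df" "C1_on S g Dg"
  shows "C1_on S (\<lambda>x. f x * g x) (\<lambda>i x. Df i x * g x + f x * Dg i x)"
  unfolding C1_on_def using C1_onD[OF assms(1)] C1_onD[OF assms(2)]
  by (auto intro!: has_partial_on_mult continuous_intros)

lemma C1_on_cnj: "C1_on S f Df \<Longrightarrow> C1_on S (\<lambda>x. cnj (f x)) (\<lambda>i x. cnj (Df i x))"
  unfolding C1_on_def has_partial_on_def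
  by (auto intro!: continuous_intros has_vector_derivative_cnj)

lemma C1_on_locally:
  assumes "\<And>x. x \<in> S \<Longrightarrow> \<exists>U. open U \<and> x \<in> U \<and> C1_on U f Df"
  shows "C1_on S f Df"
proof -
  have "isCont f x" "isCont (Df i) x" "((\<lambda>t. f (x + t *\<^sub>R axis i 1))
      has_vector_derivative Df i x) (at 0)"
    if "x \<in> S" for x i
    using assms[OF that] unfolding C1_on_def has_partial_on_def
    by (auto simp: continuous_on_eq_continuous_at)
  then show ?thesis
    unfolding C1_on_def has_partial_on_def by (auto intro: continuous_at_imp_continuous_on)
qed

lemma C1_on_cong:
  assumes "C1_on S f Df" "open S" "\<And>x. x \<in> S \<Longrightarrow> f x = g x" "\<And>i x. x \<in> S \<Longrightarrow> Df i x = Dg i x"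
  shows "C1_on S g Dg"
  using assms unfolding C1_on_def
  by (auto intro: has_partial_on_cong cong: continuous_on_cong_simp)

lemma continuous_on_UNIV_compact_support:
  assumes "open D" "continuous_on D f" "closed K" "K \<subseteq> D" "\<And>x. x \<notin> K \<Longrightarrow> f x = 0"
  shows "continuous_on UNIV f"
proof -
  have "continuous_on (- K) f" by (rule continuous_on_eq[OF continuous_on_const[of _ 0]])
    (use assms in auto)
  moreover have "UNIV = D \<union> - K" using assms(4) by auto
  ultimately show ?thesis using assms by (metis continuous_on_open_Un open_Compl)
qed

lemma C1_on_UNIV_mult_compact_support:
  assumes "open D" and f: "C1_on D f Df" and g: "C1_on UNIV g Dg"
    and K: "compact K" "K \<subseteq> D" "\<And>x. x \<notin> K \<Longrightarrow> g x = 0"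
  shows "C1_on UNIV (\<lambda>x. f x * g x) (\<lambda>i x. Df i x * g x + f x * Dg i x)"
proof (rule C1_on_locally)
  fix x
  have Dg0: "Dg i y = 0" if "y \<notin> K" for i y by (rule
    partial_eq_0_outside[OF C1_onD(2)[OF g] K(1,3) that])
  have "C1_on D (\<lambda>x. f x * g x) (\<lambda>i x. Df i x * g x + f x * Dg i x)"
    by (rule C1_on_mult[OF f C1_on_subset[OF g]]) simp
  moreover have "C1_on (- K) (\<lambda>x. f x * g x) (\<lambda>i x. Df i x * g x + f x * Dg i x)"
    by (rule C1_on_cong[OF C1_on_const[of _ 0]]) (use K Dg0 in \<open>auto simp: compact_imp_closed\<close>)
  moreover have "x \<in> D \<or> x \<in> - K" using K(2) by blast
  ultimately show "\<exists>U. open U \<and> x \<in> U \<and> C1_on U (\<lambda>x. f x * g x) (\<lambda>i x. Df i x * g x + f x * Dg i x)"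
    using assms(1) K(1) by (meson compact_imp_closed open_Compl)
qed

definition directional :: "real^3 \<Rightarrow> (3 \<Rightarrow> real^3 \<Rightarrow> complex) \<Rightarrow> real^3 \<Rightarrow> complex" where
  "directional v Df x = (\<Sum>i\<in>UNIV. of_real (v $ i) * Df i x)"

lemma C1_on_increment_le:
  fixes h x :: "real^3"
  assumes p: "C1_on S u p" and S: "\<And>y. norm (y - x) \<le> norm h \<Longrightarrow> y \<in> S"
    and bound: "\<And>y i. norm (y - x) \<le> norm h \<Longrightarrow> cmod (p i y - p i x) \<le> B"
  shows "cmod (u (x + h) - u x - directional h p x) \<le> B * (3 * norm h)"
proof -
  define x1 where "x1 = x + h $ 1 *\<^sub>R axis 1 1"
  define x2 where "x2 = x1 + h $ 2 *\<^sub>R axis 2 1"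
  have end_point: "x + h = x2 + h $ 3 *\<^sub>R axis 3 1"
    by (simp add: x1_def x2_def vec_eq_iff forall_3 axis_def)
  have near: "norm (y - x) \<le> norm h" if "\<And>i. \<bar>y $ i - x $ i\<bar> \<le> \<bar>h $ i\<bar>" for y
    by (rule norm_le_componentwise_cart) (use that in simp)
  have increment: "cmod (u (z + h $ i *\<^sub>R axis i 1) - u z - h $ i *\<^sub>R p i x) \<le> B * \<bar>h $ i\<bar>"
    if "\<And>t. \<bar>t\<bar> \<le> \<bar>h $ i\<bar> \<Longrightarrow> norm (z + t *\<^sub>R axis i 1 - x) \<le> norm h" for z i
    by (rule norm_partial_increment_le[OF C1_onD(2)[OF p] S bound]) (use that in auto)
  have "u (x + h) - u x - directional h p x
      = (u x1 - u x - h $ 1 *\<^sub>R p 1 x) + (u x2 - u x1 - h $ 2 *\<^sub>R p 2 x)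
        + (u (x + h) - u x2 - h $ 3 *\<^sub>R p 3 x)"
    by (simp add: directional_def sum_3 scaleR_conv_of_real)
  also have "cmod \<dots> \<le> B * \<bar>h $ 1\<bar> + B * \<bar>h $ 2\<bar> + B * \<bar>h $ 3\<bar>"
    unfolding end_point x2_def unfolding x1_def
    by (intro norm_triangle_mono increment near) (auto simp: forall_3 axis_def)
  also have "\<dots> \<le> B * norm h + B * norm h + B * norm h"
  proof -
    have "B \<ge> 0" using order_trans[OF norm_ge_zero bound[of x]] by simp
    then show ?thesis by (intro add_mono mult_left_mono component_le_norm_cart)
  qed
  finally show ?thesis by simp
qed

lemma C1_on_has_derivative:
  assumes "open S" and p: "C1_on S u p" and x: "x \<in> S"
  shows "(u has_derivative (\<lambda>h. directional h p x)) (at x)"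
  unfolding has_derivative_at_alt
proof (intro conjI allI impI)
  show "bounded_linear (\<lambda>h. directional h p x)"
    unfolding directional_def
    by (intro bounded_linear_sum bounded_linear_mult_const
      bounded_linear_of_real[THEN bounded_linear_compose]
        bounded_linear_vec_nth)
  fix e :: real assume e: "e > 0"
  have "\<forall>i. \<exists>d>0. \<forall>y. dist y x < d \<longrightarrow> y \<in> S \<and> dist (p i y) (p i x) < e / 3"
  proof
    fix i
    have "\<forall>\<^sub>F y in nhds x. dist (p i y) (p i x) < e / 3"
      using C1_onD(3)[OF p, of i] assms(1) x e
      by (intro tendstoD) (auto simp: continuous_on_eq_continuous_at isCont_def
        tendsto_at_iff_tendsto_nhds)
    moreover have "\<forall>\<^sub>F y in nhds x. y \<in> S" using assms(1) x by (rule eventually_nhds_in_open)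
    ultimately have "\<forall>\<^sub>F y in nhds x. y \<in> S \<and> dist (p i y) (p i x) < e / 3" by eventually_elim simp
    then show "\<exists>d>0. \<forall>y. dist y x < d \<longrightarrow> y \<in> S \<and> dist (p i y) (p i x) < e / 3"
      unfolding eventually_nhds_metric .
  qed
  then obtain d where d: "\<And>i. d i > 0" "\<And>i y. dist y x < d i \<Longrightarrow> y \<in> S \<and> dist (p i y) (p i x) < e / 3"
    by metis
  have "Min (range d) > 0" using d(1) by simp
  moreover have "norm (u y - u x - directional (y - x) p x) \<le> e * norm (y - x)"
    if "norm (y - x) < Min (range d)" for y
  proof -
    have near: "z \<in> S \<and> dist (p i z) (p i x) < e / 3" if "norm (z - x) \<le> norm (y - x)" for z i
      using d(2)[of z i] that \<open>norm (y - x) < Min (range d)\<close>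
      by (simp add: dist_norm order_le_less_trans)
    have "cmod (u (x + (y - x)) - u x - directional (y - x) p x) \<le> e / 3 * (3 * norm (y - x))"
      by (rule C1_on_increment_le[OF p]) (use near in \<open>auto simp: dist_norm intro: less_imp_le\<close>)
    then show ?thesis by simp
  qed
  ultimately show "\<exists>d>0. \<forall>y. norm (y - x) < d \<longrightarrow>
      norm (u y - u x - directional (y - x) p x) \<le> e * norm (y - x)"
    by blast
qed

lemma C1_on_has_vector_derivative_line:
  assumes "open S" "C1_on S u p" "x + t *\<^sub>R v \<in> S"
  shows "((\<lambda>t. u (x + t *\<^sub>R v)) has_vector_derivative directional v p (x + t *\<^sub>R v)) (at t)"
proof -
  have "((\<lambda>t. x + t *\<^sub>R v) has_derivative (\<lambda>s. s *\<^sub>R v)) (at t)" by (auto intro!: derivative_eq_intros)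
  from diff_chain_at[OF this C1_on_has_derivative[OF assms]]
  have "((\<lambda>t. u (x + t *\<^sub>R v)) has_derivative (\<lambda>s. directional (s *\<^sub>R v) p (x + t *\<^sub>R v))) (at t)"
    by (simp add: o_def)
  moreover have "directional (s *\<^sub>R v) p y = s *\<^sub>R directional v p y" for s y
    unfolding directional_def scaleR_conv_of_real[where 'a=complex]
    by (simp add: sum_distrib_left mult.assoc)
  ultimately show ?thesis by (simp add: has_vector_derivative_def)
qed

lemma integral_partial_eq_0:
  fixes f :: "real^3 \<Rightarrow> complex"
  assumes f: "continuous_on UNIV f" "has_partial_on f i f' UNIV" "continuous_on UNIV f'"
    and K: "compact K" "\<And>x. x \<notin> K \<Longrightarrow> f x = 0"
  shows "(LINT x|lborel. f' x) = 0"
proof -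
  have f': "f' x = 0" if "x \<notin> K" for x by (rule partial_eq_0_outside[OF f(2) K that])
  obtain B where B: "B > 0" "\<And>x. norm (f' x) \<le> B"
    using bounded_continuous_compact_support[OF f(3) K(1) f'] by blast
  obtain r where r: "\<And>x. x \<in> K \<Longrightarrow> norm x \<le> r"
    using compact_imp_bounded[OF K(1)] unfolding bounded_iff by auto
  have f_meas: "f \<in> borel_measurable borel" using f(1) by (rule borel_measurable_continuous_onI)
  have translate: "(LINT x|lborel. f (x + t *\<^sub>R axis i 1)) = (LINT x|lborel. f x)" for t
    using lborel_integral_affine[OF f_meas, of 1 "t *\<^sub>R axis i 1"] by (simp add: add.commute)
  have "((\<lambda>t. LINT x|lborel. f (x + t *\<^sub>R axis i 1))
      has_vector_derivative (LINT x|lborel. f' x)) (at 0)"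
  proof (rule has_vector_derivative_integral)
    show "integrable lborel (\<lambda>x. B * indicator (cball 0 (r + 1)) (x::real^3) :: real)"
      by (rule integrable_indicator_compact[OF compact_cball])
    show "integrable lborel (\<lambda>x. f (x + t *\<^sub>R axis i 1))" for t
      by (intro integrable_lborel_translate integrable_continuous_compact_support[OF f(1) K(1)
        subset_UNIV K(2)])
    show "((\<lambda>t. f (x + t *\<^sub>R axis i 1)) has_vector_derivative f' x) (at 0)" for x
      using f(2) by (simp add: has_partial_on_def)
    fix t :: real and x :: "real^3"
    assume t: "\<bar>t - 0\<bar> < 1"
    show "norm (f (x + t *\<^sub>R axis i 1) - f (x + 0 *\<^sub>R axis i 1))
        \<le> \<bar>t - 0\<bar> * (B * indicator (cball 0 (r + 1)) x)"
    proof (cases "x \<in> cball 0 (r + 1)")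
      case True
      then show ?thesis
        using norm_partial_increment_le[OF f(2), of t x 0 B] B(2) by (simp add: mult.commute)
    next
      case False
      then have "x \<notin> K" "x + t *\<^sub>R axis i 1 \<notin> K"
        using r[of x] r[of "x + t *\<^sub>R axis i 1"] t norm_triangle_ineq4[of "x
            + t *\<^sub>R axis i 1" "t *\<^sub>R axis i 1"] by auto
      then show ?thesis using K(2) B(1) by simp
    qed
  qed simp
  then show ?thesis unfolding translate using has_vector_derivative_const vector_derivative_unique_at
    by blast
qed

lemma integration_by_parts_compact_support:
  fixes f g :: "real^3 \<Rightarrow> complex"
  assumes D: "open D" and f: "continuous_on D f" "has_partial_on f i f' D" "continuous_on D f'"
    and g: "continuous_on UNIV g" "has_partial_on g i g' UNIV" "continuous_on UNIV g'"
    and K: "compact K" "K \<subseteq> D" "\<And>x. x \<notin> K \<Longrightarrow> g x = 0"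
  shows "(LINT x|lborel. f' x * g x + f x * g' x) = 0"
proof (rule integral_partial_eq_0[OF _ _ _ K(1), of "\<lambda>x. f x * g x" i])
  note closed = compact_imp_closed[OF K(1)]
  have g': "g' x = 0" if "x \<notin> K" for x by (rule partial_eq_0_outside[OF g(2) K(1,3) that])
  note gD = continuous_on_subset[OF g(1) subset_UNIV, of D]
    continuous_on_subset[OF g(3) subset_UNIV, of D]
  show "continuous_on UNIV (\<lambda>x. f x * g x)"
    by (rule continuous_on_UNIV_compact_support[OF D _ closed K(2)])
      (use f gD K(3) in \<open>auto intro!: continuous_intros\<close>)
  show "continuous_on UNIV (\<lambda>x. f' x * g x + f x * g' x)"
    by (rule continuous_on_UNIV_compact_support[OF D _ closed K(2)])
      (use f gD K(3) g' in \<open>auto intro!: continuous_intros\<close>)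
  have "has_partial_on (\<lambda>x. f x * g x) i (\<lambda>x. f' x * g x + f x * g' x) D"
    by (rule has_partial_on_mult[OF f(2) has_partial_on_subset[OF g(2)]]) simp
  moreover have "has_partial_on (\<lambda>x. f x * g x) i (\<lambda>x. f' x * g x + f x * g' x) (- K)"
    by (rule has_partial_on_cong[OF has_partial_on_const]) (use closed K g' in auto)
  moreover have "UNIV = D \<union> - K" using K(2) by auto
  ultimately show "has_partial_on (\<lambda>x. f x * g x) i (\<lambda>x. f' x * g x + f x * g' x) UNIV"
    unfolding has_partial_on_def by blast
qed (use K in auto)

lemma has_partial_on_scale:
  fixes f :: "real^3 \<Rightarrow> complex"
  assumes "has_partial_on f i f' UNIV"
  shows "has_partial_on (\<lambda>y. f (t *\<^sub>R y)) i (\<lambda>y. of_real t * f' (t *\<^sub>R y)) UNIV"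
  unfolding has_partial_on_def
proof
  fix y
  have "((\<lambda>s. t * s) has_vector_derivative t) (at 0)" by (auto intro!: derivative_eq_intros)
  from vector_diff_chain_at[OF this, of "\<lambda>s. f (t *\<^sub>R y + s *\<^sub>R axis i 1)" "f' (t *\<^sub>R y)"] assms
  show "((\<lambda>s. f (t *\<^sub>R (y + s *\<^sub>R axis i 1))) has_vector_derivative of_real t * f' (t *\<^sub>R y)) (at 0)"
    by (simp add: has_partial_on_def o_def scaleR_add_right scaleR_conv_of_real[where 'a=complex])
qed

section \<open>A polynomial smooth step\<close>

definition clamp01 :: "real \<Rightarrow> real" where "clamp01 x = max 0 (min 1 x)"

lemma clamp01_bounds: "0 \<le> clamp01 x" "clamp01 x \<le> 1"
  by (auto simp: clamp01_def)

lemma clamp01_eq: "x \<le> 0 \<Longrightarrow> clamp01 x = 0" "x \<ge> 1 \<Longrightarrow> clamp01 x = 1"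
  "0 \<le> x \<Longrightarrow> x \<le> 1 \<Longrightarrow> clamp01 x = x"
  by (auto simp: clamp01_def)

lemma has_real_derivative_clamp01:
  assumes P: "\<And>x. (P has_real_derivative Q x) (at x)" and Q: "Q 0 = 0" "Q 1 = 0"
  shows "((\<lambda>x. P (clamp01 x)) has_real_derivative Q (clamp01 x)) (at x)"
proof -
  have piece: "((\<lambda>x. P (clamp01 x)) has_real_derivative Q (clamp01 x)) (at x within S)"
    if "closed S" and eq: "\<And>y. y \<in> S \<Longrightarrow> P (clamp01 y) = G y"
      and G: "x \<in> S \<Longrightarrow> (G has_real_derivative Q (clamp01 x)) (at x)" for S G
  proof (cases "x \<in> S")
    case True
    from has_field_derivative_at_within[OF G[OF True]] show ?thesis
      by (rule has_field_derivative_transform_within[OF _ zero_less_one True]) (simp add: eq)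
  next
    case False
    then have "at x within S = bot" using \<open>closed S\<close> by (intro not_in_closure_trivial_limitI) simp
    then show ?thesis by (simp add: has_field_derivative_iff)
  qed
  have "{..0} \<union> ({0..1} \<union> {1..}) = (UNIV :: real set)" by auto
  then have at_eq: "at x = sup (at x within {..0}) (sup (at x within {0..1}) (at x within {1..}))"
    by (metis at_within_union)
  have "((\<lambda>x. P (clamp01 x)) has_real_derivative Q (clamp01 x)) (at x within {..0})"
    by (rule piece[of _ "\<lambda>_. P 0"]) (use Q in \<open>auto simp: clamp01_eq\<close>)
  moreover have "((\<lambda>x. P (clamp01 x)) has_real_derivative Q (clamp01 x)) (at x within {0..1})"
    by (rule piece[of _ P]) (use P[of x] in \<open>auto simp: clamp01_eq\<close>)
  moreover have "((\<lambda>x. P (clamp01 x)) has_real_derivative Q (clamp01 x)) (at x within {1..})"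
    by (rule piece[of _ "\<lambda>_. P 1"]) (use Q in \<open>auto simp: clamp01_eq\<close>)
  ultimately have "((\<lambda>y. (P (clamp01 y) - P (clamp01 x)) / (y - x)) \<longlongrightarrow> Q (clamp01 x)) (at x)"
    unfolding has_field_derivative_iff by (subst at_eq) (auto intro!: filterlim_sup)
  then show ?thesis by (simp add: has_field_derivative_iff)
qed

definition smoothstep :: "real \<Rightarrow> real" where
  "smoothstep x = (let c = clamp01 x in c^4 * (35 - 84*c + 70*c^2 - 20*c^3))"
definition smoothstep1 :: "real \<Rightarrow> real" where
  "smoothstep1 x = (let c = clamp01 x in 140 * c^3 * (1-c)^3)"
definition smoothstep2 :: "real \<Rightarrow> real" where
  "smoothstep2 x = (let c = clamp01 x in 420 * c^2 * (1-c)^2 * (1-2*c))"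
definition smoothstep3 :: "real \<Rightarrow> real" where
  "smoothstep3 x = (let c = clamp01 x in 840 * c * (1-c) * (1 - 5*c + 5*c^2))"

lemmas smoothstep_defs = smoothstep_def smoothstep1_def smoothstep2_def smoothstep3_def

lemma has_real_derivative_smoothstep:
  "(smoothstep has_real_derivative smoothstep1 x) (at x)"
  "(smoothstep1 has_real_derivative smoothstep2 x) (at x)"
  "(smoothstep2 has_real_derivative smoothstep3 x) (at x)"
proof -
  have "((\<lambda>x. (\<lambda>c. c^4 * (35 - 84*c + 70*c^2 - 20*c^3)) (clamp01 x)) has_real_derivative
     (\<lambda>c. 140 * c^3 * (1-c)^3) (clamp01 x)) (at x)"
    by (rule has_real_derivative_clamp01, (rule derivative_eq_intros refl)+)
      (auto simp: algebra_simps power2_eq_square power3_eq_cube power4_eq_xxxx)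
  then show "(smoothstep has_real_derivative smoothstep1 x) (at x)"
    by (simp add: smoothstep_defs[abs_def] Let_def)
  have "((\<lambda>x. (\<lambda>c. 140 * c^3 * (1-c)^3) (clamp01 x)) has_real_derivative
     (\<lambda>c. 420 * c^2 * (1-c)^2 * (1-2*c)) (clamp01 x)) (at x)"
    by (rule has_real_derivative_clamp01, (rule derivative_eq_intros refl)+)
      (auto simp: algebra_simps power2_eq_square power3_eq_cube power4_eq_xxxx)
  then show "(smoothstep1 has_real_derivative smoothstep2 x) (at x)"
    by (simp add: smoothstep_defs[abs_def] Let_def)
  have "((\<lambda>x. (\<lambda>c. 420 * c^2 * (1-c)^2 * (1-2*c)) (clamp01 x)) has_real_derivative
     (\<lambda>c. 840 * c * (1-c) * (1 - 5*c + 5*c^2)) (clamp01 x)) (at x)"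
    by (rule has_real_derivative_clamp01, (rule derivative_eq_intros refl)+)
      (auto simp: algebra_simps power2_eq_square power3_eq_cube power4_eq_xxxx)
  then show "(smoothstep2 has_real_derivative smoothstep3 x) (at x)"
    by (simp add: smoothstep_defs[abs_def] Let_def)
qed

lemma continuous_on_smoothstep [continuous_intros]:
  assumes "continuous_on S f"
  shows "continuous_on S (\<lambda>x. smoothstep (f x))" "continuous_on S (\<lambda>x. smoothstep1 (f x))"
    "continuous_on S (\<lambda>x. smoothstep2 (f x))" "continuous_on S (\<lambda>x. smoothstep3 (f x))"
  unfolding smoothstep_defs clamp01_def Let_def by (intro continuous_intros assms)+

lemma smoothstep_left:
  assumes "x \<le> 0"
  shows "smoothstep x = 0" "smoothstep1 x = 0" "smoothstep2 x = 0" "smoothstep3 x = 0"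
  using assms by (simp_all add: smoothstep_defs clamp01_eq)

lemma smoothstep_right:
  assumes "x \<ge> 1"
  shows "smoothstep x = 1" "smoothstep1 x = 0" "smoothstep2 x = 0" "smoothstep3 x = 0"
  using assms by (simp_all add: smoothstep_defs clamp01_eq)

lemma smoothstep1_nonneg: "smoothstep1 x \<ge> 0"
  using clamp01_bounds[of x] by (auto simp: smoothstep1_def Let_def)

lemma smoothstep1_pos: "0 < x \<Longrightarrow> x < 1 \<Longrightarrow> smoothstep1 x > 0"
  by (auto simp: smoothstep1_def Let_def clamp01_eq)

lemma smoothstep1_le: "smoothstep1 x \<le> 140"
proof -
  have "clamp01 x ^ 3 * (1 - clamp01 x)^3 \<le> 1 * 1"
    using clamp01_bounds[of x] by (intro mult_mono power_le_one) auto
  then show ?thesis by (simp add: smoothstep1_def Let_def)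
qed

lemma mono_smoothstep: "x \<le> y \<Longrightarrow> smoothstep x \<le> smoothstep y"
  by (rule DERIV_nonneg_imp_nondecreasing) (use has_real_derivative_smoothstep(1)
    smoothstep1_nonneg in blast)+

lemma smoothstep_bounds: "0 \<le> smoothstep x" "smoothstep x \<le> 1"
  using mono_smoothstep[of "min x 0" x] mono_smoothstep[of x "max x 1"]
    smoothstep_left(1)[of "min x 0"] smoothstep_right(1)[of "max x 1"]
  by auto

section \<open>Radial functions\<close>

definition dsq :: "real^3 \<Rightarrow> real^3 \<Rightarrow> real" where
  "dsq c y = (norm (y - c))^2"

lemma dsq_nonneg [simp]: "0 \<le> dsq c y"
  by (simp add: dsq_def)

lemma sqrt_dsq: "sqrt (dsq c y) = norm (y - c)"
  by (simp add: dsq_def)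

lemma dsq_0: "dsq 0 y = (norm y)^2"
  by (simp add: dsq_def)

lemma dsq_eq_sum: "dsq c y = (\<Sum>i\<in>UNIV. ((y - c) $ i)^2)"
  unfolding dsq_def power2_norm_eq_inner by (simp add: inner_vec_def power2_eq_square)

lemma dsq_le_iff: "r \<ge> 0 \<Longrightarrow> dsq c y \<le> r^2 \<longleftrightarrow> norm (y - c) \<le> r"
  by (simp add: dsq_def abs_le_square_iff[symmetric])

lemma continuous_on_dsq [continuous_intros]:
  "continuous_on S f \<Longrightarrow> continuous_on S g \<Longrightarrow> continuous_on S (\<lambda>x. dsq (f x) (g x))"
  unfolding dsq_def by (intro continuous_intros)

lemma has_real_derivative_dsq_line:
  "((\<lambda>t. dsq c (x + t *\<^sub>R v)) has_real_derivative 2 * ((x + t *\<^sub>R v - c) \<bullet> v)) (at t)"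
proof -
  have "(\<lambda>t. dsq c (x + t *\<^sub>R v)) = (\<lambda>t. (x - c) \<bullet> (x - c) + 2 * t * ((x - c) \<bullet> v) + t^2 * (v \<bullet> v))"
    unfolding dsq_def power2_norm_eq_inner
    by (simp add: fun_eq_iff inner_add_left inner_add_right inner_diff_left
      inner_diff_right inner_commute
        algebra_simps power2_eq_square)
  then show ?thesis
    by (auto intro!: derivative_eq_intros simp: inner_add_left inner_diff_left algebra_simps)
qed

text \<open>
  A radial function is written as \<open>h (dsq c y)\<close>, a function of the squared distance; a digit at the
  end of a name counts derivatives with respect to this variable.
\<close>

definition radial_partial :: "(real \<Rightarrow> complex) \<Rightarrow> real^3 \<Rightarrow> 3 \<Rightarrow> real^3 \<Rightarrow> complex" where
  "radial_partial h1 c i y = of_real (2 * (y - c) $ i) * h1 (dsq c y)"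

definition radial_partial2 ::
  "(real \<Rightarrow> complex) \<Rightarrow> (real \<Rightarrow> complex) \<Rightarrow> real^3 \<Rightarrow> 3 \<Rightarrow> real^3 \<Rightarrow> complex" where
  "radial_partial2 h1 h2 c i y = 2 * h1 (dsq c y) + of_real (4 * ((y - c) $ i)^2) * h2 (dsq c y)"

lemma has_partial_on_radial:
  assumes "\<And>s. (h has_vector_derivative h1 s) (at s)"
  shows "has_partial_on (\<lambda>y. h (dsq c y)) i (radial_partial h1 c i) S"
  unfolding has_partial_on_def
proof
  fix x
  have "((\<lambda>t. dsq c (x + t *\<^sub>R axis i 1)) has_vector_derivative 2 * (x - c) $ i) (at 0)"
    using has_real_derivative_dsq_line[of c x "axis i 1" 0]
    by (simp add: inner_axis has_real_derivative_iff_has_vector_derivative)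
  from vector_diff_chain_at[OF this, of h] assms
  show "((\<lambda>t. h (dsq c (x + t *\<^sub>R axis i 1))) has_vector_derivative radial_partial h1 c i x) (at 0)"
    by (simp add: radial_partial_def o_def scaleR_conv_of_real)
qed

lemma has_partial_on_coordinate:
  "has_partial_on (\<lambda>y. complex_of_real (2 * (y - c) $ i)) i (\<lambda>y. 2) S"
  unfolding has_partial_on_def
proof
  fix x :: "real^3"
  have "((\<lambda>t. 2 * (x + t *\<^sub>R axis i 1 - c) $ i) has_real_derivative 2) (at 0)"
    by (auto intro!: derivative_eq_intros)
  from has_vector_derivative_of_real[OF this]
  show "((\<lambda>t. complex_of_real (2 * (x + t *\<^sub>R axis i 1 - c) $ i)) has_vector_derivative 2) (at 0)"
    by simp
qed

lemma has_partial_on_radial_partial: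
  assumes "\<And>s. (h1 has_vector_derivative h2 s) (at s)"
  shows "has_partial_on (radial_partial h1 c i) i (radial_partial2 h1 h2 c i) S"
proof -
  have "has_partial_on (\<lambda>y. complex_of_real (2 * (y - c) $ i) * h1 (dsq c y)) i
      (\<lambda>y. 2 * h1 (dsq c y) + of_real (2 * (y - c) $ i) * radial_partial h2 c i y) S"
    by (intro has_partial_on_mult has_partial_on_coordinate has_partial_on_radial assms)
  moreover have "radial_partial2 h1 h2 c i = (\<lambda>y. 2 * h1 (dsq c y)
      + of_real (2 * (y - c) $ i) * radial_partial h2 c i y)"
    by (simp add: fun_eq_iff radial_partial_def radial_partial2_def power2_eq_square algebra_simps)
  ultimately show ?thesis unfolding radial_partial_def[abs_def] by simp
qed

lemma directional_radial_partial:
  "directional v (radial_partial h1 c) y = of_real (2 * (v \<bullet> (y - c))) * h1 (dsq c y)"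
  by (simp add: directional_def radial_partial_def inner_vec_def sum_3 algebra_simps)

lemma sum_radial_partial2:
  "(\<Sum>i\<in>UNIV. radial_partial2 h1 h2 c i y) = 6 * h1 (dsq c y) + 4 * of_real (dsq c y) * h2 (dsq c y)"
  unfolding dsq_eq_sum[of c y] radial_partial2_def
  by (simp add: sum.distrib sum_distrib_right sum_3 algebra_simps)

lemma continuous_on_UNIV_has_vector_derivative:
  "(\<And>s. (h has_vector_derivative h1 s) (at s)) \<Longrightarrow> continuous_on UNIV h"
  by (rule continuous_at_imp_continuous_on) (blast intro: has_vector_derivative_continuous)

lemma continuous_on_radial:
  assumes "continuous_on UNIV h"
  shows "continuous_on S (\<lambda>y. h (dsq c y))"
  by (rule continuous_on_compose2[OF assms]) (auto intro!: continuous_intros)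

lemma continuous_on_radial_partial: "continuous_on UNIV h1 \<Longrightarrow> continuous_on S (radial_partial h1 c i)"
  unfolding radial_partial_def by (intro continuous_intros continuous_on_radial)

lemma continuous_on_radial_partial2:
  "continuous_on UNIV h1 \<Longrightarrow> continuous_on UNIV h2 \<Longrightarrow> continuous_on S (radial_partial2 h1 h2 c i)"
  unfolding radial_partial2_def by (intro continuous_intros continuous_on_radial)

lemma C1_on_radial:
  assumes "\<And>s. (h has_vector_derivative h1 s) (at s)" "continuous_on UNIV h1"
  shows "C1_on S (\<lambda>y. h (dsq c y)) (radial_partial h1 c)"
  unfolding C1_on_def using continuous_on_UNIV_has_vector_derivative[OF assms(1)]
  by (intro conjI allI continuous_on_radial continuous_on_radial_partial has_partial_on_radial assms)

lemma integral_radial_divergence_eq_0: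
  fixes h h1 :: "real \<Rightarrow> complex"
  assumes h: "\<And>s. (h has_vector_derivative h1 s) (at s)" "continuous_on UNIV h1"
    and support: "\<And>s. s \<ge> b^2 \<Longrightarrow> h s = 0" "b > 0"
  shows "(LINT v|lborel. 6 * h ((norm (v::real^3))^2) + 4 * of_real ((norm v)^2) * h1 ((norm v)^2)) = 0"
proof -
  have h_cont: "continuous_on UNIV h" by (rule continuous_on_UNIV_has_vector_derivative[OF h(1)])
  have outside: "radial_partial h 0 i v = 0" if "v \<notin> cball 0 b" for i v
  proof -
    have "\<not> dsq 0 v \<le> b^2" using that support(2) by (simp add: dsq_le_iff)
    then show ?thesis using support(1) by (simp add: radial_partial_def)
  qed
  note partial = has_partial_on_radial_partial[OF h(1)]
  note cont = continuous_on_radial_partial[OF h_cont] continuous_on_radial_partial2[OF h_cont h(2)]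
  have "integrable lborel (radial_partial2 h h1 0 i)" for i
    by (rule integrable_continuous_compact_support[OF cont(2) compact_cball subset_UNIV])
      (rule partial_eq_0_outside[OF partial compact_cball outside])
  moreover have "(LINT v|lborel. radial_partial2 h h1 0 i v) = 0" for i
    by (rule integral_partial_eq_0[OF cont(1) partial cont(2) compact_cball outside])
  ultimately have "(LINT v|lborel. (\<Sum>i\<in>UNIV. radial_partial2 h h1 0 i v)) = 0"
    by (simp add: Bochner_Integration.integral_sum)
  then show ?thesis unfolding sum_radial_partial2 dsq_0 .
qed

definition C2_fun ::
  "(real^3 \<Rightarrow> complex) \<Rightarrow> (3 \<Rightarrow> real^3 \<Rightarrow> complex) \<Rightarrow> (3 \<Rightarrow> real^3 \<Rightarrow> complex) \<Rightarrow> bool" where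
  "C2_fun e De DDe \<longleftrightarrow> C1_on UNIV e De \<and>
     (\<forall>i. has_partial_on (De i) i (DDe i) UNIV \<and> continuous_on UNIV (DDe i))"

definition helmholtz_op :: "real \<Rightarrow> (real^3 \<Rightarrow> complex) \<Rightarrow> (3 \<Rightarrow> real^3 \<Rightarrow> complex) \<Rightarrow> real^3 \<Rightarrow> complex" where
  "helmholtz_op k e DDe x = (\<Sum>i\<in>UNIV. DDe i x) + of_real (k^2) * e x"

lemma C2_funD:
  assumes "C2_fun e De DDe"
  shows "C1_on UNIV e De" "has_partial_on (De i) i (DDe i) UNIV" "continuous_on UNIV (DDe i)"
  using assms by (auto simp: C2_fun_def)

lemma C2_fun_radial:
  assumes "\<And>s. (h has_vector_derivative h1 s) (at s)" "\<And>s. (h1 has_vector_derivative h2 s) (at s)"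
    "continuous_on UNIV h2"
  shows "C2_fun (\<lambda>y. h (dsq c y)) (radial_partial h1 c) (radial_partial2 h1 h2 c)"
proof -
  have "continuous_on UNIV h1" by (rule continuous_on_UNIV_has_vector_derivative[OF assms(2)])
  then show ?thesis unfolding C2_fun_def
    by (intro conjI allI C1_on_radial has_partial_on_radial_partial continuous_on_radial_partial2 assms)
qed

lemma C2_fun_mult:
  assumes "C2_fun f Df DDf" "C2_fun g Dg DDg"
  shows "C2_fun (\<lambda>x. f x * g x) (\<lambda>i x. Df i x * g x + f x * Dg i x)
     (\<lambda>i x. (DDf i x * g x + Df i x * Dg i x) + (Df i x * Dg i x + f x * DDg i x))"
  unfolding C2_fun_def
  by (intro conjI allI C1_on_mult has_partial_on_add has_partial_on_mult continuous_intros
    C2_funD[OF assms(1)]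
      C2_funD[OF assms(2)] C1_onD[OF C2_funD(1)[OF assms(1)]] C1_onD[OF C2_funD(1)[OF assms(2)]])

lemma helmholtz_op_mult:
  "helmholtz_op k (\<lambda>x. f x * g x) (\<lambda>i x. (DDf i x * g x + Df i x * Dg i x)
      + (Df i x * Dg i x + f x * DDg i x)) x
     = helmholtz_op k f DDf x * g x + 2 * (\<Sum>i\<in>UNIV. Df i x * Dg i x) + f x * (\<Sum>i\<in>UNIV. DDg i x)"
  by (simp add: helmholtz_op_def sum_3 algebra_simps)

lemma helmholtz_op_radial:
  "helmholtz_op k (\<lambda>y. h (dsq c y)) (radial_partial2 h1 h2 c) y
     = 6 * h1 (dsq c y) + 4 * of_real (dsq c y) * h2 (dsq c y) + of_real (k^2) * h (dsq c y)"
  by (simp add: helmholtz_op_def sum_radial_partial2)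

lemma C2_fun_scale:
  assumes "C2_fun e De DDe"
  shows "C2_fun (\<lambda>y. e (t *\<^sub>R y)) (\<lambda>i y. of_real t * De i (t *\<^sub>R y))
      (\<lambda>i y. of_real t * (of_real t * DDe i (t *\<^sub>R y)))"
proof -
  have scale: "continuous_on UNIV (\<lambda>y. f (t *\<^sub>R y))" if "continuous_on UNIV f"
    for f :: "real^3 \<Rightarrow> complex"
    by (rule continuous_on_compose2[OF that]) (auto intro!: continuous_intros)
  have "has_partial_on (\<lambda>y. of_real t * De i (t *\<^sub>R y)) i
      (\<lambda>y. of_real t * (of_real t * DDe i (t *\<^sub>R y))) UNIV" for i
    using has_partial_on_mult[OF has_partial_on_const[of "of_real t"]
      has_partial_on_scale[OF C2_funD(2)[OF assms]]] by simp
  then show ?thesis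
    unfolding C2_fun_def C1_on_def using C1_onD[OF C2_funD(1)[OF assms]] C2_funD(3)[OF assms]
    by (auto intro!: continuous_intros scale has_partial_on_scale)
qed

lemma C2_fun_partials_eq_0_outside:
  assumes "C2_fun e De DDe" "compact K" "\<And>x. x \<notin> K \<Longrightarrow> e x = 0" "x \<notin> K"
  shows "De i x = 0" "DDe i x = 0"
proof -
  have De0: "De i x = 0" if "x \<notin> K" for x
    by (rule partial_eq_0_outside[OF C1_onD(2)[OF C2_funD(1)[OF assms(1)]] assms(2,3) that])
  show "De i x = 0" by (rule De0[OF assms(4)])
  show "DDe i x = 0" by (rule partial_eq_0_outside[OF C2_funD(2)[OF assms(1)] assms(2) De0 assms(4)])
qed

section \<open>The outgoing fundamental solution and its regularisation\<close>

definition phase :: "real \<Rightarrow> real \<Rightarrow> complex" where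
  "phase k s = exp (\<i> * k * of_real (sqrt s))"
definition fund :: "real \<Rightarrow> real \<Rightarrow> complex" where
  "fund k s = phase k s / of_real (sqrt s)"
definition fund1 :: "real \<Rightarrow> real \<Rightarrow> complex" where
  "fund1 k s = (let z = of_real (sqrt s) in phase k s * (\<i> * k * z - 1) / (2 * z^3))"
definition fund2 :: "real \<Rightarrow> real \<Rightarrow> complex" where
  "fund2 k s = (let z = of_real (sqrt s) in phase k s * (3 - 3 * \<i> * k * z - (k * z)^2) / (4 * z^5))"

lemmas fund_defs = fund_def fund1_def fund2_def phase_def

lemma norm_phase: "cmod (phase k s) = 1"
  by (simp add: phase_def)

lemma norm_fund: "cmod (fund k (dsq c y)) = 1 / norm (y - c)"
  by (simp add: fund_def norm_divide norm_phase sqrt_dsq)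

lemma has_vector_derivative_comp_sqrt:
  assumes "s > 0" "(F has_field_derivative F' * (2 * of_real (sqrt s))) (at (of_real (sqrt s)))"
  shows "((\<lambda>s. F (complex_of_real (sqrt s))) has_vector_derivative F') (at s)"
proof -
  have "((\<lambda>s. complex_of_real (sqrt s)) has_vector_derivative of_real (inverse (sqrt s) / 2)) (at s)"
    using DERIV_real_sqrt[OF assms(1)] by (rule has_vector_derivative_of_real)
  from field_vector_diff_chain_at[OF this assms(2)] show ?thesis
    using assms(1) by (simp add: o_def mult.left_commute)
qed

lemma has_vector_derivative_phase:
  assumes "s > 0"
  shows "(phase k has_vector_derivative \<i> * k * phase k s / (2 * of_real (sqrt s))) (at s)"
  unfolding phase_def[abs_def]
  by (rule has_vector_derivative_comp_sqrt[OF assms]) (use assms in \<open>auto intro!: derivative_eq_intros\<close>)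

lemma has_vector_derivative_fund:
  assumes "s > 0"
  shows "(fund k has_vector_derivative fund1 k s) (at s)"
    "(fund1 k has_vector_derivative fund2 k s) (at s)"
proof -
  have sqrt_nonzero: "complex_of_real (sqrt s) \<noteq> 0" using assms by simp
  show "(fund k has_vector_derivative fund1 k s) (at s)"
    unfolding fund_defs[abs_def] Let_def using assms sqrt_nonzero
    by (intro has_vector_derivative_comp_sqrt[where F="\<lambda>z. exp (\<i> * k * z) / z"])
       (auto intro!: derivative_eq_intros simp: divide_simps power2_eq_square power3_eq_cube,
         auto simp: algebra_simps)
  show "(fund1 k has_vector_derivative fund2 k s) (at s)"
    unfolding fund_defs[abs_def] Let_def using assms sqrt_nonzero
    by (intro has_vector_derivative_comp_sqrt[where F="\<lambda>z. exp (\<i> * k * z) * (\<i> * k * z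
        - 1) / (2 * z^3)"])
       (auto intro!: derivative_eq_intros simp: divide_simps, auto simp: algebra_simps
         power_numeral_reduce)
qed

lemma fund_ode:
  assumes "s > 0"
  shows "6 * fund1 k s + 4 * of_real s * fund2 k s + of_real (k^2) * fund k s = 0"
proof -
  define z where "z = complex_of_real (sqrt s)"
  have z: "z \<noteq> 0" "complex_of_real s = z^2" using assms by (auto simp: z_def simp flip: of_real_power)
  show ?thesis
    unfolding fund_def fund1_def fund2_def Let_def z_def[symmetric] using z(1)
    by (simp add: z(2) divide_simps) (simp add: algebra_simps power_numeral_reduce)
qed

lemma fund1_eq:
  assumes "s > 0"
  shows "fund1 k s = fund k s * (\<i> * k * of_real (sqrt s) - 1) / of_real (2 * s)"
proof -
  define z where "z = complex_of_real (sqrt s)"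
  have z: "z \<noteq> 0" "complex_of_real s = z^2" using assms by (auto simp: z_def simp flip: of_real_power)
  show ?thesis
    unfolding fund_def fund1_def Let_def z_def[symmetric] using z(1)
    by (simp add: z(2) divide_simps) (simp add: algebra_simps power_numeral_reduce)
qed

lemma continuous_on_fund:
  "continuous_on {0<..} (phase k)" "continuous_on {0<..} (fund k)"
  "continuous_on {0<..} (fund1 k)" "continuous_on {0<..} (fund2 k)"
  unfolding fund_defs Let_def by (auto intro!: continuous_intros)

lemma has_vector_derivative_mult_cutoff:
  fixes f :: "real \<Rightarrow> real" and g :: "real \<Rightarrow> complex"
  assumes f: "\<And>s. (f has_real_derivative f1 s) (at s)" "\<And>s. s \<le> a \<Longrightarrow> f s = 0"
    "\<And>s. s \<le> a \<Longrightarrow> f1 s = 0" and "a > 0"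
    and g: "\<And>s. s > 0 \<Longrightarrow> (g has_vector_derivative g1 s) (at s)"
  shows "((\<lambda>s. of_real (f s) * g s) has_vector_derivative of_real (f1 s) * g s
      + of_real (f s) * g1 s) (at s)"
proof (cases "s > 0")
  case True
  have "((\<lambda>s. complex_of_real (f s)) has_vector_derivative of_real (f1 s)) (at s)"
    using f(1) by (rule has_vector_derivative_of_real)
  from has_vector_derivative_mult[OF this g[OF True]] show ?thesis by (simp add: add.commute)
next
  case False
  then have "s \<in> {..<a}" using \<open>a > 0\<close> by simp
  moreover have "((\<lambda>s. of_real (f s) * g s) has_vector_derivative 0) (at s)"
    by (rule has_vector_derivative_transform_within_open[OF has_vector_derivative_const[of 0] _
      \<open>s \<in> {..<a}\<close>])
      (use f(2) in auto)
  ultimately show ?thesis using f(2,3) by simp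
qed

lemma continuous_on_mult_cutoff:
  fixes f :: "real \<Rightarrow> real" and g :: "real \<Rightarrow> complex"
  assumes "continuous_on UNIV f" "\<And>s. s \<le> a \<Longrightarrow> f s = 0" "a > 0" "continuous_on {0<..} g"
  shows "continuous_on UNIV (\<lambda>s. of_real (f s) * g s)"
proof (rule continuous_on_UNIV_compact_support[of "{0<..}" _ "{a..}"])
  show "continuous_on {0<..} (\<lambda>s. of_real (f s) * g s)"
    by (intro continuous_intros assms continuous_on_subset[OF assms(1)]) auto
qed (use assms in auto)

definition cutoff :: "real \<Rightarrow> real \<Rightarrow> real" where "cutoff e s = smoothstep (s / e^2 - 1)"
definition cutoff1 :: "real \<Rightarrow> real \<Rightarrow> real" where "cutoff1 e s = smoothstep1 (s / e^2 - 1) / e^2"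
definition cutoff2 :: "real \<Rightarrow> real \<Rightarrow> real" where "cutoff2 e s = smoothstep2 (s / e^2 - 1) / e^4"
definition cutoff3 :: "real \<Rightarrow> real \<Rightarrow> real" where "cutoff3 e s = smoothstep3 (s / e^2 - 1) / e^6"

lemmas cutoff_defs = cutoff_def cutoff1_def cutoff2_def cutoff3_def

lemma has_real_derivative_cutoff:
  assumes "e > 0"
  shows "(cutoff e has_real_derivative cutoff1 e s) (at s)"
    "(cutoff1 e has_real_derivative cutoff2 e s) (at s)"
    "(cutoff2 e has_real_derivative cutoff3 e s) (at s)"
proof -
  have rescale: "((\<lambda>s. s / e^2 - 1) has_real_derivative 1 / e^2) (at s)"
    using DERIV_diff[OF DERIV_cdivide[OF DERIV_ident, of "e^2"] DERIV_const[of 1]] by simp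
  note chain = has_real_derivative_smoothstep[THEN DERIV_chain2, OF rescale]
  show "(cutoff e has_real_derivative cutoff1 e s) (at s)"
    unfolding cutoff_defs[abs_def] using chain(1) by simp
  show "(cutoff1 e has_real_derivative cutoff2 e s) (at s)"
    unfolding cutoff_defs[abs_def] using DERIV_cdivide[OF chain(2), of "e^2"] by (simp flip: power_add)
  show "(cutoff2 e has_real_derivative cutoff3 e s) (at s)"
    unfolding cutoff_defs[abs_def] using DERIV_cdivide[OF chain(3), of "e^4"] by (simp flip: power_add)
qed

lemma continuous_on_cutoff [continuous_intros]:
  assumes "continuous_on S f"
  shows "continuous_on S (\<lambda>x. cutoff e (f x))" "continuous_on S (\<lambda>x. cutoff1 e (f x))"
    "continuous_on S (\<lambda>x. cutoff2 e (f x))" "continuous_on S (\<lambda>x. cutoff3 e (f x))"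
  unfolding cutoff_defs divide_inverse by (intro continuous_intros assms)+

lemma cutoff_inside:
  assumes "e > 0" "s \<le> e^2"
  shows "cutoff e s = 0" "cutoff1 e s = 0" "cutoff2 e s = 0" "cutoff3 e s = 0"
  using assms by (simp_all add: cutoff_defs smoothstep_left field_simps)

lemma cutoff_outside:
  assumes "e > 0" "s \<ge> 2 * e^2"
  shows "cutoff e s = 1" "cutoff1 e s = 0" "cutoff2 e s = 0" "cutoff3 e s = 0"
proof -
  have "s / e^2 - 1 \<ge> 1" using assms by (simp add: field_simps)
  then show "cutoff e s = 1" "cutoff1 e s = 0" "cutoff2 e s = 0" "cutoff3 e s = 0"
    by (simp_all add: cutoff_defs smoothstep_right)
qed

lemma cutoff_le_1: "cutoff e s \<le> 1"
  by (simp add: cutoff_def smoothstep_bounds)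

lemma cutoff1_nonneg: "cutoff1 e s \<ge> 0"
  by (simp add: cutoff1_def smoothstep1_nonneg)

lemma cutoff1_le: "cutoff1 e s \<le> 140 / e^2"
  unfolding cutoff1_def by (intro divide_right_mono smoothstep1_le) simp

lemma C2_fun_bump:
  assumes "e > 0"
  shows "C2_fun (\<lambda>x. complex_of_real (1 - cutoff e (dsq c x)))
    (radial_partial (\<lambda>s. of_real (- cutoff1 e s)) c) (radial_partial2 (\<lambda>s. of_real (- cutoff1 e s))
      (\<lambda>s. of_real (- cutoff2 e s)) c)"
proof (rule C2_fun_radial)
  show "((\<lambda>s. complex_of_real (1 - cutoff e s)) has_vector_derivative of_real (- cutoff1 e s)) (at s)"
    "((\<lambda>s. complex_of_real (- cutoff1 e s)) has_vector_derivative of_real (- cutoff2 e s)) (at s)" for s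
    using has_real_derivative_cutoff[OF assms, of s]
    by (auto intro!: has_vector_derivative_of_real derivative_eq_intros)
  show "continuous_on UNIV (\<lambda>s. complex_of_real (- cutoff2 e s))" using assms
    by (intro continuous_intros)
qed

lemma dsq_ge_of_norm_ge:
  assumes "e > 0" "norm (y - c) \<ge> 3 / 2 * e"
  shows "dsq c y \<ge> 2 * e^2"
proof -
  have "(3 / 2 * e)^2 \<le> dsq c y" unfolding dsq_def using assms by (intro power_mono) auto
  moreover have "2 * e^2 \<le> (3 / 2 * e)^2" by (simp add: power_mult_distrib power_divide)
  ultimately show ?thesis by linarith
qed

lemma cutoff_dsq_eq:
  assumes "e > 0"
  shows "norm (y - c) \<le> e \<Longrightarrow> cutoff e (dsq c y) = 0" "norm (y - c) \<le> e \<Longrightarrow> cutoff1 e (dsq c y) = 0"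
    "norm (y - c) \<ge> 2 * e \<Longrightarrow> cutoff e (dsq c y) = 1" "norm (y - c) \<ge> 2 * e \<Longrightarrow> cutoff1 e (dsq c y) = 0"
    "norm (y - c) \<ge> 2 * e \<Longrightarrow> cutoff2 e (dsq c y) = 0"
proof -
  have "dsq c y \<le> e^2" if "norm (y - c) \<le> e" using assms that by (simp add: dsq_le_iff)
  then show "norm (y - c) \<le> e \<Longrightarrow> cutoff e (dsq c y) = 0" "norm (y - c) \<le> e \<Longrightarrow> cutoff1 e (dsq c y) = 0"
    using cutoff_inside[OF assms] by auto
  have "2 * e^2 \<le> dsq c y" if "norm (y - c) \<ge> 2 * e"
    using dsq_ge_of_norm_ge[OF assms] that assms by simp
  then show "norm (y - c) \<ge> 2 * e \<Longrightarrow> cutoff e (dsq c y) = 1" "norm (y - c) \<ge> 2 * e \<Longrightarrow>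
      cutoff1 e (dsq c y) = 0"
    "norm (y - c) \<ge> 2 * e \<Longrightarrow> cutoff2 e (dsq c y) = 0"
    using cutoff_outside[OF assms] by auto
qed

definition regfund :: "real \<Rightarrow> real \<Rightarrow> real \<Rightarrow> complex" where
  "regfund k e s = cutoff e s * fund k s"
definition regfund1 :: "real \<Rightarrow> real \<Rightarrow> real \<Rightarrow> complex" where
  "regfund1 k e s = cutoff1 e s * fund k s + cutoff e s * fund1 k s"
definition regfund2 :: "real \<Rightarrow> real \<Rightarrow> real \<Rightarrow> complex" where
  "regfund2 k e s = cutoff2 e s * fund k s + cutoff1 e s * fund1 k s
      + (cutoff1 e s * fund1 k s + cutoff e s * fund2 k s)"

lemmas regfund_defs = regfund_def regfund1_def regfund2_def

text \<open>\<open>source k e\<close> is the Helmholtz operator applied to \<open>regfund k e\<close>; it replaces the Dirac measure.\<close>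

definition source :: "real \<Rightarrow> real \<Rightarrow> real \<Rightarrow> complex" where
  "source k e s = 6 * regfund1 k e s + 4 * of_real s * regfund2 k e s + of_real (k^2) * regfund k e s"

lemma has_vector_derivative_regfund:
  assumes e: "e > 0"
  shows "(regfund k e has_vector_derivative regfund1 k e s) (at s)"
    "(regfund1 k e has_vector_derivative regfund2 k e s) (at s)"
  unfolding regfund_defs[abs_def] using e
  by (intro has_vector_derivative_add has_vector_derivative_mult_cutoff[where a="e^2"]
    has_real_derivative_cutoff
      cutoff_inside has_vector_derivative_fund; simp)+

lemma continuous_on_regfund:
  assumes e: "e > 0"
  shows "continuous_on UNIV (regfund k e)" "continuous_on UNIV (regfund1 k e)"
    "continuous_on UNIV (regfund2 k e)"
  unfolding regfund_defs[abs_def] using e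
  by (intro continuous_on_add continuous_on_mult_cutoff[where a="e^2"] continuous_on_fund cutoff_inside
      continuous_on_cutoff continuous_on_id; simp)+

lemma regfund_eq_fund:
  assumes "e > 0" "s \<ge> 2 * e^2"
  shows "regfund k e s = fund k s" "regfund1 k e s = fund1 k s" "regfund2 k e s = fund2 k s"
  using cutoff_outside[OF assms] by (auto simp: regfund_defs)

lemma source_eq:
  assumes e: "e > 0"
  shows "source k e s = of_real (2 * cutoff1 e s + 4 * s * cutoff2 e s) * fund k s
    + of_real (cutoff1 e s) * (4 * \<i> * k * phase k s)"
proof (cases "s > 0")
  case True
  have "source k e s = of_real (6 * cutoff1 e s + 4 * s * cutoff2 e s) * fund k s
      + 8 * of_real (cutoff1 e s * s) * fund1 k s
     + of_real (cutoff e s) * (6 * fund1 k s + 4 * of_real s * fund2 k s + of_real (k^2) * fund k s)"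
    by (simp add: source_def regfund_defs algebra_simps)
  also have "\<dots> = of_real (6 * cutoff1 e s + 4 * s * cutoff2 e s) * fund k s
     + 4 * of_real (cutoff1 e s) * (fund k s * (\<i> * k * of_real (sqrt s) - 1))"
    using fund_ode[OF True] fund1_eq[OF True] True by simp
  also have "fund k s * (\<i> * k * of_real (sqrt s) - 1) = \<i> * k * phase k s - fund k s"
    using True by (simp add: fund_def right_diff_distrib)
  finally show ?thesis by (simp add: algebra_simps)
next
  case False
  then have "s \<le> e^2" using e by (meson zero_le_power2 not_le order_trans)
  then show ?thesis by (simp add: source_def regfund_defs e cutoff_inside)
qed

lemma source_eq_0:
  assumes "e > 0" "s \<le> e^2 \<or> s \<ge> 2 * e^2"
  shows "source k e s = 0"
  using assms cutoff_inside[of e s] cutoff_outside[of e s] by (auto simp: source_eq)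

lemma source_dsq_eq_0:
  assumes "e > 0" "norm (y - c) \<ge> 3 / 2 * e"
  shows "source k e (dsq c y) = 0"
  using source_eq_0[OF assms(1)] dsq_ge_of_norm_ge[OF assms] by blast

lemma continuous_on_source: "e > 0 \<Longrightarrow> continuous_on UNIV (source k e)"
  unfolding source_def[abs_def] by (intro continuous_intros continuous_on_regfund)

definition source1 :: "real \<Rightarrow> real \<Rightarrow> real \<Rightarrow> complex" where
  "source1 k e s = of_real (6 * cutoff2 e s + 4 * s * cutoff3 e s) * fund k s
     + of_real (2 * cutoff1 e s + 4 * s * cutoff2 e s) * fund1 k s
     + (of_real (cutoff2 e s) * (4 * \<i> * k * phase k s)
     + of_real (cutoff1 e s) * (4 * \<i> * k * (\<i> * k * phase k s / (2 * of_real (sqrt s)))))"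

lemma has_vector_derivative_source:
  assumes e: "e > 0"
  shows "(source k e has_vector_derivative source1 k e s) (at s)"
proof -
  have "((\<lambda>s. 2 * cutoff1 e s + 4 * s * cutoff2 e s) has_real_derivative 6 * cutoff2 e s
      + 4 * s * cutoff3 e s) (at s)" for s
    by (rule derivative_eq_intros has_real_derivative_cutoff e refl | simp)+
  moreover have "((\<lambda>s. 4 * \<i> * k * phase k s) has_vector_derivative
      4 * \<i> * k * (\<i> * k * phase k s / (2 * of_real (sqrt s)))) (at s)" if "s > 0" for s
    by (intro has_vector_derivative_mult_right has_vector_derivative_phase that)
  ultimately show ?thesis
    unfolding source_eq[OF e, abs_def] source1_def using e
    by (intro has_vector_derivative_add has_vector_derivative_mult_cutoff[where a="e^2"]
      has_vector_derivative_fund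
        has_real_derivative_cutoff) (auto simp: cutoff_inside)
qed

lemma continuous_on_source1:
  assumes e: "e > 0"
  shows "continuous_on UNIV (source1 k e)"
proof -
  have "continuous_on {0<..} (\<lambda>s. 4 * \<i> * k * (\<i> * k * phase k s / (2 * of_real (sqrt s))))"
    by (intro continuous_intros continuous_on_fund; simp)
  then show ?thesis
    unfolding source1_def[abs_def] using e
    by (intro continuous_on_add continuous_on_mult_cutoff[where a="e^2"] continuous_on_fund
      continuous_intros)
      (auto simp: cutoff_inside)
qed

lemma source1_dsq_eq_0:
  assumes "e > 0" "norm (y - c) \<ge> 3 / 2 * e"
  shows "source1 k e (dsq c y) = 0"
  using cutoff_outside[OF assms(1) dsq_ge_of_norm_ge[OF assms]] by (simp add: source1_def)

section \<open>The regularised source as an approximate identity\<close>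

definition mass_density :: "real^3 \<Rightarrow> real" where
  "mass_density v =
     (2 * smoothstep1 ((norm v)^2 - 1) + 4 * (norm v)^2 * smoothstep2 ((norm v)^2 - 1)) / norm v"

definition source_mass :: real where
  "source_mass = (LINT v|lborel. mass_density v)"

lemma continuous_on_div_norm:
  fixes g :: "real \<Rightarrow> real"
  assumes "continuous_on UNIV g" "\<And>s. s \<le> 1 \<Longrightarrow> g s = 0"
  shows "continuous_on UNIV (\<lambda>v::'a::real_normed_vector. g ((norm v)^2) / norm v)"
proof (rule continuous_on_UNIV_compact_support[of "- {0}" _ "{v. norm v \<ge> 1}"])
  show "closed {v::'a. norm v \<ge> 1}" by (intro closed_Collect_le continuous_intros)
  show "continuous_on (- {0}) (\<lambda>v::'a. g ((norm v)^2) / norm v)"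
    by (intro continuous_intros continuous_on_compose2[OF assms(1)]) auto
qed (use assms(2) in \<open>auto simp: power_le_one\<close>)

lemma continuous_on_mass_density: "continuous_on UNIV mass_density"
  unfolding mass_density_def[abs_def]
  by (rule continuous_on_div_norm[of "\<lambda>s. 2 * smoothstep1 (s - 1) + 4 * s * smoothstep2 (s - 1)"])
    (auto simp: smoothstep_left intro!: continuous_intros)

lemma norm_gt_2_imp_ge_1:
  assumes "norm v > 2"
  shows "(norm v)^2 - 1 \<ge> 1"
  using power_mono[of 2 "norm v" 2] assms by simp

lemma mass_density_eq_0: "v \<notin> cball 0 2 \<Longrightarrow> mass_density v = 0"
  using norm_gt_2_imp_ge_1[of v] by (simp add: mass_density_def smoothstep_right)

lemma integrable_mass_density: "integrable lborel mass_density"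
  by (rule integrable_continuous_compact_support[OF continuous_on_mass_density compact_cball subset_UNIV
    mass_density_eq_0])

definition mass_weight :: "real \<Rightarrow> real" where
  "mass_weight s = smoothstep1 (s - 1) / sqrt s"

definition mass_weight1 :: "real \<Rightarrow> real" where
  "mass_weight1 s = smoothstep2 (s - 1) / sqrt s - smoothstep1 (s - 1) / (2 * s * sqrt s)"

lemma has_vector_derivative_mass_weight:
  "((\<lambda>s. complex_of_real (mass_weight s)) has_vector_derivative of_real (mass_weight1 s)) (at s)"
proof -
  have "((\<lambda>s. of_real (smoothstep1 (s - 1)) * complex_of_real (1 / sqrt s)) has_vector_derivative
      of_real (smoothstep2 (s - 1)) * of_real (1 / sqrt s)
      + of_real (smoothstep1 (s - 1)) * of_real (- (1 / (2 * s * sqrt s)))) (at s)"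
  proof (rule has_vector_derivative_mult_cutoff[where a=1])
    show "((\<lambda>s. smoothstep1 (s - 1)) has_real_derivative smoothstep2 (s - 1)) (at s)" for s
      by (rule DERIV_chain2[OF has_real_derivative_smoothstep(2), THEN DERIV_cong])
        (auto intro!: derivative_eq_intros)
    show "((\<lambda>s. complex_of_real (1 / sqrt s))
        has_vector_derivative of_real (- (1 / (2 * s * sqrt s)))) (at s)"
      if "s > 0" for s
      using that by (intro has_vector_derivative_of_real)
        (auto intro!: derivative_eq_intros simp: field_simps)
  qed (auto simp: smoothstep_left)
  then show ?thesis by (simp add: mass_weight_def mass_weight1_def)
qed

lemma continuous_on_mass_weight1: "continuous_on UNIV (\<lambda>s. complex_of_real (mass_weight1 s))"
proof -
  have "continuous_on UNIV (\<lambda>s. of_real (smoothstep2 (s - 1)) * complex_of_real (1 / sqrt s)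
      - of_real (smoothstep1 (s - 1)) * of_real (1 / (2 * s * sqrt s)))"
    by (intro continuous_on_diff continuous_on_mult_cutoff[where a=1])
      (auto simp: smoothstep_left intro!: continuous_intros)
  then show ?thesis by (simp add: mass_weight1_def)
qed

lemma continuous_on_mass_weight_norm: "continuous_on UNIV (\<lambda>v::real^3. mass_weight ((norm v)^2))"
  using continuous_on_div_norm[of "\<lambda>s. smoothstep1 (s - 1)"]
  by (simp add: mass_weight_def smoothstep_left continuous_intros)

lemma integrable_mass_weight_norm: "integrable lborel (\<lambda>v::real^3. mass_weight ((norm v)^2))"
  by (rule integrable_continuous_compact_support[OF continuous_on_mass_weight_norm
    compact_cball[of 0 2]])
    (auto simp: mass_weight_def smoothstep_right norm_gt_2_imp_ge_1)

lemma source_mass_neg: "source_mass < 0"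
proof -
  have pointwise: "mass_density v + 2 * mass_weight ((norm v)^2)
      = 6 * mass_weight ((norm v)^2) + 4 * (norm v)^2 * mass_weight1 ((norm v)^2)" for v
    by (cases "v = 0") (simp_all add: mass_weight_def mass_weight1_def mass_density_def field_simps
      power2_eq_square)
  have "0 = (LINT v|lborel. 6 * complex_of_real (mass_weight ((norm (v::real^3))^2))
      + 4 * of_real ((norm v)^2) * of_real (mass_weight1 ((norm v)^2)))"
    by (rule integral_radial_divergence_eq_0[OF has_vector_derivative_mass_weight
      continuous_on_mass_weight1, of 2, symmetric])
      (auto simp: mass_weight_def smoothstep_right)
  also have "\<dots> = (LINT v|lborel. complex_of_real (mass_density v
      + 2 * mass_weight ((norm (v::real^3))^2)))"
    unfolding pointwise by simp
  also have "\<dots> = complex_of_real (source_mass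
      + 2 * (LINT v|lborel. mass_weight ((norm (v::real^3))^2)))"
    unfolding integral_complex_of_real source_mass_def
    using integrable_mass_weight_norm integrable_mass_density by simp
  finally have "source_mass = - 2 * (LINT v|lborel. mass_weight ((norm (v::real^3))^2))"
    by (metis add_eq_0_iff mult_minus_left of_real_eq_0_iff add.commute)
  moreover have "(LINT v|lborel. mass_weight ((norm (v::real^3))^2)) > 0"
    by (rule integral_pos_continuous[OF continuous_on_mass_weight_norm integrable_mass_weight_norm, of
      "sqrt (3/2) *\<^sub>R axis 1 1"])
      (auto simp: mass_weight_def smoothstep1_nonneg intro!: smoothstep1_pos divide_pos_pos)
  ultimately show ?thesis by simp
qed

lemma source_scaled_eq:
  assumes e: "e > 0"
  shows "of_real (e^3) * source k e (dsq x (x + e *\<^sub>R v)) =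
    (of_real (mass_density v) + of_real (e * smoothstep1 ((norm v)^2 - 1)) * (4 * \<i> * k))
      * exp (\<i> * of_real (k * e * norm v))"
proof -
  define n where "n = norm v"
  have dsq_eq: "dsq x (x + e *\<^sub>R v) = e^2 * n^2" using e by (simp add: dsq_def n_def power_mult_distrib)
  have cutoff_eq: "cutoff1 e (e^2 * n^2) = smoothstep1 (n^2 - 1) / e^2"
    "cutoff2 e (e^2 * n^2) = smoothstep2 (n^2 - 1) / e^4"
    using e by (auto simp: cutoff_defs)
  have "sqrt (e^2 * n^2) = e * n" using e by (simp add: real_sqrt_mult n_def)
  then have phase_eq: "phase k (e^2 * n^2) = exp (\<i> * of_real (k * e * n))"
    "fund k (e^2 * n^2) = exp (\<i> * of_real (k * e * n)) / (of_real e * of_real n)"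
    by (simp_all add: fund_def phase_def mult.assoc)
  have algebra: "E^3 * ((2 * (a / E^2) + 4 * (E^2 * N^2) * (b / E^4)) * (X / (E * N))
      + a / E^2 * (4 * \<i> * k * X))
      = ((2 * a + 4 * N^2 * b) / N + E * a * (4 * \<i> * k)) * X" if "E \<noteq> 0" for E N a b X :: complex
    using that by (cases "N = 0") (auto simp: field_simps power_numeral_reduce)
  show ?thesis
    unfolding dsq_eq source_eq[OF e] cutoff_eq mass_density_def n_def[symmetric] phase_eq
    using algebra[of "of_real e" "of_real (smoothstep1 (n^2 - 1))" "of_real n"] e by simp
qed

lemma norm_source_scaled_le:
  assumes e: "e > 0"
  shows "cmod (of_real (e^3) * source k e (dsq x (x + e *\<^sub>R v))) \<le> \<bar>mass_density v\<bar>
      + e * 140 * (4 * \<bar>k\<bar>)"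
proof -
  have "cmod (of_real (e^3) * source k e (dsq x (x + e *\<^sub>R v)))
      \<le> \<bar>mass_density v\<bar> + \<bar>e * smoothstep1 ((norm v)^2 - 1)\<bar> * (4 * \<bar>k\<bar>)"
    unfolding source_scaled_eq[OF e] norm_mult[of "_ + _"]
    using norm_triangle_ineq[of "complex_of_real (mass_density v)" "of_real (e * smoothstep1 ((norm v)^2
        - 1)) * (4 * \<i> * k)"]
    by (simp add: norm_mult abs_mult)
  also have "\<dots> \<le> \<bar>mass_density v\<bar> + e * 140 * (4 * \<bar>k\<bar>)"
    using e smoothstep1_nonneg smoothstep1_le by (intro add_left_mono mult_right_mono)
      (auto simp: abs_mult)
  finally show ?thesis .
qed

lemma source_scaled_tendsto:
  "((\<lambda>e. of_real (e^3) * source k e (dsq x (x + e *\<^sub>R v))) \<longlongrightarrow> of_real (mass_density v)) (at_right 0)"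
proof (rule Lim_transform_eventually)
  show "((\<lambda>e. (of_real (mass_density v) + of_real (e * smoothstep1 ((norm v)^2 - 1)) * (4 * \<i> * k))
      * exp (\<i> * of_real (k * e * norm v))) \<longlongrightarrow> of_real (mass_density v)) (at_right 0)"
    by (auto intro!: tendsto_eq_intros)
  show "\<forall>\<^sub>F e in at_right 0. (of_real (mass_density v)
      + of_real (e * smoothstep1 ((norm v)^2 - 1)) * (4 * \<i> * k))
      * exp (\<i> * of_real (k * e * norm v)) = of_real (e^3) * source k e (dsq x (x + e *\<^sub>R v))"
    using eventually_at_right_less[of 0] by eventually_elim (simp only: source_scaled_eq)
qed

lemma source_scaled_bounded:
  obtains C where "C > 0" "\<And>e x v. 0 < e \<Longrightarrow> e \<le> T \<Longrightarrow>
    cmod (of_real (e^3) * source k e (dsq x (x + e *\<^sub>R v))) \<le> C * indicator (cball 0 2) v"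
proof -
  obtain A where A: "A > 0" "\<And>v. norm (mass_density v) \<le> A"
    using bounded_continuous_compact_support[OF continuous_on_mass_density compact_cball
      mass_density_eq_0] by blast
  have "cmod (of_real (e^3) * source k e (dsq x (x + e *\<^sub>R v)))
      \<le> (A + \<bar>T\<bar> * 140 * (4 * \<bar>k\<bar>)) * indicator (cball 0 2) v"
    if e: "0 < e" "e \<le> T" for e x v
  proof (cases "v \<in> cball 0 2")
    case True
    have "\<bar>mass_density v\<bar> + e * 140 * (4 * \<bar>k\<bar>) \<le> A + \<bar>T\<bar> * 140 * (4 * \<bar>k\<bar>)"
      using A(2)[of v] e by (intro add_mono mult_right_mono) auto
    from order_trans[OF norm_source_scaled_le[OF e(1)] this] True show ?thesis by simp
  qed (use e source_dsq_eq_0[of e "x + e *\<^sub>R v" x k] in simp)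
  then show ?thesis using A(1) by (intro that[of "A + \<bar>T\<bar> * 140 * (4 * \<bar>k\<bar>)"])
    (auto intro: add_pos_nonneg)
qed

lemma source_rescale:
  fixes k :: real
  assumes f: "continuous_on (ball x r) f" and e: "0 < e" "2 * e < r"
  defines "F \<equiv> \<lambda>v. f (x + e *\<^sub>R v) * (of_real (e^3) * source k e (dsq x (x + e *\<^sub>R v)))"
  shows "F \<in> borel_measurable borel" "(LINT v|lborel. F v)
      = (LINT y|lborel. f y * source k e (dsq x y))"
proof -
  have meas: "(\<lambda>y. f y * source k e (dsq x y)) \<in> borel_measurable borel"
  proof (intro borel_measurable_continuous_onI continuous_on_UNIV_compact_support[OF open_ball])
    show "continuous_on (ball x r) (\<lambda>y. f y * source k e (dsq x y))"
      by (intro continuous_intros f continuous_on_radial continuous_on_source e)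
    show "cball x (2 * e) \<subseteq> ball x r" using e by auto
    show "f y * source k e (dsq x y) = 0" if "y \<notin> cball x (2 * e)" for y
      using that e source_dsq_eq_0[of e y x k] by (simp add: dist_norm norm_minus_commute)
  qed auto
  have F_eq: "F v = of_real (e^3) * (f (x + e *\<^sub>R v) * source k e (dsq x (x + e *\<^sub>R v)))" for v
    by (simp add: F_def mult.left_commute)
  have "(\<lambda>v. f (x + e *\<^sub>R v) * source k e (dsq x (x + e *\<^sub>R v))) \<in> borel_measurable borel"
    by (rule measurable_compose[OF _ meas]) simp
  then show "F \<in> borel_measurable borel" unfolding F_eq[abs_def]
    by (rule borel_measurable_times[OF borel_measurable_const])
  show "(LINT v|lborel. F v) = (LINT y|lborel. f y * source k e (dsq x y))"
    unfolding F_eq using lborel_integral_affine[OF meas, of e x] e by (simp add: scaleR_conv_of_real)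
qed

lemma source_tendsto:
  assumes f: "continuous_on (ball x r) f" and r: "r > 0"
  shows "((\<lambda>e. LINT y|lborel. f y * source k e (dsq x y)) \<longlongrightarrow> of_real source_mass * f x) (at_right 0)"
proof -
  let ?S = "{0<..<r / 4}"
  define F where "F e v = f (x + e *\<^sub>R v) * (of_real (e^3) * source k e (dsq x (x + e *\<^sub>R v)))" for e v
  obtain C where C: "C > 0" "\<And>e x v. 0 < e \<Longrightarrow> e \<le> r \<Longrightarrow>
      cmod (of_real (e^3) * source k e (dsq x (x + e *\<^sub>R v))) \<le> C * indicator (cball 0 2) v"
    by (rule source_scaled_bounded[of r k]) (rule that)
  have "bounded (f ` cball x (r / 2))"
    by (intro compact_imp_bounded compact_continuous_image continuous_on_subset[OF f]) (use r in auto)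
  then obtain B where B: "B > 0" "\<And>y. y \<in> cball x (r / 2) \<Longrightarrow> cmod (f y) \<le> B"
    unfolding bounded_pos by auto
  have at_right: "at 0 within ?S = at_right 0" by (rule at_within_nhd[of _ "{..<r / 4}"])
    (use r in auto)
  have "((\<lambda>e. LINT v|lborel. F e v) \<longlongrightarrow> (LINT v|lborel. f x * of_real (mass_density v))) (at 0 within ?S)"
  proof (rule tendsto_integral_dominated[OF integrable_indicator_compact[OF compact_cball]])
    fix e assume "e \<in> ?S - {0}"
    then have e: "0 < e" "e < r / 4" "2 * e < r" by auto
    show "F e \<in> borel_measurable lborel"
      unfolding F_def[abs_def] using source_rescale(1)[OF f e(1,3)] by simp
    show "cmod (F e v) \<le> B * C * indicator (cball 0 2) v" for v
    proof (cases "v \<in> cball 0 2")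
      case True
      then have "norm (e *\<^sub>R v) \<le> r / 4 * 2" unfolding norm_scaleR using e by (intro mult_mono) auto
      then have "cmod (f (x + e *\<^sub>R v)) \<le> B" by (intro B(2)) (simp add: dist_norm)
      then show ?thesis
        unfolding F_def norm_mult[of "f _"] using C(2)[of e x v] e True B(1) by (simp add: mult_mono)
    qed (use C(2)[of e x v] e in \<open>simp add: F_def\<close>)
  next
    fix v :: "real^3"
    have "isCont f x" using f r by (simp add: continuous_on_eq_continuous_at)
    moreover have "((\<lambda>e. x + e *\<^sub>R v) \<longlongrightarrow> x) (at_right 0)" by (auto intro!: tendsto_eq_intros)
    ultimately have "((\<lambda>e. f (x + e *\<^sub>R v)) \<longlongrightarrow> f x) (at_right 0)" by (rule isCont_tendsto_compose)
    from tendsto_mult[OF this source_scaled_tendsto]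
    show "((\<lambda>e. F e v) \<longlongrightarrow> f x * of_real (mass_density v)) (at 0 within ?S)"
      by (simp only: F_def at_right)
  qed
  then have "((\<lambda>e. LINT y|lborel. f y * source k e (dsq x y))
      \<longlongrightarrow> (LINT v|lborel. f x * of_real (mass_density v))) (at 0 within ?S)"
    by (rule Lim_transform_within[OF _ zero_less_one])
      (use source_rescale(2)[OF f] in \<open>auto simp: F_def\<close>)
  then show ?thesis unfolding at_right by (simp add: source_mass_def mult.commute)
qed

lemma source_integral_eqI:
  assumes f: "continuous_on (ball x r) f" and r: "r > 0"
    and const: "\<And>e. 0 < e \<Longrightarrow> 2 * e \<le> r \<Longrightarrow> (LINT y|lborel. f y * source k e (dsq x y)) = I"
  shows "of_real source_mass * f x = I"
proof -
  have "\<forall>\<^sub>F e in at_right 0. (LINT y|lborel. f y * source k e (dsq x y)) = I"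
    unfolding eventually_at_right_field using r const by (intro exI[of _ "r / 2"]) auto
  from tendsto_eventually[OF this] source_tendsto[OF f r] show ?thesis
    by (rule tendsto_unique[OF trivial_limit_at_right_real, symmetric])
qed

section \<open>Weak solutions of the Helmholtz equation\<close>

locale weak_helmholtz =
  fixes k :: real and D :: "(real^3) set" and w :: "real^3 \<Rightarrow> complex" and p :: "3 \<Rightarrow> real^3 \<Rightarrow> complex"
  assumes w_integrable: "compact K \<Longrightarrow> K \<subseteq> D \<Longrightarrow> set_integrable lborel K w"
    and p_integrable: "compact K \<Longrightarrow> K \<subseteq> D \<Longrightarrow> set_integrable lborel K (p i)"
    and weak: "C1_on UNIV \<phi> D\<phi> \<Longrightarrow> compact K \<Longrightarrow> K \<subseteq> D \<Longrightarrow> (\<And>x. x \<notin> K \<Longrightarrow> \<phi> x = 0) \<Longrightarrow>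
       (LINT x|lborel. (\<Sum>i\<in>UNIV. p i x * D\<phi> i x) - of_real (k^2) * w x * \<phi> x) = 0"
    and weak_gradient: "continuous_on UNIV g \<Longrightarrow> has_partial_on g i g' UNIV \<Longrightarrow> continuous_on UNIV g' \<Longrightarrow>
       compact K \<Longrightarrow> K \<subseteq> D \<Longrightarrow> (\<And>x. x \<notin> K \<Longrightarrow> g x = 0) \<Longrightarrow> (LINT x|lborel. p i x * g x + w x * g' x) = 0"
begin

lemma weak_integrable:
  assumes "C1_on UNIV \<phi> D\<phi>" "compact K" "K \<subseteq> D" "\<And>x. x \<notin> K \<Longrightarrow> \<phi> x = 0"
  shows "integrable lborel (\<lambda>x. (\<Sum>i\<in>UNIV. p i x * D\<phi> i x) - of_real (k^2) * w x * \<phi> x)"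
proof -
  have "integrable lborel (\<lambda>x. p i x * D\<phi> i x)" for i
    by (rule integrable_mult_compact_support[OF p_integrable[OF assms(2,3)]
      C1_onD(3)[OF assms(1)] assms(2)])
      (rule partial_eq_0_outside[OF C1_onD(2)[OF assms(1)] assms(2,4)])
  moreover have "integrable lborel (\<lambda>x. of_real (k^2) * (w x * \<phi> x))"
    by (rule integrable_mult_right[OF integrable_mult_compact_support[OF w_integrable[OF assms(2,3)]
      C1_onD(1)[OF assms(1)] assms(2,4)]])
  ultimately show ?thesis
    by (intro Bochner_Integration.integrable_diff Bochner_Integration.integrable_sum)
      (auto simp: mult.assoc)
qed

lemma weak_gradient_integrable:
  assumes "continuous_on UNIV g" "has_partial_on g i g' UNIV" "continuous_on UNIV g'"
    and K: "compact K" "K \<subseteq> D" "\<And>x. x \<notin> K \<Longrightarrow> g x = 0"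
  shows "integrable lborel (\<lambda>x. p i x * g x + w x * g' x)"
  by (intro Bochner_Integration.integrable_add
    integrable_mult_compact_support[OF p_integrable[OF K(1,2)] assms(1) K(1,3)]
      integrable_mult_compact_support[OF w_integrable[OF K(1,2)] assms(3) K(1)]
        partial_eq_0_outside[OF assms(2) K(1,3)])

lemma green_identity:
  assumes \<eta>: "C1_on UNIV \<eta> D\<eta>" and e: "C2_fun e De DDe" and K: "compact K" "K \<subseteq> D"
    and support: "(\<forall>x. x \<notin> K \<longrightarrow> \<eta> x = 0) \<or> (\<forall>x. x \<notin> K \<longrightarrow> e x = 0)"
  shows "(LINT x|lborel. (\<Sum>i\<in>UNIV. (e x * p i x - w x * De i x) * D\<eta> i x))
       = (LINT x|lborel. w x * (\<eta> x * helmholtz_op k e DDe x))"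
proof -
  note e1 = C2_funD[OF e] and \<eta>1 = C1_onD[OF \<eta>]
  note e0 = C1_onD[OF e1(1)]
  have zero: "\<eta> x * e x = 0" "\<eta> x * De i x = 0" "\<eta> x * DDe i x = 0" if x: "x \<notin> K" for x i
    using support x C2_fun_partials_eq_0_outside[OF e K(1) _ x] by auto
  note \<eta>e = C1_on_mult[OF \<eta> e1(1)]
  have test: "(LINT x|lborel. (\<Sum>i\<in>UNIV. p i x * (D\<eta> i x * e x + \<eta> x * De i x))
      - of_real (k^2) * w x * (\<eta> x * e x)) = 0"
    by (rule weak[OF \<eta>e K]) (rule zero(1))
  have test_integrable: "integrable lborel
      (\<lambda>x. (\<Sum>i\<in>UNIV. p i x * (D\<eta> i x * e x + \<eta> x * De i x)) - of_real (k^2) * w x * (\<eta> x * e x))"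
    by (rule weak_integrable[OF \<eta>e K]) (rule zero(1))
  have \<eta>De: "has_partial_on (\<lambda>x. \<eta> x * De i x) i (\<lambda>x. D\<eta> i x * De i x + \<eta> x * DDe i x) UNIV"
      "continuous_on UNIV (\<lambda>x. \<eta> x * De i x)" "continuous_on UNIV (\<lambda>x. D\<eta> i x * De i x + \<eta> x * DDe i x)"
        for i
    by (intro has_partial_on_mult continuous_intros \<eta>1 e0 e1)+
  let ?div = "\<lambda>x. \<Sum>i\<in>UNIV. p i x * (\<eta> x * De i x) + w x * (D\<eta> i x * De i x + \<eta> x * DDe i x)"
  note parts_integrable = weak_gradient_integrable[OF \<eta>De(2,1,3) K, OF zero(2)]
  then have div_integrable: "integrable lborel ?div" by (rule Bochner_Integration.integrable_sum)
  have "(LINT x|lborel. ?div x) = 0"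
    using parts_integrable weak_gradient[OF \<eta>De(2,1,3) K, OF zero(2)]
    by (simp add: Bochner_Integration.integral_sum)
  moreover have "integrable lborel (\<lambda>x. w x * (\<eta> x * helmholtz_op k e DDe x))"
  proof (rule integrable_mult_compact_support[OF w_integrable[OF K] _ K(1)])
    show "continuous_on UNIV (\<lambda>x. \<eta> x * helmholtz_op k e DDe x)"
      unfolding helmholtz_op_def by (intro continuous_intros \<eta>1 e0 e1)
    show "\<eta> x * helmholtz_op k e DDe x = 0" if "x \<notin> K" for x
      using zero[OF that] by (cases "\<eta> x = 0") (auto simp: helmholtz_op_def)
  qed
  moreover have "(LINT x|lborel. (\<Sum>i\<in>UNIV. (e x * p i x - w x * De i x) * D\<eta> i x))
     = (LINT x|lborel. ((\<Sum>i\<in>UNIV. p i x * (D\<eta> i x * e x + \<eta> x * De i x))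
       - of_real (k^2) * w x * (\<eta> x * e x))
        - ?div x + w x * (\<eta> x * helmholtz_op k e DDe x))"
    by (rule Bochner_Integration.integral_cong) (simp_all add: helmholtz_op_def sum_3 algebra_simps)
  ultimately show ?thesis using test test_integrable div_integrable by simp
qed

lemma integral_helmholtz_op_eq_0:
  assumes "C2_fun e De DDe" "compact K" "K \<subseteq> D" "\<And>x. x \<notin> K \<Longrightarrow> e x = 0"
  shows "(LINT x|lborel. w x * helmholtz_op k e DDe x) = 0"
  using green_identity[OF C1_on_const[of _ 1] assms(1-3)] assms(4) by simp

lemma green_representation:
  assumes r: "r > 0" "continuous_on (ball x r) w"
    and \<eta>: "C1_on UNIV \<eta> D\<eta>" "\<And>y. y \<in> ball x r \<Longrightarrow> \<eta> y = 1"
    and K: "compact K" "K \<subseteq> D" "\<And>x. x \<notin> K \<Longrightarrow> \<eta> x = 0"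
  shows "of_real source_mass * w x = (LINT y|lborel. (\<Sum>i\<in>UNIV.
      (fund k (dsq x y) * p i y - w y * radial_partial (fund1 k) x i y) * D\<eta> i y))" (is "_ = ?I")
proof (rule source_integral_eqI[OF r(2,1)])
  fix e :: real assume e: "0 < e" "2 * e \<le> r"
  have far: "dsq x y \<ge> 2 * e^2" if "y \<notin> ball x r" for y
    by (rule dsq_ge_of_norm_ge[OF e(1)]) (use that e in \<open>auto simp: dist_norm norm_minus_commute\<close>)
  have D\<eta>0: "D\<eta> i y = 0" if "y \<in> ball x r" for i y
    by (rule partial_eq_0_where_const[OF C1_onD(2)[OF \<eta>(1)] open_ball subset_UNIV \<eta>(2) that])
  note regfund = has_vector_derivative_regfund[OF e(1), of k] continuous_on_regfund(3)[OF e(1), of k]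
  have "?I = (LINT y|lborel. (\<Sum>i\<in>UNIV.
      (regfund k e (dsq x y) * p i y - w y * radial_partial (regfund1 k e) x i y) * D\<eta> i y))"
  proof (intro Bochner_Integration.integral_cong[OF refl] sum.cong[OF refl])
    fix y :: "real^3" and i :: 3
    show "(fund k (dsq x y) * p i y - w y * radial_partial (fund1 k) x i y) * D\<eta> i y
        = (regfund k e (dsq x y) * p i y - w y * radial_partial (regfund1 k e) x i y) * D\<eta> i y"
      using D\<eta>0[of y i] regfund_eq_fund[OF e(1) far]
      by (cases "y \<in> ball x r") (auto simp: radial_partial_def)
  qed
  also have "\<dots> = (LINT y|lborel. w y * (\<eta> y * source k e (dsq x y)))"
    using green_identity[OF \<eta>(1) C2_fun_radial[OF regfund] K(1,2)] K(3)
    by (simp add: helmholtz_op_radial source_def)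
  also have "\<dots> = (LINT y|lborel. w y * source k e (dsq x y))"
  proof (rule Bochner_Integration.integral_cong[OF refl])
    show "w y * (\<eta> y * source k e (dsq x y)) = w y * source k e (dsq x y)" for y
      using \<eta>(2)[of y] source_eq_0[OF e(1)] far[of y] by (cases "y \<in> ball x r") auto
  qed
  finally show "(LINT y|lborel. w y * source k e (dsq x y)) = ?I" by simp
qed

lemma source_mean_value:
  assumes r: "r > 0" "continuous_on (ball x r) w" and \<delta>: "\<delta> > 0" "cball x (2 * \<delta>) \<subseteq> D"
  shows "of_real source_mass * w x = (LINT y|lborel. w y * source k \<delta> (dsq x y))"
proof (rule source_integral_eqI[of _ "min r (2 * \<delta>)"])
  show "continuous_on (ball x (min r (2 * \<delta>))) w" by (rule continuous_on_subset[OF r(2)]) auto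
  fix e assume e: "0 < e" "2 * e \<le> min r (2 * \<delta>)"
  define h where "h s = regfund k e s - regfund k \<delta> s" for s
  define h1 where "h1 s = regfund1 k e s - regfund1 k \<delta> s" for s
  define h2 where "h2 s = regfund2 k e s - regfund2 k \<delta> s" for s
  have h: "(h has_vector_derivative h1 s) (at s)" "(h1 has_vector_derivative h2 s) (at s)"
    "continuous_on UNIV h2" for s
    unfolding h_def[abs_def] h1_def[abs_def] h2_def[abs_def]
    by (intro has_vector_derivative_diff continuous_intros has_vector_derivative_regfund
      continuous_on_regfund e \<delta>)+
  have "h (dsq x y) = 0" if "y \<notin> cball x (2 * \<delta>)" for y
  proof -
    have "norm (y - x) \<ge> 2 * \<delta>" using that by (simp add: dist_norm norm_minus_commute)
    then have "dsq x y \<ge> 2 * e^2" "dsq x y \<ge> 2 * \<delta>^2"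
      using e \<delta>(1) by (auto intro!: dsq_ge_of_norm_ge)
    then show ?thesis using regfund_eq_fund(1) e(1) \<delta>(1) by (simp add: h_def)
  qed
  then have "(LINT y|lborel. w y * helmholtz_op k (\<lambda>y. h (dsq x y)) (radial_partial2 h1 h2 x) y) = 0"
    by (rule integral_helmholtz_op_eq_0[OF C2_fun_radial[OF h] compact_cball \<delta>(2)])
  moreover have "w y * helmholtz_op k (\<lambda>y. h (dsq x y)) (radial_partial2 h1 h2 x) y
      = w y * source k e (dsq x y) - w y * source k \<delta> (dsq x y)" for y
    unfolding helmholtz_op_radial by (simp add: h_def h1_def h2_def source_def algebra_simps)
  moreover have "integrable lborel (\<lambda>y. w y * source k a (dsq x y))" if "0 < a" "a \<le> \<delta>" for a
    by (rule integrable_mult_compact_support[OF w_integrable[OF compact_cball \<delta>(2)] _ compact_cball])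
      (use that \<delta>(1) in \<open>auto intro!: continuous_on_radial continuous_on_source source_dsq_eq_0
          simp: dist_norm norm_minus_commute\<close>)
  ultimately show "(LINT y|lborel. w y * source k e (dsq x y))
      = (LINT y|lborel. w y * source k \<delta> (dsq x y))"
    using e \<delta>(1) by simp
qed (use r \<delta> in auto)

end

lemma weak_helmholtz_diff:
  assumes "weak_helmholtz k D u p" "weak_helmholtz k D v q"
  shows "weak_helmholtz k D (\<lambda>x. u x - v x) (\<lambda>i x. p i x - q i x)"
proof -
  interpret u: weak_helmholtz k D u p by (rule assms(1))
  interpret v: weak_helmholtz k D v q by (rule assms(2))
  show ?thesis
  proof
    show "set_integrable lborel K (\<lambda>x. u x - v x)" "set_integrable lborel K (\<lambda>x. p i x - q i x)"
      if "compact K" "K \<subseteq> D" for K i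
      using that by (auto intro!: set_integral_diff u.w_integrable v.w_integrable u.p_integrable
        v.p_integrable)
  next
    fix \<phi> D\<phi> K assume \<phi>: "C1_on UNIV \<phi> D\<phi>" "compact K" "K \<subseteq> D" "\<And>x. x \<notin> K \<Longrightarrow> \<phi> x = 0"
    have "(LINT x|lborel. (\<Sum>i\<in>UNIV. (p i x - q i x) * D\<phi> i x) - of_real (k^2) * (u x - v x) * \<phi> x)
        = (LINT x|lborel. ((\<Sum>i\<in>UNIV. p i x * D\<phi> i x) - of_real (k^2) * u x * \<phi> x)
            - ((\<Sum>i\<in>UNIV. q i x * D\<phi> i x) - of_real (k^2) * v x * \<phi> x))"
      by (simp add: sum_3 algebra_simps)
    also have "\<dots> = 0"
      using u.weak_integrable[OF \<phi>] v.weak_integrable[OF \<phi>] u.weak[OF \<phi>] v.weak[OF \<phi>] by simp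
    finally show "(LINT x|lborel. (\<Sum>i\<in>UNIV. (p i x - q i x) * D\<phi> i x)
        - of_real (k^2) * (u x - v x) * \<phi> x) = 0" .
  next
    fix g g' :: "real^3 \<Rightarrow> complex" and i K
    assume g: "continuous_on UNIV g" "has_partial_on g i g' UNIV" "continuous_on UNIV g'"
      "compact K" "K \<subseteq> D" "\<And>x. x \<notin> K \<Longrightarrow> g x = 0"
    have "(LINT x|lborel. (p i x - q i x) * g x + (u x - v x) * g' x)
        = (LINT x|lborel. (p i x * g x + u x * g' x) - (q i x * g x + v x * g' x))"
      by (simp add: algebra_simps)
    also have "\<dots> = 0"
      using u.weak_gradient_integrable[OF g] v.weak_gradient_integrable[OF g] u.weak_gradient[OF g]
        v.weak_gradient[OF g]
      by simp
    finally show "(LINT x|lborel. (p i x - q i x) * g x + (u x - v x) * g' x) = 0" .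
  qed
qed

lemma weak_helmholtz_C1:
  assumes D: "open D" and w: "C1_on D w p"
    and weak: "\<And>\<phi> D\<phi> K. C1_on UNIV \<phi> D\<phi> \<Longrightarrow> compact K \<Longrightarrow> K \<subseteq> D \<Longrightarrow> (\<And>x. x \<notin> K \<Longrightarrow> \<phi> x = 0) \<Longrightarrow>
       (LINT x|lborel. (\<Sum>i\<in>UNIV. p i x * D\<phi> i x) - of_real (k^2) * w x * \<phi> x) = 0"
  shows "weak_helmholtz k D w p"
proof
  note w1 = C1_onD[OF w]
  show "set_integrable lborel K w" "set_integrable lborel K (p i)" if "compact K" "K \<subseteq> D" for K i
    using set_integrable_continuous_compact w1(1,3) that by blast+
  show "(LINT x|lborel. p i x * g x + w x * g' x) = 0"
    if "continuous_on UNIV g" "has_partial_on g i g' UNIV" "continuous_on UNIV g'"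
      "compact K" "K \<subseteq> D" "\<And>x. x \<notin> K \<Longrightarrow> g x = 0" for g g' i K
    by (rule integration_by_parts_compact_support[OF D w1 that])
qed (rule weak)

lemma helmholtz_C2_imp_C1_on: "helmholtz_C2 k D w p \<Longrightarrow> C1_on D w p"
  by (auto simp: helmholtz_C2_def C1_on_def)

lemma weak_helmholtz_classical:
  assumes D: "open D" and w: "helmholtz_C2 k D w p"
  shows "weak_helmholtz k D w p"
proof (rule weak_helmholtz_C1[OF D helmholtz_C2_imp_C1_on[OF w]])
  obtain q where q: "\<And>i j. has_partial_on (p i) j (q i j) D" "\<And>i j. continuous_on D (q i j)"
    and eq: "\<And>x. x \<in> D \<Longrightarrow> (\<Sum>i\<in>UNIV. q i i x) + of_real (k^2) * w x = 0"
    using w unfolding helmholtz_C2_def by blast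
  note p = C1_onD(3)[OF helmholtz_C2_imp_C1_on[OF w]]
  fix \<phi> D\<phi> K assume \<phi>: "C1_on UNIV \<phi> D\<phi>" and K: "compact K" "K \<subseteq> D" "\<And>x. x \<notin> K \<Longrightarrow> \<phi> x = 0"
  note \<phi>1 = C1_onD[OF \<phi>]
  have D\<phi>: "D\<phi> i x = 0" if "x \<notin> K" for i x by (rule partial_eq_0_outside[OF \<phi>1(2) K(1,3) that])
  have "integrable lborel (\<lambda>x. q i i x * \<phi> x + p i x * D\<phi> i x)" for i
    using set_integrable_continuous_compact[OF q(2) K(1,2)]
      set_integrable_continuous_compact[OF p K(1,2)] \<phi>1 D\<phi> K
    by (intro Bochner_Integration.integrable_add integrable_mult_compact_support) auto
  moreover have "(LINT x|lborel. q i i x * \<phi> x + p i x * D\<phi> i x) = 0" for i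
    by (rule integration_by_parts_compact_support[OF D p q \<phi>1 K])
  ultimately have "(LINT x|lborel. (\<Sum>i\<in>UNIV. q i i x * \<phi> x + p i x * D\<phi> i x)) = 0"
    by (simp add: Bochner_Integration.integral_sum)
  moreover have "(\<Sum>i\<in>UNIV. q i i x * \<phi> x + p i x * D\<phi> i x) = (\<Sum>i\<in>UNIV. p i x * D\<phi> i x)
      - of_real (k^2) * w x * \<phi> x" for x
  proof (cases "x \<in> K")
    case True
    then have "(\<Sum>i\<in>UNIV. q i i x) = - (of_real (k^2) * w x)"
      using eq[of x] K(2) by (auto simp only: eq_neg_iff_add_eq_0 subset_iff)
    then show ?thesis by (simp add: sum.distrib flip: sum_distrib_right)
  qed (simp add: K(3) D\<phi>)
  ultimately show "(LINT x|lborel. (\<Sum>i\<in>UNIV. p i x * D\<phi> i x) - of_real (k^2) * w x * \<phi> x) = 0" by simp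
qed

section \<open>Interior regularity of weak solutions\<close>

lemma bounded_radial_partial:
  assumes "continuous_on UNIV h1" "\<And>s. s \<ge> b^2 \<Longrightarrow> h1 s = 0" "b \<ge> 0"
  obtains B where "B > 0" "\<And>c i y. cmod (radial_partial h1 c i y) \<le> B"
proof -
  have cont: "continuous_on UNIV (\<lambda>v::real^3. of_real (2 * norm v) * h1 (dsq 0 v))"
    by (intro continuous_intros continuous_on_radial assms(1))
  have zero: "of_real (2 * norm v) * h1 (dsq 0 v) = 0" if "v \<notin> cball 0 b" for v :: "real^3"
  proof -
    have "\<not> dsq 0 v \<le> b^2" using that assms(3) by (simp add: dsq_le_iff)
    then show ?thesis by (simp add: assms(2))
  qed
  obtain B where B: "B > 0" "\<And>v::real^3. cmod (of_real (2 * norm v) * h1 (dsq 0 v)) \<le> B"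
    using bounded_continuous_compact_support[OF cont compact_cball zero] by blast
  have "cmod (radial_partial h1 c i y) \<le> B" for c i y
  proof -
    have "cmod (radial_partial h1 c i y) \<le> cmod (of_real (2 * norm (y - c)) * h1 (dsq 0 (y - c)))"
      using component_le_norm_cart[of "y - c" i]
      by (simp add: radial_partial_def dsq_def norm_mult mult_right_mono
        del: vector_minus_component of_real_diff)
    then show ?thesis using B(2)[of "y - c"] by simp
  qed
  then show ?thesis using that B(1) by blast
qed

lemma bounded_radial:
  fixes h :: "real \<Rightarrow> complex"
  assumes "continuous_on UNIV h" "\<And>s. s \<ge> b^2 \<Longrightarrow> h s = 0"
  obtains B where "B > 0" "\<And>s. s \<ge> 0 \<Longrightarrow> cmod (h s) \<le> B"
proof -
  have cont: "continuous_on UNIV (\<lambda>s. h \<bar>s\<bar>)" by (rule continuous_on_compose2[OF assms(1)])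
    (auto intro!: continuous_intros)
  have zero: "h \<bar>s\<bar> = 0" if "s \<notin> cball 0 (b^2)" for s using that assms(2) by simp
  obtain B where "B > 0" "\<And>s. cmod (h \<bar>s\<bar>) \<le> B"
    using bounded_continuous_compact_support[OF cont compact_cball zero] by blast
  then show ?thesis using that[of B] by (metis abs_of_nonneg)
qed

lemma radial_convolution_measurable:
  assumes "integrable lborel f" "continuous_on UNIV h"
  shows "(\<lambda>y. f y * h (dsq y x)) \<in> borel_measurable lborel"
    "(\<lambda>y. f y * radial_partial h y i x) \<in> borel_measurable lborel"
proof -
  have "continuous_on UNIV (\<lambda>y. h (dsq y x))" "continuous_on UNIV (\<lambda>y. radial_partial h y i x)"
    unfolding radial_partial_def by (intro continuous_intros
      continuous_on_compose2[OF assms(2)] subset_UNIV)+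
  from this[THEN borel_measurable_continuous_onI]
  show "(\<lambda>y. f y * h (dsq y x)) \<in> borel_measurable lborel"
    "(\<lambda>y. f y * radial_partial h y i x) \<in> borel_measurable lborel"
    using borel_measurable_integrable[OF assms(1)] by (auto intro!: borel_measurable_times)
qed

lemma C1_on_radial_convolution:
  assumes f: "integrable lborel f" and h: "\<And>s. (h has_vector_derivative h1 s) (at s)"
    "continuous_on UNIV h1"
    and support: "\<And>s. s \<ge> b^2 \<Longrightarrow> h s = 0" "\<And>s. s \<ge> b^2 \<Longrightarrow> h1 s = 0" "b \<ge> 0"
  shows "C1_on UNIV (\<lambda>x. LINT y|lborel. f y * h (dsq y x))
      (\<lambda>i x. LINT y|lborel. f y * radial_partial h1 y i x)"
  unfolding C1_on_def
proof (intro conjI allI)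
  fix i :: 3
  have h_cont: "continuous_on UNIV h" by (rule continuous_on_UNIV_has_vector_derivative[OF h(1)])
  obtain B where B: "B > 0" "\<And>s. s \<ge> 0 \<Longrightarrow> cmod (h s) \<le> B"
    using bounded_radial[OF h_cont support(1)] by blast
  obtain B1 where B1: "B1 > 0" "\<And>c i y. cmod (radial_partial h1 c i y) \<le> B1"
    using bounded_radial_partial[OF h(2) support(2,3)] by blast
  note meas = radial_convolution_measurable(1)[OF f h_cont] radial_convolution_measurable(2)[OF f h(2)]
  have dominated: "integrable lborel (\<lambda>y. C * norm (f y))" for C
    using f by (intro integrable_mult_right integrable_norm)
  have f_bound: "cmod (f y * z) \<le> C * norm (f y)" if "cmod z \<le> C" for y z C
    using mult_right_mono[OF that norm_ge_zero[of "f y"]] by (simp add: norm_mult mult.commute)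
  show "continuous_on UNIV (\<lambda>x. LINT y|lborel. f y * h (dsq y x))"
    by (rule continuous_on_integral_dominated[OF dominated meas(1)])
      (auto intro!: f_bound B(2) continuous_intros continuous_on_radial h_cont)
  show "continuous_on UNIV (\<lambda>x. LINT y|lborel. f y * radial_partial h1 y i x)"
    by (rule continuous_on_integral_dominated[OF dominated meas(2)])
      (auto intro!: f_bound B1(2) continuous_intros continuous_on_radial_partial h(2))
  note partial = has_partial_on_radial[OF h(1)]
  show "has_partial_on (\<lambda>x. LINT y|lborel. f y * h (dsq y x)) i
      (\<lambda>x. LINT y|lborel. f y * radial_partial h1 y i x) UNIV"
    unfolding has_partial_on_def
  proof (intro ballI has_vector_derivative_integral[OF zero_less_one _ dominated])
    show "integrable lborel (\<lambda>y. f y * h (dsq y z))" for z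
      by (rule Bochner_Integration.integrable_bound[OF dominated[of B] meas(1)])
        (use B(1) f_bound[OF B(2)] in \<open>auto intro!: AE_I2 simp: abs_mult\<close>)
    fix x y
    show "((\<lambda>t. f y * h (dsq y (x + t *\<^sub>R axis i 1)))
        has_vector_derivative f y * radial_partial h1 y i x) (at 0)"
      using partial by (intro has_vector_derivative_mult_right) (auto simp: has_partial_on_def)
    fix t :: real
    have "cmod (h (dsq y (x + t *\<^sub>R axis i 1)) - h (dsq y x)) \<le> B1 * \<bar>t\<bar>"
      using norm_partial_increment_le[OF partial[of y i UNIV], of t x 0 B1] B1(2) by simp
    from f_bound[OF this, of y]
    show "cmod (f y * h (dsq y (x + t *\<^sub>R axis i 1)) - f y * h (dsq y (x + 0 *\<^sub>R axis i 1)))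
        \<le> \<bar>t - 0\<bar> * (B1 * cmod (f y))"
      by (simp add: right_diff_distrib mult_ac)
  qed
qed

context weak_helmholtz
begin

definition mollify :: "real \<Rightarrow> real^3 \<Rightarrow> complex" where
  "mollify \<delta> x = (LINT y|lborel. w y * source k \<delta> (dsq y x)) / of_real source_mass"

definition mollify_partial :: "real \<Rightarrow> 3 \<Rightarrow> real^3 \<Rightarrow> complex" where
  "mollify_partial \<delta> i x = (LINT y|lborel. w y * radial_partial (source1 k \<delta>) y i x)
      / of_real source_mass"

lemma C1_on_mollify:
  assumes \<delta>: "\<delta> > 0"
  shows "C1_on {x. cball x (2 * \<delta>) \<subseteq> D} (mollify \<delta>) (mollify_partial \<delta>)"
proof (rule C1_on_locally)
  fix x assume "x \<in> {x. cball x (2 * \<delta>) \<subseteq> D}"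
  then have K: "cball x (2 * \<delta>) \<subseteq> D" by simp
  let ?K = "cball x (2 * \<delta>)" and ?f = "\<lambda>y. indicator (cball x (2 * \<delta>)) y *\<^sub>R w y"
  have "source k \<delta> s = 0" "source1 k \<delta> s = 0" if "s \<ge> (3 / 2 * \<delta>)^2" for s
  proof -
    have "2 * \<delta>^2 \<le> (3 / 2 * \<delta>)^2" by (simp add: power_mult_distrib power_divide)
    then have "s \<ge> 2 * \<delta>^2" using that by linarith
    then show "source k \<delta> s = 0" "source1 k \<delta> s = 0"
      using source_eq_0[OF \<delta>] cutoff_outside[OF \<delta>] by (auto simp: source1_def)
  qed
  then have C1: "C1_on UNIV (\<lambda>x. LINT y|lborel. ?f y * source k \<delta> (dsq y x))
      (\<lambda>i x. LINT y|lborel. ?f y * radial_partial (source1 k \<delta>) y i x)"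
    using w_integrable[OF compact_cball K] \<delta>
    by (intro C1_on_radial_convolution[where b="3 / 2 * \<delta>"] has_vector_derivative_source
      continuous_on_source1)
      (auto simp: set_integrable_def)
  have local: "?f y * source k \<delta> (dsq y z) = w y * source k \<delta> (dsq y z)"
    "?f y * radial_partial (source1 k \<delta>) y i z = w y * radial_partial (source1 k \<delta>) y i z"
    if z: "z \<in> ball x (\<delta> / 2)" for y z i
  proof -
    have "norm (z - y) \<ge> 3 / 2 * \<delta>" if "y \<notin> ?K"
      using that z norm_triangle_ineq[of "x - z" "z - y"] by (auto simp: dist_norm norm_minus_commute)
    then show "?f y * source k \<delta> (dsq y z) = w y * source k \<delta> (dsq y z)"
      "?f y * radial_partial (source1 k \<delta>) y i z = w y * radial_partial (source1 k \<delta>) y i z"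
      using source_dsq_eq_0[OF \<delta>] source1_dsq_eq_0[OF \<delta>]
      by (auto simp: indicator_def radial_partial_def)
  qed
  have "C1_on (ball x (\<delta> / 2)) (\<lambda>x. of_real (1 / source_mass)
      * (LINT y|lborel. ?f y * source k \<delta> (dsq y x)))
      (\<lambda>i x. 0 * (LINT y|lborel. ?f y * source k \<delta> (dsq y x))
        + of_real (1 / source_mass) * (LINT y|lborel. ?f y * radial_partial (source1 k \<delta>) y i x))"
    by (intro C1_on_mult C1_on_const C1_on_subset[OF C1]) simp
  then have "C1_on (ball x (\<delta> / 2)) (mollify \<delta>) (mollify_partial \<delta>)"
    by (rule C1_on_cong) (simp_all only: local mollify_def mollify_partial_def open_ball
      mult_zero_left add_0
        of_real_divide of_real_1 times_divide_eq_left mult_1)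
  then show "\<exists>U. open U \<and> x \<in> U \<and> C1_on U (mollify \<delta>) (mollify_partial \<delta>)"
    using \<delta> by (intro exI[of _ "ball x (\<delta> / 2)"]) simp
qed

lemma mollify_eq:
  assumes \<delta>: "\<delta> > 0" and V: "open V" "V \<subseteq> {x. cball x (2 * \<delta>) \<subseteq> D}" "continuous_on V w" and x: "x \<in> V"
  shows "mollify \<delta> x = w x"
proof -
  obtain r where r: "r > 0" "ball x r \<subseteq> V" using V(1) x open_contains_ball by blast
  have "cball x (2 * \<delta>) \<subseteq> D" using V(2) x by blast
  from source_mean_value[OF r(1) continuous_on_subset[OF V(3) r(2)] \<delta> this]
  have "of_real source_mass * w x = (LINT y|lborel. w y * source k \<delta> (dsq y x))"
    by (simp add: dsq_def norm_minus_commute)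
  then show ?thesis using source_mass_neg by (simp add: mollify_def field_simps)
qed

lemma mollify_partial_eq:
  assumes \<delta>: "\<delta> > 0" and V: "open V" "V \<subseteq> {x. cball x (2 * \<delta>) \<subseteq> D}" "C1_on V w p" and x: "x \<in> V"
  shows "mollify_partial \<delta> i x = p i x"
proof (rule has_partial_on_unique[OF _ _ x])
  show "has_partial_on (mollify \<delta>) i (mollify_partial \<delta> i) V"
    by (rule has_partial_on_subset[OF C1_onD(2)[OF C1_on_mollify[OF \<delta>]] V(2)])
  show "has_partial_on (mollify \<delta>) i (p i) V"
    by (rule has_partial_on_cong[OF C1_onD(2)[OF V(3)] V(1)])
      (use mollify_eq[OF \<delta> V(1,2) C1_onD(1)[OF V(3)]] in auto)
qed

end

lemma (in weak_helmholtz) weak_helmholtz_mollify: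
  assumes \<delta>: "\<delta> > 0" and E: "open E" "E \<subseteq> {x. cball x (2 * \<delta>) \<subseteq> D}"
    and V: "open V" "V \<subseteq> E" "C1_on V w p" and null: "AE x in lborel. x \<in> E \<longrightarrow> x \<in> V"
  shows "weak_helmholtz k E (mollify \<delta>) (mollify_partial \<delta>)"
proof (rule weak_helmholtz_C1[OF E(1)])
  show C1: "C1_on E (mollify \<delta>) (mollify_partial \<delta>)" by (rule C1_on_subset[OF C1_on_mollify[OF \<delta>] E(2)])
  fix \<phi> D\<phi> K assume \<phi>: "C1_on UNIV \<phi> D\<phi>" and K: "compact K" "K \<subseteq> E" "\<And>x. x \<notin> K \<Longrightarrow> \<phi> x = 0"
  have "x \<in> cball x (2 * \<delta>)" for x :: "real^3" using \<delta> by simp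
  then have KD: "K \<subseteq> D" using K(2) E(2) by blast
  let ?form = "\<lambda>w p x. (\<Sum>i\<in>UNIV. p i x * D\<phi> i x) - of_real (k^2) * w x * \<phi> x"
  have D\<phi>: "D\<phi> i x = 0" if "x \<notin> K" for i x by (rule
    partial_eq_0_outside[OF C1_onD(2)[OF \<phi>] K(1,3) that])
  have V': "V \<subseteq> {x. cball x (2 * \<delta>) \<subseteq> D}" using V(2) E(2) by blast
  have "integrable lborel (?form (mollify \<delta>) (mollify_partial \<delta>))"
    by (rule integrable_continuous_compact_support[OF _ K(1,2)])
      (use K(3) D\<phi> C1_onD[OF C1] continuous_on_subset[OF C1_onD(1)[OF \<phi>]]
        continuous_on_subset[OF C1_onD(3)[OF \<phi>]]
        in \<open>auto intro!: continuous_intros\<close>)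
  moreover have "integrable lborel (?form w p)" by (rule weak_integrable[OF \<phi> K(1) KD K(3)])
  moreover have "AE x in lborel. ?form (mollify \<delta>) (mollify_partial \<delta>) x = ?form w p x"
    using null
  proof eventually_elim
    case (elim x)
    show ?case
    proof (cases "x \<in> K")
      case True
      then have "x \<in> V" using elim K(2) by blast
      then show ?thesis using mollify_eq[OF \<delta> V(1) V' C1_onD(1)[OF V(3)]]
        mollify_partial_eq[OF \<delta> V(1) V' V(3)] by simp
    qed (simp add: K(3) D\<phi>)
  qed
  ultimately have "(LINT x|lborel. ?form (mollify \<delta>) (mollify_partial \<delta>) x)
      = (LINT x|lborel. ?form w p x)"
    by (intro integral_cong_AE borel_measurable_integrable)
  also have "\<dots> = 0" by (rule weak[OF \<phi> K(1) KD K(3)])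
  finally show "(LINT x|lborel. ?form (mollify \<delta>) (mollify_partial \<delta>) x) = 0" .
qed

section \<open>Neumann solutions in a half space and even reflection\<close>

definition upper_half :: "(real^3) set" where "upper_half = {x. x $ 3 > 0}"

definition reflect :: "real^3 \<Rightarrow> real^3" where
  "reflect x = (\<chi> i. if i = 3 then - x $ i else x $ i)"

definition reflection_sign :: "3 \<Rightarrow> complex" where
  "reflection_sign i = (if i = 3 then - 1 else 1)"

lemma open_upper_half: "open upper_half"
  unfolding upper_half_def by (intro open_Collect_less continuous_intros)

lemma reflect_nth [simp]: "reflect x $ i = (if i = 3 then - x $ i else x $ i)"
  by (simp add: reflect_def)

lemma reflect_reflect [simp]: "reflect (reflect x) = x"
  by (simp add: vec_eq_iff)

lemma norm_reflect [simp]: "norm (reflect x) = norm x"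
  unfolding norm_eq_sqrt_inner by (simp add: inner_vec_def sum_3)

lemma continuous_on_reflect [continuous_intros]:
  assumes "continuous_on S f"
  shows "continuous_on S (\<lambda>x. reflect (f x))"
proof -
  have "continuous_on S (\<lambda>x. if i = 3 then - f x $ i else f x $ i)" for i
    by (cases "i = 3") (auto intro!: continuous_intros assms)
  then show ?thesis unfolding reflect_def by (rule continuous_on_vec_lambda)
qed

lemma reflect_measurable [measurable]: "reflect \<in> borel_measurable borel"
  by (intro borel_measurable_continuous_onI continuous_intros)

lemma distr_lborel_reflect: "distr lborel borel reflect = lborel"
proof -
  define c where "c = (\<lambda>b::real^3. if b = axis 3 1 then - 1 else 1 :: real)"
  have c_axis: "c (axis i 1) = (if i = 3 then - 1 else 1)" for i
    by (auto simp: c_def axis_eq_axis)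
  have reflect_eq: "reflect = (\<lambda>x. 0 + (\<Sum>b\<in>Basis. (c b * (x \<bullet> b)) *\<^sub>R b))"
  proof (rule ext, rule euclidean_eqI)
    fix x b :: "real^3" assume b: "b \<in> Basis"
    then obtain i where "b = axis i 1" by (auto simp: Basis_vec_def)
    then have "reflect x \<bullet> b = c b * (x \<bullet> b)" by (simp add: c_axis inner_axis)
    then show "reflect x \<bullet> b = (0 + (\<Sum>b\<in>Basis. (c b * (x \<bullet> b)) *\<^sub>R b)) \<bullet> b"
      using b by (simp add: inner_sum_left_Basis)
  qed
  have prod_eq: "(\<Prod>b\<in>Basis. \<bar>c b\<bar>) = 1" by (rule prod.neutral) (simp add: c_def)
  have "lborel = density (distr lborel borel reflect) (\<lambda>_. (\<Prod>b\<in>Basis. \<bar>c b\<bar>))"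
    unfolding reflect_eq by (rule lborel_affine_euclidean) (simp add: c_def)
  from this[unfolded prod_eq ennreal_1 density_1] show ?thesis by (rule sym)
qed

lemma lborel_integrable_reflect:
  fixes f :: "real^3 \<Rightarrow> complex"
  assumes "integrable lborel f"
  shows "integrable lborel (\<lambda>x. f (reflect x))"
  using assms integrable_distr[of reflect lborel borel f] by (simp add: distr_lborel_reflect)

lemma lborel_integral_reflect:
  fixes f :: "real^3 \<Rightarrow> complex"
  assumes "integrable lborel f"
  shows "(LINT x|lborel. f (reflect x)) = (LINT x|lborel. f x)"
  using integral_distr[of reflect lborel borel f] borel_measurable_integrable[OF assms]
  by (simp add: distr_lborel_reflect)

lemma has_partial_on_reflect:
  fixes g :: "real^3 \<Rightarrow> complex"
  assumes "has_partial_on g i g' S"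
  shows "has_partial_on (\<lambda>x. g (reflect x)) i (\<lambda>x. reflection_sign i * g' (reflect x)) (reflect -` S)"
  unfolding has_partial_on_def
proof
  fix x assume "x \<in> reflect -` S"
  then have x: "reflect x \<in> S" by simp
  define s :: real where "s = (if i = 3 then - 1 else 1)"
  have line: "reflect (x + t *\<^sub>R axis i 1) = reflect x + (t * s) *\<^sub>R axis i 1" for t
    by (auto simp: vec_eq_iff s_def axis_def)
  have "((\<lambda>t. g (reflect x + t *\<^sub>R axis i 1)) has_vector_derivative g' (reflect x)) (at (0 * s))"
    using assms x by (simp add: has_partial_on_def)
  moreover have "((\<lambda>t. t * s) has_vector_derivative s) (at 0)" by (auto intro!: derivative_eq_intros)
  ultimately have "((\<lambda>t. g (reflect x + (t * s) *\<^sub>R axis i 1))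
      has_vector_derivative s *\<^sub>R g' (reflect x)) (at 0)"
    using vector_diff_chain_at[of "\<lambda>t. t * s" s 0] by (auto simp: o_def)
  then show "((\<lambda>t. g (reflect (x + t *\<^sub>R axis i 1)))
      has_vector_derivative reflection_sign i * g' (reflect x)) (at 0)"
    unfolding line reflection_sign_def s_def by (cases "i = 3") simp_all
qed

definition plane_cutoff :: "real \<Rightarrow> real^3 \<Rightarrow> complex" where
  "plane_cutoff e y = of_real (smoothstep (y $ 3 / e - 1))"

definition plane_cutoff_partial :: "real \<Rightarrow> 3 \<Rightarrow> real^3 \<Rightarrow> complex" where
  "plane_cutoff_partial e i y = (if i = 3 then of_real (smoothstep1 (y $ 3 / e - 1) / e) else 0)"

lemma C1_on_plane_cutoff: "C1_on UNIV (plane_cutoff e) (plane_cutoff_partial e)"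
  unfolding C1_on_def
proof (intro conjI allI)
  fix i :: 3
  show "continuous_on UNIV (plane_cutoff e)"
    unfolding plane_cutoff_def[abs_def] divide_inverse by (intro continuous_intros)
  show "continuous_on UNIV (plane_cutoff_partial e i)"
    unfolding plane_cutoff_partial_def[abs_def] divide_inverse
    by (cases "i = 3") (auto intro!: continuous_intros)
  show "has_partial_on (plane_cutoff e) i (plane_cutoff_partial e i) UNIV"
    unfolding has_partial_on_def plane_cutoff_def
  proof
    fix x :: "real^3"
    have "((\<lambda>t. (x $ 3 + t) / e - 1) has_real_derivative 1 / e) (at 0)"
      unfolding divide_inverse by (auto intro!: derivative_eq_intros)
    from DERIV_chain2[OF has_real_derivative_smoothstep(1) this, THEN
      has_vector_derivative_of_real[where 'a=complex]]
    show "((\<lambda>t. complex_of_real (smoothstep ((x + t *\<^sub>R axis i 1) $ 3 / e - 1))) has_vector_derivative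
        plane_cutoff_partial e i x) (at 0)"
      by (cases "i = 3") (simp_all add: plane_cutoff_partial_def axis_def)
  qed
qed

lemma plane_cutoff_below:
  assumes "e > 0" "y $ 3 \<le> e"
  shows "plane_cutoff e y = 0" "plane_cutoff_partial e i y = 0"
  using assms by (auto simp: plane_cutoff_def plane_cutoff_partial_def smoothstep_left)

lemma plane_cutoff_above:
  assumes "e > 0" "y $ 3 \<ge> 2 * e"
  shows "plane_cutoff e y = 1" "plane_cutoff_partial e i y = 0"
proof -
  have "y $ 3 / e - 1 \<ge> 1" using assms by (simp add: field_simps)
  then show "plane_cutoff e y = 1" "plane_cutoff_partial e i y = 0"
    by (simp_all add: plane_cutoff_def plane_cutoff_partial_def smoothstep_right)
qed

text \<open>
  In the normal direction the derivative of the cutoff has size \<open>1 / e\<close> in a layer of width \<open>e\<close>,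
  which is why \<open>g\<close> must vanish on the plane there.
\<close>

lemma norm_plane_cutoff_partial_mult_le:
  assumes g: "has_partial_on g i g' UNIV" "\<And>x. cmod (g' x) \<le> B" "\<And>x. i = 3 \<Longrightarrow> x $ 3 = 0 \<Longrightarrow> g x = 0"
    and e: "e > 0"
  shows "cmod (plane_cutoff_partial e i y * g y) \<le> 280 * B"
proof (cases "i = 3 \<and> e \<le> y $ 3 \<and> y $ 3 \<le> 2 * e")
  case True
  have B: "B \<ge> 0" by (rule order_trans[OF norm_ge_zero g(2)])
  define z where "z = y - (y $ 3) *\<^sub>R axis 3 1"
  have "g z = 0" by (rule g(3)) (use True in \<open>auto simp: z_def\<close>)
  then have "cmod (g y) \<le> B * \<bar>y $ 3\<bar>"
    using norm_partial_increment_le[OF g(1), of "y $ 3" z 0 B] g(2) True by (simp add: z_def)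
  also have "\<dots> \<le> B * (2 * e)" using True B e by (intro mult_left_mono) auto
  finally have "cmod (plane_cutoff_partial e i y) * cmod (g y) \<le> 140 / e * (B * (2 * e))"
    using True e smoothstep1_nonneg smoothstep1_le
    by (intro mult_mono) (auto simp: plane_cutoff_partial_def norm_divide divide_right_mono)
  then show ?thesis using e by (simp add: norm_mult)
next
  case False
  have "plane_cutoff_partial e i y = 0"
    using False plane_cutoff_below(2)[OF e, of y i] plane_cutoff_above(2)[OF e, of y i]
    by (cases "i = 3") (auto simp: plane_cutoff_partial_def)
  then show ?thesis using order_trans[OF norm_ge_zero g(2)] by simp
qed

lemma integral_plane_cutoff_eq_0:
  assumes "open D" and u: "C1_on (upper_half \<inter> D) u q"
    and g: "continuous_on UNIV g" "has_partial_on g i g' UNIV" "continuous_on UNIV g'"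
    and K: "compact K" "K \<subseteq> D" "\<And>x. x \<notin> K \<Longrightarrow> g x = 0" and e: "e > 0"
  shows "(LINT y|lborel. indicator upper_half y *\<^sub>R
    (q i y * (plane_cutoff e y * g y) + u y * (plane_cutoff_partial e i y * g y
      + plane_cutoff e y * g' y))) = 0"
proof -
  let ?K = "K \<inter> {y. y $ 3 \<ge> e}"
  have K_e: "compact ?K" "?K \<subseteq> upper_half \<inter> D"
    using K e by (auto intro!: compact_Int_closed closed_Collect_le continuous_intros
      simp: upper_half_def)
  have zero: "plane_cutoff e y * g y = 0" if "y \<notin> ?K" for y
    using that K(3)[of y] plane_cutoff_below(1)[OF e, of y] by auto
  note chi = C1_onD[OF C1_on_plane_cutoff[of e]]
  from has_partial_on_mult[OF chi(2) g(2)]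
  have "(LINT y|lborel. q i y * (plane_cutoff e y * g y)
      + u y * (plane_cutoff_partial e i y * g y + plane_cutoff e y * g' y)) = 0"
    by (intro integration_by_parts_compact_support[OF _ C1_onD[OF u] _ _ _ K_e zero]
      continuous_intros chi g)
      (use \<open>open D\<close> open_upper_half in auto)
  moreover have "plane_cutoff e y = 0" "plane_cutoff_partial e i y = 0" if "y \<notin> upper_half" for y
    using that plane_cutoff_below[OF e, of y] e by (auto simp: upper_half_def)
  then have "indicator upper_half y *\<^sub>R
      (q i y * (plane_cutoff e y * g y) + u y * (plane_cutoff_partial e i y * g y
        + plane_cutoff e y * g' y))
    = q i y * (plane_cutoff e y * g y) + u y * (plane_cutoff_partial e i y * g y
      + plane_cutoff e y * g' y)" for y
    by (cases "y \<in> upper_half") auto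
  ultimately show ?thesis by simp
qed

lemma norm_plane_cutoff_integrand_le:
  assumes g: "has_partial_on g i g' UNIV" "\<And>x. cmod (g' x) \<le> B" and normal: "\<And>x. i = 3 \<Longrightarrow>
      x $ 3 = 0 \<Longrightarrow> g x = 0"
    and e: "e > 0"
  shows "cmod (a * (plane_cutoff e y * g y) + b * (plane_cutoff_partial e i y * g y
      + plane_cutoff e y * g' y))
    \<le> cmod (a * g y + b * g' y) + cmod b * (280 * B)"
proof -
  have "cmod (plane_cutoff e y * (a * g y + b * g' y)) \<le> cmod (a * g y + b * g' y)"
    using smoothstep_bounds by (simp add: plane_cutoff_def norm_mult mult_left_le_one_le)
  moreover have "cmod (b * (plane_cutoff_partial e i y * g y)) \<le> cmod b * (280 * B)"
    unfolding norm_mult[of b] using norm_plane_cutoff_partial_mult_le[OF g normal e]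
    by (intro mult_left_mono) auto
  ultimately have "cmod (plane_cutoff e y * (a * g y + b * g' y)
      + b * (plane_cutoff_partial e i y * g y))
      \<le> cmod (a * g y + b * g' y) + cmod b * (280 * B)" by (rule norm_triangle_mono)
  then show ?thesis by (simp add: algebra_simps)
qed

lemma integral_plane_cutoff_tendsto:
  fixes a b :: "real^3 \<Rightarrow> complex"
  assumes g: "continuous_on UNIV g" "has_partial_on g i g' UNIV" "continuous_on UNIV g'"
    and K: "compact K" "\<And>x. x \<notin> K \<Longrightarrow> g x = 0" and normal: "\<And>x. i = 3 \<Longrightarrow> x $ 3 = 0 \<Longrightarrow> g x = 0"
    and int: "set_integrable lborel K a" "set_integrable lborel K b"
    and upper: "\<And>x. x \<notin> upper_half \<Longrightarrow> a x = 0" "\<And>x. x \<notin> upper_half \<Longrightarrow> b x = 0"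
  shows "((\<lambda>e. LINT y|lborel. a y * (plane_cutoff e y * g y)
      + b y * (plane_cutoff_partial e i y * g y + plane_cutoff e y * g' y))
    \<longlongrightarrow> (LINT y|lborel. a y * g y + b y * g' y)) (at_right 0)"
proof -
  let ?G = "\<lambda>e y. a y * (plane_cutoff e y * g y)
      + b y * (plane_cutoff_partial e i y * g y + plane_cutoff e y * g' y)"
  have g': "g' x = 0" if "x \<notin> K" for x by (rule partial_eq_0_outside[OF g(2) K that])
  note mult_integrable = integrable_mult_compact_support[OF int(1) _ K(1)]
    integrable_mult_compact_support[OF int(2) _ K(1)]
  obtain B where B: "B > 0" "\<And>x. cmod (g' x) \<le> B"
    using bounded_continuous_compact_support[OF g(3) K(1) g'] by blast
  note chi = C1_onD[OF C1_on_plane_cutoff]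
  show ?thesis
  proof (rule tendsto_integral_dominated)
    show "integrable lborel (\<lambda>y. cmod (a y * g y + b y * g' y)
        + cmod (indicator K y *\<^sub>R b y) * (280 * B))"
      using mult_integrable(1)[OF g(1) K(2)] mult_integrable(2)[OF g(3) g']
        int(2)[unfolded set_integrable_def]
      by (intro Bochner_Integration.integrable_add integrable_norm integrable_mult_left)
    have "integrable lborel (?G e)" for e
      by (intro Bochner_Integration.integrable_add mult_integrable continuous_intros chi g)
        (simp_all add: K(2) g')
    then show "?G e \<in> borel_measurable lborel" for e by (rule borel_measurable_integrable)
    show "cmod (?G e y) \<le> cmod (a y * g y + b y * g' y) + cmod (indicator K y *\<^sub>R b y) * (280 * B)"
      if "e \<in> {0<..} - {0}" for e y
    proof (cases "y \<in> K")
      case True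
      then show ?thesis using norm_plane_cutoff_integrand_le[OF g(2) B(2) normal, of e "a y" y "b y"]
        that by simp
    qed (simp add: K(2) g')
    show "((\<lambda>e. ?G e y) \<longlongrightarrow> a y * g y + b y * g' y) (at_right 0)" for y
    proof (rule tendsto_eventually, cases "y \<in> upper_half")
      case True
      then have "y $ 3 / 2 > 0" by (simp add: upper_half_def)
      then show "\<forall>\<^sub>F e in at_right 0. ?G e y = a y * g y + b y * g' y"
        unfolding eventually_at_right_field using plane_cutoff_above[of _ y]
        by (intro exI[of _ "y $ 3 / 2"]) auto
    qed (simp add: upper)
  qed
qed

lemma integration_by_parts_half_space:
  fixes u :: "real^3 \<Rightarrow> complex"
  assumes D: "open D" and u: "C1_on (upper_half \<inter> D) u q"
    and g: "continuous_on UNIV g" "has_partial_on g i g' UNIV" "continuous_on UNIV g'"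
    and K: "compact K" "K \<subseteq> D" "\<And>x. x \<notin> K \<Longrightarrow> g x = 0"
    and u_int: "set_integrable lborel K (\<lambda>x. indicator upper_half x *\<^sub>R u x)"
    and q_int: "set_integrable lborel K (\<lambda>x. indicator upper_half x *\<^sub>R q i x)"
    and normal: "\<And>x. i = 3 \<Longrightarrow> x $ 3 = 0 \<Longrightarrow> g x = 0"
  shows "(LINT x|lborel. indicator upper_half x *\<^sub>R (q i x * g x + u x * g' x)) = 0"
proof -
  let ?u = "\<lambda>x. indicator upper_half x *\<^sub>R u x" and ?q = "\<lambda>x. indicator upper_half x *\<^sub>R q i x"
  have "((\<lambda>e. LINT y|lborel. ?q y * (plane_cutoff e y * g y)
      + ?u y * (plane_cutoff_partial e i y * g y + plane_cutoff e y * g' y))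
    \<longlongrightarrow> (LINT x|lborel. ?q x * g x + ?u x * g' x)) (at_right 0)"
    by (rule integral_plane_cutoff_tendsto[OF g K(1,3) normal q_int u_int]) simp_all
  moreover have "((\<lambda>e. LINT y|lborel. ?q y * (plane_cutoff e y * g y)
      + ?u y * (plane_cutoff_partial e i y * g y + plane_cutoff e y * g' y)) \<longlongrightarrow> 0) (at_right 0)"
    using integral_plane_cutoff_eq_0[OF D u g K]
    by (intro tendsto_eventually) (auto simp: eventually_at_right_field scaleR_add_right
      intro!: exI[of _ 1])
  ultimately have "(LINT x|lborel. ?q x * g x + ?u x * g' x) = 0"
    by (rule tendsto_unique[OF trivial_limit_at_right_real])
  then show ?thesis by (simp add: scaleR_add_right)
qed

definition even_ext :: "(real^3 \<Rightarrow> complex) \<Rightarrow> real^3 \<Rightarrow> complex" where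
  "even_ext u x = indicator upper_half x *\<^sub>R u x + indicator upper_half (reflect x) *\<^sub>R u (reflect x)"

definition even_ext_partial :: "(3 \<Rightarrow> real^3 \<Rightarrow> complex) \<Rightarrow> 3 \<Rightarrow> real^3 \<Rightarrow> complex" where
  "even_ext_partial q i x = indicator upper_half x *\<^sub>R q i x
     + reflection_sign i * (indicator upper_half (reflect x) *\<^sub>R q i (reflect x))"

lemma even_ext_upper:
  assumes "x \<in> upper_half"
  shows "even_ext u x = u x" "even_ext_partial q i x = q i x"
  using assms by (simp_all add: even_ext_def even_ext_partial_def upper_half_def)

lemma even_ext_reflect:
  "even_ext u (reflect x) = even_ext u x"
  "even_ext_partial q i (reflect x) = reflection_sign i * even_ext_partial q i x"
  by (simp_all add: even_ext_def even_ext_partial_def reflection_sign_def)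

lemma integral_add_reflect:
  fixes F H :: "real^3 \<Rightarrow> complex"
  assumes "integrable lborel F" "integrable lborel H"
  shows "(LINT x|lborel. F x + H (reflect x)) = (LINT x|lborel. F x + H x)"
  using assms lborel_integrable_reflect[OF assms(2)] lborel_integral_reflect[OF assms(2)] by simp

lemma reflect_notin: "x \<notin> reflect ` K \<Longrightarrow> reflect x \<notin> K"
  by (metis image_eqI reflect_reflect)

locale half_space_weak_helmholtz =
  fixes k :: real and D :: "(real^3) set" and u :: "real^3 \<Rightarrow> complex" and q :: "3 \<Rightarrow> real^3 \<Rightarrow> complex"
  assumes open_D: "open D" and reflect_D: "x \<in> D \<Longrightarrow> reflect x \<in> D" and u_C1: "C1_on (upper_half \<inter> D) u q"
    and u_integrable: "compact K \<Longrightarrow> K \<subseteq> D \<Longrightarrow> set_integrable lborel K (\<lambda>x. indicator upper_half x *\<^sub>R u x)"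
    and q_integrable: "compact K \<Longrightarrow> K \<subseteq> D \<Longrightarrow> set_integrable lborel K
        (\<lambda>x. indicator upper_half x *\<^sub>R q i x)"
    and half_space_weak: "C1_on UNIV \<phi> D\<phi> \<Longrightarrow> compact K \<Longrightarrow> K \<subseteq> D \<Longrightarrow> (\<And>x. x \<notin> K \<Longrightarrow> \<phi> x = 0) \<Longrightarrow>
      (LINT x|lborel. indicator upper_half x *\<^sub>R ((\<Sum>i\<in>UNIV. q i x * D\<phi> i x)
        - of_real (k^2) * u x * \<phi> x)) = 0"
begin

lemma compact_Un_reflect:
  assumes "compact K" "K \<subseteq> D"
  shows "compact (K \<union> reflect ` K)" "K \<union> reflect ` K \<subseteq> D"
  using assms reflect_D by (auto intro!: compact_Un compact_continuous_image continuous_intros)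

lemma set_integrable_add_reflect:
  fixes v :: "real^3 \<Rightarrow> complex"
  assumes K: "compact K" "K \<subseteq> D"
    and v: "\<And>K. compact K \<Longrightarrow> K \<subseteq> D \<Longrightarrow> set_integrable lborel K (\<lambda>x. indicator upper_half x *\<^sub>R v x)"
  shows "set_integrable lborel K (\<lambda>x. indicator upper_half x *\<^sub>R v x
      + c * (indicator upper_half (reflect x) *\<^sub>R v (reflect x)))"
proof -
  have rK: "compact (reflect ` K)" "reflect ` K \<subseteq> D"
    using K reflect_D by (auto intro!: compact_continuous_image continuous_intros)
  have ind: "indicat_real (reflect ` K) (reflect x) = indicator K x" for x
    by (metis (no_types, lifting) image_iff indicator_simps reflect_reflect)
  have "integrable lborel (\<lambda>x. indicator K x *\<^sub>R indicator upper_half (reflect x) *\<^sub>R v (reflect x))"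
    using lborel_integrable_reflect[OF v[OF rK, unfolded set_integrable_def]] unfolding ind .
  then have "set_integrable lborel K (\<lambda>x. c * (indicator upper_half (reflect x) *\<^sub>R v (reflect x)))"
    unfolding set_integrable_def using integrable_mult_right by fastforce
  then show ?thesis by (intro set_integral_add v K)
qed

lemma even_ext_weak:
  assumes \<phi>: "C1_on UNIV \<phi> D\<phi>" and K: "compact K" "K \<subseteq> D" "\<And>x. x \<notin> K \<Longrightarrow> \<phi> x = 0"
  shows "(LINT x|lborel. (\<Sum>i\<in>UNIV. even_ext_partial q i x * D\<phi> i x)
      - of_real (k^2) * even_ext u x * \<phi> x) = 0"
proof -
  let ?\<psi> = "\<lambda>x. \<phi> (reflect x)" and ?D\<psi> = "\<lambda>i x. reflection_sign i * D\<phi> i (reflect x)"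
  let ?form = "\<lambda>f Df x. indicator upper_half x *\<^sub>R ((\<Sum>i\<in>UNIV. q i x * Df i x)
      - of_real (k^2) * u x * f x)"
  have \<psi>: "C1_on UNIV ?\<psi> ?D\<psi>"
    unfolding C1_on_def using has_partial_on_reflect[OF C1_onD(2)[OF \<phi>]]
    by (auto intro!: continuous_intros continuous_on_compose2[OF C1_onD(1)[OF \<phi>]]
      continuous_on_compose2[OF C1_onD(3)[OF \<phi>]])
  note K' = compact_Un_reflect[OF K(1,2)]
  have form_int: "integrable lborel (?form f Df)"
    if f: "C1_on UNIV f Df" and K: "compact K" "K \<subseteq> D" "\<And>x. x \<notin> K \<Longrightarrow> f x = 0" for f Df K
  proof -
    have Df: "Df i x = 0" if "x \<notin> K" for i x by (rule
      partial_eq_0_outside[OF C1_onD(2)[OF f] K(1,3) that])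
    have "integrable lborel (\<lambda>x. (\<Sum>i\<in>UNIV. (indicator upper_half x *\<^sub>R q i x) * Df i x)
        - of_real (k^2) * ((indicator upper_half x *\<^sub>R u x) * f x))"
      by (intro Bochner_Integration.integrable_diff Bochner_Integration.integrable_sum
        integrable_mult_right
          integrable_mult_compact_support[OF q_integrable[OF K(1,2)] C1_onD(3)[OF f] K(1) Df]
          integrable_mult_compact_support[OF u_integrable[OF K(1,2)] C1_onD(1)[OF f] K(1,3)])
    then show ?thesis by (simp add: scaleR_diff_right scaleR_sum_right mult.assoc)
  qed
  have "(LINT x|lborel. (\<Sum>i\<in>UNIV. even_ext_partial q i x * D\<phi> i x) - of_real (k^2) * even_ext u x * \<phi> x)
      = (LINT x|lborel. ?form \<phi> D\<phi> x + ?form ?\<psi> ?D\<psi> (reflect x))"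
    by (intro Bochner_Integration.integral_cong refl)
      (simp add: even_ext_def even_ext_partial_def sum_3 algebra_simps scaleR_conv_of_real)
  also have "\<dots> = (LINT x|lborel. ?form \<phi> D\<phi> x + ?form ?\<psi> ?D\<psi> x)"
    by (rule integral_add_reflect[OF form_int[OF \<phi> K] form_int[OF \<psi> K']])
      (simp_all add: K(3) reflect_notin)
  also have "\<dots> = (LINT x|lborel. ?form (\<lambda>x. \<phi> x + ?\<psi> x) (\<lambda>i x. D\<phi> i x + ?D\<psi> i x) x)"
    by (intro Bochner_Integration.integral_cong refl)
      (simp add: sum_3 algebra_simps scaleR_conv_of_real)
  also have "\<dots> = 0"
    by (rule half_space_weak[OF C1_on_add[OF \<phi> \<psi>] K']) (simp add: K(3) reflect_notin)
  finally show ?thesis .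
qed

lemma even_ext_weak_gradient:
  assumes g: "continuous_on UNIV g" "has_partial_on g i g' UNIV" "continuous_on UNIV g'"
    and K: "compact K" "K \<subseteq> D" "\<And>x. x \<notin> K \<Longrightarrow> g x = 0"
  shows "(LINT x|lborel. even_ext_partial q i x * g x + even_ext u x * g' x) = 0"
proof -
  let ?h = "\<lambda>x. reflection_sign i * g (reflect x)" and ?h' = "\<lambda>x. g' (reflect x)"
  let ?form = "\<lambda>f f' x. indicator upper_half x *\<^sub>R (q i x * f x + u x * f' x)"
  have "has_partial_on ?h i (\<lambda>x. 0 * g (reflect x)
      + reflection_sign i * (reflection_sign i * g' (reflect x))) UNIV"
    using has_partial_on_reflect[OF g(2)] by (intro has_partial_on_mult has_partial_on_const) simp
  then have h: "continuous_on UNIV ?h" "has_partial_on ?h i ?h' UNIV" "continuous_on UNIV ?h'"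
    by (auto simp: reflection_sign_def intro!: continuous_intros continuous_on_compose2[OF g(1)]
        continuous_on_compose2[OF g(3)] split: if_splits)
  note K' = compact_Un_reflect[OF K(1,2)]
  have form_int: "integrable lborel (?form f f')"
    if f: "continuous_on UNIV f" "has_partial_on f i f' UNIV" "continuous_on UNIV f'"
      and K: "compact K" "K \<subseteq> D" "\<And>x. x \<notin> K \<Longrightarrow> f x = 0" for f f' K
    using integrable_mult_compact_support[OF q_integrable[OF K(1,2)] f(1) K(1,3)]
      integrable_mult_compact_support[OF u_integrable[OF K(1,2)] f(3) K(1)
        partial_eq_0_outside[OF f(2) K(1,3)]]
    by (simp add: scaleR_add_right Bochner_Integration.integrable_add)
  have zero: "g x + ?h x = 0" if "x \<notin> K \<union> reflect ` K" for x using that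
    by (simp add: K(3) reflect_notin)
  have "reflect x = x" if "x $ 3 = 0" for x :: "real^3" using that by (simp add: vec_eq_iff)
  then have normal: "g x + ?h x = 0" if "i = 3" "x $ 3 = 0" for x using that
    by (simp add: reflection_sign_def)
  have "(LINT x|lborel. even_ext_partial q i x * g x + even_ext u x * g' x)
      = (LINT x|lborel. ?form g g' x + ?form ?h ?h' (reflect x))"
    by (intro Bochner_Integration.integral_cong refl)
      (simp add: even_ext_def even_ext_partial_def algebra_simps scaleR_conv_of_real)
  also have "\<dots> = (LINT x|lborel. ?form g g' x + ?form ?h ?h' x)"
    by (rule integral_add_reflect[OF form_int[OF g K] form_int[OF h K']])
      (simp_all add: K(3) reflect_notin)
  also have "\<dots> = (LINT x|lborel. ?form (\<lambda>x. g x + ?h x) (\<lambda>x. g' x + ?h' x) x)"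
    by (intro Bochner_Integration.integral_cong refl) (simp add: algebra_simps scaleR_conv_of_real)
  also have "\<dots> = 0"
    by (rule integration_by_parts_half_space[OF open_D u_C1 _ _ _ K' zero u_integrable[OF K']
      q_integrable[OF K'] normal])
      (intro continuous_intros has_partial_on_add g h)+
  finally show ?thesis .
qed

lemma weak_helmholtz_even_ext: "weak_helmholtz k D (even_ext u) (even_ext_partial q)"
proof
  show "set_integrable lborel K (even_ext u)" "set_integrable lborel K (even_ext_partial q i)"
    if "compact K" "K \<subseteq> D" for K i
    using set_integrable_add_reflect[OF that u_integrable, of 1]
      set_integrable_add_reflect[OF that q_integrable, of i "reflection_sign i"]
    by (simp_all add: even_ext_def[abs_def] even_ext_partial_def[abs_def])
qed (fact even_ext_weak even_ext_weak_gradient)+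

end

lemma set_integrable_of_square:
  fixes f :: "'a::euclidean_space \<Rightarrow> complex"
  assumes A: "A \<in> sets borel" "bounded A" "continuous_on A f"
    and f: "set_integrable lborel A (\<lambda>x. (cmod (f x))^2)"
  shows "set_integrable lborel A f"
proof (rule set_integrable_bound)
  have "set_integrable lborel A (\<lambda>x. 1 :: real)"
    using A emeasure_bounded_finite[OF A(2)] by (simp add: set_integrable_def)
  then show "set_integrable lborel A (\<lambda>x. 1 + (cmod (f x))^2)" using f by (rule set_integral_add(1))
  show "set_borel_measurable lborel A f"
    using borel_measurable_continuous_on_indicator[OF A(1,3)] by (simp add: set_borel_measurable_def)
  have "cmod (f x) \<le> 1 + (cmod (f x))^2" for x
    using sum_squares_bound[of 1 "cmod (f x)"] norm_ge_zero[of "f x"]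
    by (simp only: power_one mult_1_right)
  then show "AE x in lborel. x \<in> A \<longrightarrow> norm (f x) \<le> norm (1 + (cmod (f x))^2)"
    by (intro AE_I2) auto
qed

lemma test_fun_Re_Im:
  assumes \<phi>: "C1_on UNIV \<phi> D\<phi>" "compact K" "\<And>x. x \<notin> K \<Longrightarrow> \<phi> x = 0"
  shows "test_fun (\<lambda>x. Re (\<phi> x)) (\<lambda>i x. Re (D\<phi> i x))" "test_fun (\<lambda>x. Im (\<phi> x)) (\<lambda>i x. Im (D\<phi> i x))"
proof -
  have "{x. Re (\<phi> x) \<noteq> 0} \<subseteq> K" "{x. Im (\<phi> x) \<noteq> 0} \<subseteq> K" using \<phi>(3) by force+
  then have "bounded {x. Re (\<phi> x) \<noteq> 0}" "bounded {x. Im (\<phi> x) \<noteq> 0}"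
    using bounded_subset[OF compact_imp_bounded[OF \<phi>(2)]] by blast+
  then show "test_fun (\<lambda>x. Re (\<phi> x)) (\<lambda>i x. Re (D\<phi> i x))" "test_fun (\<lambda>x. Im (\<phi> x)) (\<lambda>i x. Im (D\<phi> i x))"
    using \<phi>(1) unfolding test_fun_def C1_on_def has_partial_on_def
    by (auto intro!: continuous_intros bounded_linear.has_vector_derivative[OF bounded_linear_Re]
        bounded_linear.has_vector_derivative[OF bounded_linear_Im])
qed

lemma weak_neumann_complex_test:
  assumes u: "weak_neumann k S u p" and \<phi>: "C1_on UNIV \<phi> D\<phi>" "compact K" "\<And>x. x \<notin> K \<Longrightarrow> \<phi> x = 0"
  shows "(LINT x:S|lborel. (\<Sum>i\<in>UNIV. p i x * D\<phi> i x) - of_real (k^2) * u x * \<phi> x) = 0"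
proof -
  let ?form = "\<lambda>f Df x. (\<Sum>i\<in>UNIV. p i x * of_real (Df i x)) - of_real (k^2) * u x * of_real (f x)"
  let ?Re = "?form (\<lambda>x. Re (\<phi> x)) (\<lambda>i x. Re (D\<phi> i x))"
    and ?Im = "?form (\<lambda>x. Im (\<phi> x)) (\<lambda>i x. Im (D\<phi> i x))"
  have real: "set_integrable lborel S (?form f Df)" "(LINT x:S|lborel. ?form f Df x) = 0"
    if "test_fun f Df" for f Df
    using u that unfolding weak_neumann_def Let_def by blast+
  note re = real[OF test_fun_Re_Im(1)[OF \<phi>]] and im = real[OF test_fun_Re_Im(2)[OF \<phi>]]
  have "(\<Sum>i\<in>UNIV. p i x * D\<phi> i x) - of_real (k^2) * u x * \<phi> x = ?Re x + \<i> * ?Im x" for x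
    by (subst (1 2 3) complex_eq) (simp add: sum_3 algebra_simps)
  then have "(LINT x:S|lborel. (\<Sum>i\<in>UNIV. p i x * D\<phi> i x) - of_real (k^2) * u x * \<phi> x)
      = (LINT x:S|lborel. ?Re x + \<i> * ?Im x)" by presburger
  also have "\<dots> = (LINT x:S|lborel. ?Re x) + \<i> * (LINT x:S|lborel. ?Im x)"
    using re(1) im(1) by (subst set_integral_add(2)) auto
  finally show ?thesis using re(2) im(2) by simp
qed

lemma weak_helmholtz_neumann:
  assumes u: "helmholtz_C2 k S u p" "weak_neumann k S u p"
    and D: "open D" "\<And>x. x \<in> D \<Longrightarrow> reflect x \<in> D" "\<And>x. x \<in> D \<Longrightarrow> x \<in> S \<longleftrightarrow> x \<in> upper_half"
  shows "weak_helmholtz k D (even_ext u) (even_ext_partial p)"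
proof (rule half_space_weak_helmholtz.weak_helmholtz_even_ext, unfold_locales)
  show "open D" "\<And>x. x \<in> D \<Longrightarrow> reflect x \<in> D" by (fact D(1), fact D(2))
  have u1: "C1_on S u p" by (rule helmholtz_C2_imp_C1_on[OF u(1)])
  then show "C1_on (upper_half \<inter> D) u p" by (rule C1_on_subset) (use D(3) in auto)
  have integrable: "set_integrable lborel K (\<lambda>x. indicator upper_half x *\<^sub>R v x)"
    if K: "compact K" "K \<subseteq> D" and v: "continuous_on S v"
      "\<And>r. r > 0 \<Longrightarrow> set_integrable lborel (S \<inter> ball 0 r) (\<lambda>x. (cmod (v x))^2)"
    for K v
  proof -
    obtain r where r: "r > 0" "K \<subseteq> ball 0 r"
      using bounded_subset_ballD[OF compact_imp_bounded[OF K(1)], of 0] by blast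
    have sub: "upper_half \<inter> K \<subseteq> S \<inter> ball 0 r" "upper_half \<inter> K \<in> sets borel"
      using K r D(3) open_upper_half by (auto simp: borel_compact)
    have "set_integrable lborel (upper_half \<inter> K) v"
      by (intro set_integrable_of_square set_integrable_subset[OF v(2)[OF r(1)]]
        continuous_on_subset[OF v(1)])
        (use sub compact_imp_bounded[OF K(1)] in \<open>auto intro: bounded_subset\<close>)
    then show ?thesis by (simp add: set_integrable_def indicator_inter_arith mult.commute)
  qed
  show "set_integrable lborel K (\<lambda>x. indicator upper_half x *\<^sub>R u x)"
    "set_integrable lborel K (\<lambda>x. indicator upper_half x *\<^sub>R p i x)" if "compact K" "K \<subseteq> D" for K i
    using integrable[OF that C1_onD(1)[OF u1]] integrable[OF that C1_onD(3)[OF u1]] u(2)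
    by (auto simp: weak_neumann_def)
  fix \<phi> D\<phi> K
  assume \<phi>: "C1_on UNIV \<phi> D\<phi>" and K: "compact K" "K \<subseteq> D" "\<And>x. x \<notin> K \<Longrightarrow> \<phi> x = 0"
  have D\<phi>: "D\<phi> i x = 0" if "x \<notin> K" for i x by (rule
    partial_eq_0_outside[OF C1_onD(2)[OF \<phi>] K(1,3) that])
  have "indicator upper_half x *\<^sub>R ((\<Sum>i\<in>UNIV. p i x * D\<phi> i x) - of_real (k^2) * u x * \<phi> x)
      = indicator S x *\<^sub>R ((\<Sum>i\<in>UNIV. p i x * D\<phi> i x) - of_real (k^2) * u x * \<phi> x)" for x
    using D(3)[of x] K(2) K(3)[of x] D\<phi>[of x] by (cases "x \<in> K") (auto simp: indicator_def)
  then show "(LINT x|lborel. indicator upper_half x *\<^sub>R ((\<Sum>i\<in>UNIV. p i x * D\<phi> i x)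
      - of_real (k^2) * u x * \<phi> x)) = 0"
    using weak_neumann_complex_test[OF u(2) \<phi> K(1,3)] unfolding set_lebesgue_integral_def by presburger
qed

lemma AE_height_nonzero: "AE x::real^3 in lborel. x $ 3 \<noteq> 0"
proof -
  have "{x::real^3. x $ 3 = 0} \<in> null_sets lebesgue"
    using negligible_standard_hyperplane_cart[of 3] by (simp add: negligible_iff_null_sets)
  from AE_not_in[OF this] show ?thesis by (simp add: AE_completion_iff)
qed

lemma C1_on_even_ext:
  assumes u: "C1_on (upper_half \<inter> D) u p" and D: "open D" "\<And>x. x \<in> D \<Longrightarrow> reflect x \<in> D"
  shows "C1_on {x \<in> D. x $ 3 \<noteq> 0} (even_ext u) (even_ext_partial p)"
proof (rule C1_on_locally)
  have up: "C1_on (upper_half \<inter> D) (even_ext u) (even_ext_partial p)"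
    by (rule C1_on_cong[OF u]) (use D(1) open_upper_half in \<open>auto simp: even_ext_upper\<close>)
  have open_down: "open (reflect -` (upper_half \<inter> D))"
    using D(1) open_upper_half by (intro open_vimage continuous_intros) auto
  have "C1_on (reflect -` (upper_half \<inter> D)) (\<lambda>x. u (reflect x))
      (\<lambda>i x. reflection_sign i * p i (reflect x))"
    unfolding C1_on_def
    by (intro conjI allI has_partial_on_reflect continuous_intros C1_onD(2)[OF u]
        continuous_on_compose2[OF C1_onD(1)[OF u]] continuous_on_compose2[OF C1_onD(3)[OF u]]) auto
  then have down: "C1_on (reflect -` (upper_half \<inter> D)) (even_ext u) (even_ext_partial p)"
    by (rule C1_on_cong) (use open_down in \<open>auto simp: even_ext_def even_ext_partial_def
      upper_half_def\<close>)
  fix x assume "x \<in> {x \<in> D. x $ 3 \<noteq> 0}"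
  then have "x \<in> upper_half \<inter> D \<or> x \<in> reflect -` (upper_half \<inter> D)" using D(2)
    by (auto simp: upper_half_def)
  then show "\<exists>U. open U \<and> x \<in> U \<and> C1_on U (even_ext u) (even_ext_partial p)"
    using up down open_down D(1) open_upper_half by (metis open_Int)
qed

lemma directional_even_ext_reflect:
  "directional (reflect x) (even_ext_partial p) (reflect x) = directional x (even_ext_partial p) x"
  unfolding directional_def even_ext_reflect by (simp add: reflection_sign_def sum_3)

lemma even_ext_diff:
  "even_ext (\<lambda>x. u x - v x) x = even_ext u x - even_ext v x"
  "even_ext_partial (\<lambda>i x. p i x - q i x) i x = even_ext_partial p i x - even_ext_partial q i x"
  by (simp_all add: even_ext_def even_ext_partial_def algebra_simps)

lemma norm_le_of_off_plane:
  fixes h :: "real^3 \<Rightarrow> complex"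
  assumes h: "continuous_on {x. norm x > \<rho>} h" and bound: "\<And>x. norm x > \<rho> \<Longrightarrow> x $ 3 \<noteq> 0 \<Longrightarrow> cmod (h x) \<le> e"
    and x: "norm x > \<rho>"
  shows "cmod (h x) \<le> e"
proof (cases "x $ 3 = 0")
  case True
  let ?y = "\<lambda>t. x + t *\<^sub>R axis 3 1"
  have "open {x::real^3. norm x > \<rho>}" by (intro open_Collect_less continuous_intros)
  then have "isCont h x" using h x by (simp add: continuous_on_eq_continuous_at)
  have y: "(?y \<longlongrightarrow> ?y 0) (at_right 0)" by (intro tendsto_intros)
  from isCont_tendsto_compose[OF \<open>isCont h x\<close>] y have "((\<lambda>t. h (?y t)) \<longlongrightarrow> h x) (at_right 0)" by simp
  then have lim: "((\<lambda>t. cmod (h (?y t))) \<longlongrightarrow> cmod (h x)) (at_right 0)" by (rule tendsto_norm)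
  have "\<forall>\<^sub>F t in at_right 0. norm (?y t) > \<rho>" using order_tendstoD(1)[OF tendsto_norm[OF y]] x by simp
  moreover have "\<forall>\<^sub>F t::real in at_right 0. t > 0" by (rule eventually_at_right_less)
  ultimately have "\<forall>\<^sub>F t in at_right 0. cmod (h (?y t)) \<le> e"
    by eventually_elim (use True in \<open>auto intro!: bound simp: axis_def\<close>)
  then show ?thesis using lim by (intro tendsto_upperbound) auto
qed (use bound x in blast)

section \<open>Energy flux of radiating solutions\<close>

definition annulus :: "real \<Rightarrow> real \<Rightarrow> (real^3) set" where
  "annulus a b = cball 0 b - ball 0 a"

lemma compact_annulus: "compact (annulus a b)"
  by (simp add: annulus_def compact_diff)

lemma annulus_iff: "y \<in> annulus a b \<longleftrightarrow> a \<le> norm y \<and> norm y \<le> b"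
  by (auto simp: annulus_def)

lemma cutoff1_eq_0_outside_annulus: "\<rho> > 0 \<Longrightarrow> y \<notin> annulus \<rho> (2 * \<rho>) \<Longrightarrow> cutoff1 \<rho> (dsq 0 y) = 0"
  using cutoff_dsq_eq(2,4)[of \<rho> y 0] by (auto simp: annulus_iff)

definition annular :: "real \<Rightarrow> real \<Rightarrow> real \<Rightarrow> complex" where
  "annular a b s = of_real (cutoff a s - cutoff b s)"

definition annular1 :: "real \<Rightarrow> real \<Rightarrow> real \<Rightarrow> complex" where
  "annular1 a b s = of_real (cutoff1 a s - cutoff1 b s)"

lemma C1_on_annular:
  assumes "a > 0" "b > 0"
  shows "C1_on UNIV (\<lambda>y. annular a b (dsq 0 y)) (radial_partial (annular1 a b) 0)"
proof (rule C1_on_radial)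
  show "(annular a b has_vector_derivative annular1 a b s) (at s)" for s
    unfolding annular_def[abs_def] annular1_def
    by (intro has_vector_derivative_of_real DERIV_diff has_real_derivative_cutoff assms)
  show "continuous_on UNIV (annular1 a b)" unfolding annular1_def[abs_def] by (intro continuous_intros)
qed

lemma annular_dsq_eq_0:
  assumes "0 < a" "a \<le> b" "y \<notin> annulus a (2 * b)"
  shows "annular a b (dsq 0 y) = 0"
proof -
  have "b > 0" using assms(1,2) by simp
  have "norm y \<le> a \<and> norm y \<le> b \<or> norm y \<ge> 2 * a \<and> norm y \<ge> 2 * b"
    using assms by (auto simp: annulus_iff)
  then show ?thesis
    using cutoff_dsq_eq(1,3)[OF assms(1), of y 0] cutoff_dsq_eq(1,3)[OF \<open>b > 0\<close>, of y 0]
    by (auto simp: annular_def)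
qed

lemma annular_dsq_eq_1: "0 < a \<Longrightarrow> 0 < b \<Longrightarrow> 2 * a \<le> norm y \<Longrightarrow> norm y \<le> b \<Longrightarrow> annular a b (dsq 0 y) = 1"
  using cutoff_dsq_eq(3)[of a y 0] cutoff_dsq_eq(1)[of b y 0] by (simp add: annular_def)

lemma integrable_cutoff1:
  fixes f :: "real^3 \<Rightarrow> 'b::{banach, second_countable_topology}"
  assumes "\<rho> > 0" "continuous_on S f" "annulus \<rho> (2 * \<rho>) \<subseteq> S"
  shows "integrable lborel (\<lambda>y. cutoff1 \<rho> (dsq 0 y) *\<^sub>R f y)"
  by (rule integrable_continuous_compact_support[OF _ compact_annulus assms(3)])
    (use assms in \<open>auto intro!: continuous_intros simp: cutoff1_eq_0_outside_annulus\<close>)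

lemma integral_cutoff1_moment_le:
  assumes "\<rho> > 0"
  shows "(LINT y|lborel. cutoff1 \<rho> (dsq 0 (y::real^3)) / norm y ^ m)
      \<le> 1120 * unit_ball_vol 3 * \<rho> / \<rho> ^ m"
proof -
  have "(LINT y|lborel. cutoff1 \<rho> (dsq 0 (y::real^3)) / norm y ^ m)
      \<le> (LINT y|lborel. 140 / \<rho>^2 / \<rho>^m * indicator (cball (0::real^3) (2 * \<rho>)) y)"
  proof (rule integral_mono'[OF integrable_indicator_compact[OF compact_cball]])
    fix y :: "real^3"
    show "cutoff1 \<rho> (dsq 0 y) / norm y ^ m \<le> 140 / \<rho>^2 / \<rho>^m * indicator (cball 0 (2 * \<rho>)) y"
    proof (cases "y \<in> annulus \<rho> (2 * \<rho>)")
      case True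
      then have "\<rho> ^ m \<le> norm y ^ m" using assms by (intro power_mono) (auto simp: annulus_iff)
      then have "cutoff1 \<rho> (dsq 0 y) / norm y ^ m \<le> 140 / \<rho>^2 / \<rho>^m"
        using assms cutoff1_le cutoff1_nonneg by (intro frac_le) auto
      then show ?thesis using True by (simp add: annulus_iff)
    qed (use assms in \<open>simp add: cutoff1_eq_0_outside_annulus\<close>)
  qed (use assms in simp)
  also have "\<dots> = 140 / \<rho>^2 / \<rho>^m * measure lborel (cball (0::real^3) (2 * \<rho>))" by simp
  also have "\<dots> = 1120 * unit_ball_vol 3 * \<rho> / \<rho> ^ m"
    using assms by (simp add: content_cball power_mult_distrib power2_eq_square power3_eq_cube)
  finally show ?thesis .
qed

lemma continuous_on_norm_power_inverse: "continuous_on (- {0}) (\<lambda>y::real^3. 1 / norm y ^ m)"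
  by (intro continuous_intros) auto

lemma integrable_cutoff1_moment:
  assumes "\<rho> > 0"
  shows "integrable lborel (\<lambda>y::real^3. cutoff1 \<rho> (dsq 0 y) / norm y ^ m)"
  using integrable_cutoff1[OF assms continuous_on_norm_power_inverse] assms by (auto simp: annulus_iff)

locale radiating = weak_helmholtz k "{x. norm x > R}" w p
  for k R :: real and w :: "real^3 \<Rightarrow> complex" and p :: "3 \<Rightarrow> real^3 \<Rightarrow> complex" +
  assumes k: "k > 0" and R: "R > 0" and w_C1: "C1_on {x. norm x > R} w p"
    and radiation: "((\<lambda>x. directional x p x - \<i> * of_real (k * norm x) * w x) \<longlongrightarrow> 0) at_infinity"
begin

lemma eventually_radiation_le:
  assumes "e > 0"
  shows "\<forall>\<^sub>F x in at_infinity. cmod (directional x p x - \<i> * of_real (k * norm x) * w x) \<le> e"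
  using tendstoD[OF radiation assms] by eventually_elim simp

lemma continuous_on_radial_w:
  "continuous_on {x. norm x > R} w" "continuous_on {x. norm x > R} (\<lambda>x. directional x p x)"
  using C1_onD[OF w_C1] unfolding directional_def by (auto intro!: continuous_intros)

lemma annulus_exterior: "a > R \<Longrightarrow> annulus a b \<subseteq> {x. norm x > R}"
  by (auto simp: annulus_iff)

definition flux :: "real \<Rightarrow> real" where
  "flux \<rho> = (LINT y|lborel. cutoff1 \<rho> (dsq 0 y) * Im (directional y p y * cnj (w y)))"

lemma flux_integrable:
  assumes "\<rho> > R"
  shows "integrable lborel (\<lambda>y. cutoff1 \<rho> (dsq 0 y) * Im (directional y p y * cnj (w y)))"
proof -
  have "continuous_on {x. norm x > R} (\<lambda>y. Im (directional y p y * cnj (w y)))"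
    by (intro continuous_intros continuous_on_radial_w)
  from integrable_cutoff1[OF _ this annulus_exterior[OF assms]] show ?thesis using assms R by simp
qed

text \<open>
  Conservation of energy: test the equation with \<open>cnj w\<close> times the difference of two radial cutoffs
  and take imaginary parts.
\<close>

lemma flux_constant:
  assumes ab: "R < a" "a \<le> b"
  shows "flux a = flux b"
proof -
  have pos: "a > 0" "b > 0" "b > R" using ab R by auto
  let ?\<eta> = "\<lambda>y. annular a b (dsq 0 y)" and ?D\<eta> = "radial_partial (annular1 a b) 0"
    and ?K = "annulus a (2 * b)"
  note \<eta> = C1_on_annular[OF pos(1,2)] and \<eta>0 = annular_dsq_eq_0[OF pos(1) ab(2)]
  have ext: "open {x::real^3. norm x > R}" by (intro open_Collect_less continuous_intros)
  note K = compact_annulus[of a "2 * b"] annulus_exterior[OF ab(1), of "2 * b"]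
  note test = C1_on_UNIV_mult_compact_support[OF ext C1_on_cnj[OF w_C1] \<eta> K \<eta>0]
  let ?form = "\<lambda>y. (\<Sum>i\<in>UNIV. p i y * (cnj (p i y) * ?\<eta> y + cnj (w y) * ?D\<eta> i y))
      - of_real (k^2) * w y * (cnj (w y) * ?\<eta> y)"
  have form_int: "integrable lborel ?form" by (rule weak_integrable[OF test K]) (simp_all add: \<eta>0)
  have "(LINT y|lborel. ?form y) = 0" by (rule weak[OF test K]) (simp_all add: \<eta>0)
  with integral_Im[OF form_int] have "(LINT y|lborel. Im (?form y)) = 0"
    by (simp only: zero_complex.sel)
  moreover have "Im (?form y) = 2 * (cutoff1 a (dsq 0 y) * Im (directional y p y * cnj (w y)))
      - 2 * (cutoff1 b (dsq 0 y) * Im (directional y p y * cnj (w y)))" for y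
  proof -
    have real: "Im (z * (cnj z * complex_of_real c)) = 0" for z c by (simp add: algebra_simps)
    have "?form y = ((\<Sum>i\<in>UNIV. p i y * (cnj (p i y) * ?\<eta> y))
        - of_real (k^2) * (w y * (cnj (w y) * ?\<eta> y)))
        + of_real (2 * (cutoff1 a (dsq 0 y) - cutoff1 b (dsq 0 y))) * (directional y p y * cnj (w y))"
      by (simp add: directional_def radial_partial_def annular1_def sum_3 algebra_simps)
    also have "Im \<dots> = 2 * (cutoff1 a (dsq 0 y)
        - cutoff1 b (dsq 0 y)) * Im (directional y p y * cnj (w y))"
      by (simp only: plus_complex.sel minus_complex.sel Im_sum annular_def real
        times_complex.sel(2)[of "of_real _"]
          Im_complex_of_real Re_complex_of_real) simp
    finally show ?thesis by (simp add: algebra_simps)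
  qed
  ultimately show ?thesis
    unfolding flux_def using flux_integrable[OF ab(1)] flux_integrable[OF pos(3)] by simp
qed

definition mean_square :: "real \<Rightarrow> real" where
  "mean_square \<rho> = (LINT y|lborel. cutoff1 \<rho> (dsq 0 y) * (norm y * (cmod (w y))^2))"

lemma mean_square_integrable:
  assumes "\<rho> > R"
  shows "integrable lborel (\<lambda>y. cutoff1 \<rho> (dsq 0 y) * (norm y * (cmod (w y))^2))"
proof -
  have "continuous_on {x. norm x > R} (\<lambda>y. norm y * (cmod (w y))^2)"
    by (intro continuous_intros continuous_on_radial_w)
  from integrable_cutoff1[OF _ this annulus_exterior[OF assms]] show ?thesis using assms R by simp
qed

lemma norm_square_le_flux_density:
  assumes "cmod (r - \<i> * of_real (k * s) * z) \<le> 1" "s > 0"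
  shows "k^2 * (s * (cmod z)^2) \<le> 1 / s + 2 * k * Im (r * cnj z)"
proof -
  have "(cmod (r - \<i> * of_real (k * s) * z))^2 = (cmod r)^2 + (k * s)^2 * (cmod z)^2
      - 2 * (k * s) * Im (r * cnj z)"
    unfolding cmod_power2 by (simp add: power2_eq_square algebra_simps)
  moreover have "(cmod (r - \<i> * of_real (k * s) * z))^2 \<le> 1" using assms(1) by (simp add: power_le_one)
  ultimately have "(k * s)^2 * (cmod z)^2 \<le> 1 + 2 * (k * s) * Im (r * cnj z)"
    using zero_le_power2[of "cmod r"] by linarith
  then have "s * (k^2 * (s * (cmod z)^2)) \<le> s * (1 / s + 2 * k * Im (r * cnj z))"
    using assms(2) by (simp add: power_mult_distrib power2_eq_square algebra_simps)
  then show ?thesis using assms(2) by (subst (asm) mult_le_cancel_left_pos)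
qed

lemma mean_square_bounded:
  obtains M where "\<forall>\<^sub>F \<rho> in at_top. mean_square \<rho> \<le> M"
proof -
  obtain \<rho>0 where \<rho>0: "\<And>x. norm x \<ge> \<rho>0 \<Longrightarrow> cmod (directional x p x - \<i> * of_real (k * norm x) * w x) \<le> 1"
    using eventually_radiation_le[of 1] by (auto simp: eventually_at_infinity)
  define a where "a = max \<rho>0 (R + 1)"
  have a: "a \<ge> \<rho>0" "a > R" "a > 0" using R by (auto simp: a_def)
  have "mean_square \<rho> \<le> (1120 * unit_ball_vol 3 + 2 * k * flux a) / k^2" if "\<rho> \<ge> a" for \<rho>
  proof -
    have \<rho>: "\<rho> > 0" "\<rho> > R" using that a by auto
    let ?c = "\<lambda>y::real^3. cutoff1 \<rho> (dsq 0 y)"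
    have "k^2 * (?c y * (norm y * (cmod (w y))^2)) \<le> ?c y / norm y ^ 1
        + 2 * k * (?c y * Im (directional y p y * cnj (w y)))" for y
    proof (cases "y \<in> annulus \<rho> (2 * \<rho>)")
      case True
      then have "norm y \<ge> \<rho>0" "norm y > 0" using that a \<rho> by (auto simp: annulus_iff)
      from mult_left_mono[OF norm_square_le_flux_density[OF \<rho>0[OF this(1)] this(2)]
        cutoff1_nonneg[of \<rho> "dsq 0 y"]]
      show ?thesis by (simp add: algebra_simps)
    qed (simp add: cutoff1_eq_0_outside_annulus[OF \<rho>(1)])
    then have "(LINT y|lborel. k^2 * (?c y * (norm y * (cmod (w y))^2)))
        \<le> (LINT y|lborel. ?c y / norm y ^ 1 + 2 * k * (?c y * Im (directional y p y * cnj (w y))))"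
      using mean_square_integrable[OF \<rho>(2)] integrable_cutoff1_moment[OF \<rho>(1), of 1]
        flux_integrable[OF \<rho>(2)]
      by (intro integral_mono Bochner_Integration.integrable_add integrable_mult_right)
    also have "\<dots> = (LINT y|lborel. ?c y / norm y ^ 1) + 2 * k * flux \<rho>"
      unfolding flux_def using integrable_cutoff1_moment[OF \<rho>(1), of 1] flux_integrable[OF \<rho>(2)]
      by (subst Bochner_Integration.integral_add) auto
    also have "\<dots> \<le> 1120 * unit_ball_vol 3 + 2 * k * flux a"
      using integral_cutoff1_moment_le[OF \<rho>(1), of 1] flux_constant[OF a(2) that] \<rho> by simp
    finally show ?thesis using k by (simp add: mean_square_def pos_le_divide_eq mult.commute)
  qed
  then have "\<forall>\<^sub>F \<rho> in at_top. mean_square \<rho> \<le> (1120 * unit_ball_vol 3 + 2 * k * flux a) / k^2"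
    unfolding eventually_at_top_linorder by blast
  then show ?thesis by (rule that)
qed

end

section \<open>Representation of radiating solutions\<close>

lemma norm_fund_le:
  assumes "y \<noteq> 0" "norm y \<ge> 2 * norm c"
  shows "cmod (fund k (dsq c y)) \<le> 2 / norm y"
proof -
  have "norm (y - c) \<ge> norm y / 2" using norm_triangle_ineq2[of y c] assms(2) by simp
  then have "1 / norm (y - c) \<le> 1 / (norm y / 2)" using assms(1)
    by (intro divide_left_mono mult_pos_pos) auto
  then show ?thesis by (simp add: norm_fund)
qed

definition fund_radial :: "real \<Rightarrow> real^3 \<Rightarrow> real^3 \<Rightarrow> complex" where
  "fund_radial k c y = of_real (2 * (y \<bullet> (y - c))) * fund1 k (dsq c y)"

lemma fund_radial_eq:
  assumes "y \<noteq> c"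
  shows "fund_radial k c y = of_real (y \<bullet> (y - c)) * (\<i> * k * of_real (norm (y - c))
      - 1) / of_real (dsq c y) * fund k (dsq c y)"
proof -
  have "dsq c y > 0" using assms by (simp add: dsq_def)
  from fund1_eq[OF this] show ?thesis by (simp add: fund_radial_def sqrt_dsq)
qed

lemma norm_fund_radial_defect_le:
  assumes "k > 0" "y \<noteq> 0" "norm y \<ge> 2 * norm c"
  shows "cmod (fund_radial k c y - \<i> * of_real (k * norm y) * fund k (dsq c y))
      \<le> (4 * k * norm c + 4) / norm y"
proof -
  define q where "q = norm (y - c)"
  define d where "d = y \<bullet> (y - c)"
  have q: "q \<ge> norm y / 2" using norm_triangle_ineq2[of y c] assms(3) by (simp add: q_def)
  then have q0: "q > 0" using assms(2) by (meson less_le_trans half_gt_zero zero_less_norm_iff)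
  then have yc: "y \<noteq> c" by (auto simp: q_def)
  have "d = q^2 + c \<bullet> (y - c)" unfolding d_def q_def power2_norm_eq_inner by (simp add: inner_diff_left)
  then have dq: "d / q = q + (c \<bullet> (y - c)) / q" using q0 by (simp add: field_simps power2_eq_square)
  have "\<bar>(c \<bullet> (y - c)) / q\<bar> \<le> norm c"
    using Cauchy_Schwarz_ineq2[of c "y - c"] q0 by (simp add: q_def pos_divide_le_eq)
  moreover have "\<bar>q - norm y\<bar> \<le> norm c" using norm_triangle_ineq3[of "y - c" y] by (simp add: q_def)
  ultimately have phase: "\<bar>d / q - norm y\<bar> \<le> 2 * norm c" unfolding dq by linarith
  have "\<bar>d\<bar> \<le> norm y * q" unfolding d_def q_def by (rule Cauchy_Schwarz_ineq2)
  also have "\<dots> \<le> (2 * q) * q" using q q0 by (intro mult_right_mono) auto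
  finally have amplitude: "\<bar>d / q^2\<bar> \<le> 2" using q0 by (simp add: pos_divide_le_eq power2_eq_square)
  have "fund_radial k c y - \<i> * of_real (k * norm y) * fund k (dsq c y)
     = fund k (dsq c y) * (\<i> * of_real (k * (d / q - norm y)) - of_real (d / q^2))"
    unfolding fund_radial_eq[OF yc] d_def[symmetric] q_def[symmetric] using q0
    by (simp add: dsq_def q_def[symmetric] field_simps power2_eq_square)
  also have "cmod \<dots> \<le> 2 / norm y * (2 * k * norm c + 2)"
    unfolding norm_mult[of "fund k _"]
  proof (rule mult_mono[OF norm_fund_le[OF assms(2,3)]])
    have "cmod (\<i> * of_real (k * (d / q - norm y)) - of_real (d / q^2))
        \<le> k * \<bar>d / q - norm y\<bar> + \<bar>d / q^2\<bar>"
      using norm_triangle_ineq4[of "\<i> * of_real (k * (d / q - norm y))" "of_real (d / q^2)"] assms(1)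
      by (simp add: norm_mult abs_mult del: of_real_mult of_real_diff of_real_divide)
    also have "\<dots> \<le> k * (2 * norm c) + 2" using phase amplitude assms(1)
      by (intro add_mono mult_left_mono) auto
    finally show "cmod (\<i> * of_real (k * (d / q - norm y)) - of_real (d / q^2)) \<le> 2 * k * norm c + 2"
      by simp
  qed auto
  finally show ?thesis by (simp add: algebra_simps add_divide_distrib)
qed

context radiating
begin

definition shell :: "real \<Rightarrow> real^3 \<Rightarrow> real^3 \<Rightarrow> complex" where
  "shell \<rho> x y = cutoff1 \<rho> (dsq 0 y) *\<^sub>R (2 * (fund k (dsq x y) * directional y p y
      - w y * fund_radial k x y))"

lemma shell_integrable:
  assumes \<rho>: "\<rho> > R" and x: "x \<notin> annulus \<rho> (2 * \<rho>)"
  shows "integrable lborel (shell \<rho> x)"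
proof -
  let ?S = "{y. norm y > R} - {x}"
  have "continuous_on ?S (\<lambda>y. fund k (dsq x y))" "continuous_on ?S (\<lambda>y. fund1 k (dsq x y))"
    by (intro continuous_on_compose2[OF continuous_on_fund(2)]
      continuous_on_compose2[OF continuous_on_fund(3)]
        continuous_intros; force simp: dsq_def)+
  moreover have "continuous_on ?S w" "continuous_on ?S (\<lambda>x. directional x p x)"
    using continuous_on_radial_w by (auto intro: continuous_on_subset)
  ultimately have "continuous_on ?S (\<lambda>y. 2 * (fund k (dsq x y) * directional y p y
      - w y * fund_radial k x y))"
    unfolding fund_radial_def by (intro continuous_intros)
  then show ?thesis
    unfolding shell_def[abs_def] by (rule integrable_cutoff1[rotated])
      (use assms R annulus_exterior in auto)
qed

lemma norm_shell_le:
  assumes e: "cmod (directional y p y - \<i> * of_real (k * norm y) * w y) \<le> e"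
    and y: "norm y \<ge> 2 * norm x" "norm y > 0" and \<rho>: "\<rho> > 0"
  shows "cmod (shell \<rho> x y) \<le> 4 * e * (cutoff1 \<rho> (dsq 0 y) / norm y ^ 1)
    + (4 * k * norm x + 4) / \<rho> * (cutoff1 \<rho> (dsq 0 y) * (norm y * (cmod (w y))^2))
    + (4 * k * norm x + 4) * \<rho> * (cutoff1 \<rho> (dsq 0 y) / norm y ^ 3)"
proof -
  define C where "C = 4 * k * norm x + 4"
  have C: "C \<ge> 0" using k by (simp add: C_def)
  let ?P = "fund k (dsq x y)" and ?d = "\<lambda>r z. r - \<i> * of_real (k * norm y) * z"
  have y0: "y \<noteq> 0" using y(2) by auto
  have "?P * directional y p y - w y * fund_radial k x y = ?P * ?d (directional y p y) (w y)
      - w y * ?d (fund_radial k x y) ?P"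
    by (simp add: algebra_simps)
  also have "cmod \<dots> \<le> cmod ?P * cmod (?d (directional y p y) (w y))
      + cmod (w y) * cmod (?d (fund_radial k x y) ?P)"
    unfolding norm_mult[symmetric] by (rule norm_triangle_ineq4)
  also have "\<dots> \<le> 2 / norm y * e + cmod (w y) * (C / norm y)"
    unfolding C_def using norm_fund_le[OF y0 y(1)] norm_fund_radial_defect_le[OF k y0 y(1)] e
    by (intro add_mono mult_mono mult_left_mono) auto
  finally have "2 * cmod (?P * directional y p y - w y * fund_radial k x y)
      \<le> 2 * (2 / norm y * e + cmod (w y) * (C / norm y))"
    by simp
  also have "\<dots> = 4 * e / norm y + C * (2 * (cmod (w y) / norm y))" by (simp add: algebra_simps)
  also have "2 * (cmod (w y) / norm y) \<le> norm y * (cmod (w y))^2 / \<rho> + \<rho> / norm y ^ 3"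
  proof -
    have "0 \<le> (cmod (w y) * norm y / \<rho> - 1 / norm y)^2 * (\<rho> / norm y)" using \<rho> y by simp
    also have "\<dots> = norm y * (cmod (w y))^2 / \<rho> + \<rho> / norm y ^ 3 - 2 * (cmod (w y) / norm y)"
      using \<rho> y by (simp add: power2_eq_square power3_eq_cube field_simps)
    finally show ?thesis by simp
  qed
  finally have "2 * cmod (?P * directional y p y - w y * fund_radial k x y)
      \<le> 4 * e / norm y + C * (norm y * (cmod (w y))^2 / \<rho> + \<rho> / norm y ^ 3)"
    using C by (simp add: mult_left_mono)
  from mult_left_mono[OF this cutoff1_nonneg[of \<rho> "dsq 0 y"]]
  moreover have "cmod (shell \<rho> x y) = cutoff1 \<rho> (dsq 0 y) * (2 * cmod (?P * directional y p y
      - w y * fund_radial k x y))"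
    unfolding shell_def norm_scaleR norm_mult[of 2] by (simp add: cutoff1_nonneg)
  ultimately show ?thesis unfolding C_def[symmetric] by (simp add: algebra_simps)
qed

lemma norm_integral_shell_le:
  assumes e: "\<And>y. norm y \<ge> \<rho> \<Longrightarrow> cmod (directional y p y - \<i> * of_real (k * norm y) * w y) \<le> e"
    and \<rho>: "\<rho> > R" "\<rho> \<ge> 2 * norm x"
  shows "cmod (LINT y|lborel. shell \<rho> x y)
    \<le> 4480 * unit_ball_vol 3 * e + (4 * k * norm x + 4) * (mean_square \<rho> + 1120 * unit_ball_vol 3) / \<rho>"
proof -
  define C where "C = 4 * k * norm x + 4"
  have C: "C \<ge> 0" using k by (simp add: C_def)
  have \<rho>0: "\<rho> > 0" using \<rho> R by simp
  have "e \<ge> 0" using order_trans[OF norm_ge_zero e[of "\<rho> *\<^sub>R axis 1 1"]] \<rho>0 by simp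
  let ?c = "\<lambda>y::real^3. cutoff1 \<rho> (dsq 0 y)"
  let ?g = "\<lambda>y. 4 * e * (?c y / norm y ^ 1) + C / \<rho> * (?c y * (norm y * (cmod (w y))^2))
      + C * \<rho> * (?c y / norm y ^ 3)"
  note g_int = integrable_cutoff1_moment[OF \<rho>0] mean_square_integrable[OF \<rho>(1)]
  have "cmod (LINT y|lborel. shell \<rho> x y) \<le> (LINT y|lborel. ?g y)"
  proof (rule order_trans[OF integral_norm_bound integral_mono'])
    show "integrable lborel ?g" using g_int by (intro Bochner_Integration.integrable_add
      integrable_mult_right)
    show "cmod (shell \<rho> x y) \<le> ?g y" for y
    proof (cases "y \<in> annulus \<rho> (2 * \<rho>)")
      case True
      then show ?thesis unfolding C_def using \<rho> \<rho>0 by (intro norm_shell_le e) (auto simp: annulus_iff)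
    qed (simp add: shell_def cutoff1_eq_0_outside_annulus[OF \<rho>0])
    show "0 \<le> ?g y" for y
      using \<open>e \<ge> 0\<close> C \<rho>0 cutoff1_nonneg[of \<rho> "dsq 0 y"]
      by (intro add_nonneg_nonneg mult_nonneg_nonneg) auto
  qed
  also have "\<dots> = 4 * e * (LINT y|lborel. ?c y / norm y ^ 1) + C / \<rho> * mean_square \<rho>
      + C * \<rho> * (LINT y|lborel. ?c y / norm y ^ 3)"
    unfolding mean_square_def using g_int(1)[of 1] g_int(1)[of 3] g_int(2)
    by (simp only: Bochner_Integration.integral_add Bochner_Integration.integrable_add
      integrable_mult_right integral_mult_right_zero)
  also have "\<dots> \<le> 4 * e * (1120 * unit_ball_vol 3 * \<rho> / \<rho> ^ 1) + C / \<rho> * mean_square \<rho>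
      + C * \<rho> * (1120 * unit_ball_vol 3 * \<rho> / \<rho> ^ 3)"
    using \<open>e \<ge> 0\<close> C \<rho>0 by (intro add_mono mult_left_mono order_refl integral_cutoff1_moment_le) auto
  also have "\<dots> = 4480 * unit_ball_vol 3 * e + C * (mean_square \<rho> + 1120 * unit_ball_vol 3) / \<rho>"
    using \<rho>0 by (simp add: field_simps power3_eq_cube)
  finally show ?thesis by (simp only: C_def)
qed

lemma integral_shell_tendsto_0: "((\<lambda>\<rho>. LINT y|lborel. shell \<rho> x y) \<longlongrightarrow> 0) at_top"
proof (rule tendstoI)
  fix \<epsilon> :: real assume "\<epsilon> > 0"
  define e where "e = \<epsilon> / (2 * 4480 * unit_ball_vol 3)"
  have V: "unit_ball_vol 3 > 0" by simp
  then have e: "e > 0" using \<open>\<epsilon> > 0\<close> by (simp add: e_def)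
  obtain M where M: "\<forall>\<^sub>F \<rho> in at_top. mean_square \<rho> \<le> M" using mean_square_bounded by blast
  obtain \<rho>0 where \<rho>0: "\<And>y. norm y \<ge> \<rho>0 \<Longrightarrow> cmod (directional y p y - \<i> * of_real (k * norm y) * w y) \<le> e"
    using eventually_radiation_le[OF e] by (auto simp: eventually_at_infinity)
  define C where "C = (4 * k * norm x + 4) * (M + 1120 * unit_ball_vol 3)"
  have "((\<lambda>\<rho>. C / \<rho>) \<longlongrightarrow> 0) at_top" by (intro tendsto_divide_0[OF tendsto_const]
    filterlim_at_top_imp_at_infinity filterlim_ident)
  then have "\<forall>\<^sub>F \<rho> in at_top. C / \<rho> < \<epsilon> / 2" using \<open>\<epsilon> > 0\<close> by (intro order_tendstoD) auto
  then show "\<forall>\<^sub>F \<rho> in at_top. dist (LINT y|lborel. shell \<rho> x y) 0 < \<epsilon>"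
    using M eventually_ge_at_top[of \<rho>0] eventually_gt_at_top[of R] eventually_ge_at_top[of "2 * norm x"]
  proof eventually_elim
    case (elim \<rho>)
    have "\<rho> > 0" using elim R by simp
    have "cmod (LINT y|lborel. shell \<rho> x y)
        \<le> 4480 * unit_ball_vol 3 * e + (4 * k * norm x + 4) * (mean_square \<rho>
          + 1120 * unit_ball_vol 3) / \<rho>"
      using elim by (intro norm_integral_shell_le \<rho>0) auto
    also have "\<dots> \<le> 4480 * unit_ball_vol 3 * e + C / \<rho>"
      unfolding C_def using elim \<open>\<rho> > 0\<close> k by (intro add_left_mono divide_right_mono mult_left_mono)
        auto
    also have "4480 * unit_ball_vol 3 * e = \<epsilon> / 2" using less_imp_neq[OF V] by (simp add: e_def)
    finally show ?case unfolding dist_norm diff_zero using elim(1) by linarith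
  qed
qed

lemma representation_between_shells:
  assumes a: "R < a" and x: "norm x > 2 * a" and \<rho>: "\<rho> > norm x"
  shows "of_real source_mass * w x = (LINT y|lborel. shell a x y) - (LINT y|lborel. shell \<rho> x y)"
proof -
  have pos: "a > 0" "\<rho> > 0" "\<rho> > R" using a x \<rho> R by auto
  define r where "r = min (norm x - 2 * a) (\<rho> - norm x)"
  have r: "r > 0" using x \<rho> by (simp add: r_def)
  let ?\<eta> = "\<lambda>y. annular a \<rho> (dsq 0 y)" and ?D\<eta> = "radial_partial (annular1 a \<rho>) 0"
    and ?K = "annulus a (2 * \<rho>)"
  have "a \<le> \<rho>" using x \<rho> pos by simp
  have near: "2 * a < norm y" "norm y < \<rho>" if "y \<in> ball x r" for y
    using that norm_triangle_ineq2[of x y] norm_triangle_ineq2[of y x]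
    by (auto simp: r_def dist_norm norm_minus_commute)
  have "of_real source_mass * w x = (LINT y|lborel. (\<Sum>i\<in>UNIV.
      (fund k (dsq x y) * p i y - w y * radial_partial (fund1 k) x i y) * ?D\<eta> i y))"
  proof (rule green_representation[OF r _ C1_on_annular[OF pos(1,2)] _ compact_annulus
    annulus_exterior[OF a]])
    show "continuous_on (ball x r) w"
      by (rule continuous_on_subset[OF continuous_on_radial_w(1)]) (use near pos a in force)
    show "?\<eta> y = 1" if "y \<in> ball x r" for y
      using near[OF that] pos by (intro annular_dsq_eq_1) auto
    show "?\<eta> y = 0" if "y \<notin> ?K" for y
      by (rule annular_dsq_eq_0[OF pos(1) \<open>a \<le> \<rho>\<close> that])
  qed
  also have "\<dots> = (LINT y|lborel. shell a x y - shell \<rho> x y)"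
  proof (rule Bochner_Integration.integral_cong[OF refl])
    fix y
    have "(\<Sum>i\<in>UNIV. (fund k (dsq x y) * p i y - w y * radial_partial (fund1 k) x i y) * ?D\<eta> i y)
        = 2 * annular1 a \<rho> (dsq 0 y) * (fund k (dsq x y) * directional y p y
          - w y * directional y (radial_partial (fund1 k) x) y)"
      by (simp add: directional_def radial_partial_def[of "annular1 a \<rho>"] sum_3 algebra_simps)
    then show "(\<Sum>i\<in>UNIV. (fund k (dsq x y) * p i y - w y * radial_partial (fund1 k) x i y) * ?D\<eta> i y)
        = shell a x y - shell \<rho> x y"
      unfolding directional_radial_partial fund_radial_def[symmetric]
      by (simp add: shell_def annular1_def scaleR_conv_of_real algebra_simps)
  qed
  also have "\<dots> = (LINT y|lborel. shell a x y) - (LINT y|lborel. shell \<rho> x y)"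
    by (intro Bochner_Integration.integral_diff shell_integrable a pos)
      (use x \<rho> in \<open>auto simp: annulus_iff\<close>)
  finally show ?thesis .
qed

lemma exterior_representation:
  assumes "R < a" "norm x > 2 * a"
  shows "of_real source_mass * w x = (LINT y|lborel. shell a x y)"
proof -
  have "\<forall>\<^sub>F \<rho> in at_top. (LINT y|lborel. shell a x y) - (LINT y|lborel. shell \<rho> x y)
      = of_real source_mass * w x"
    using eventually_gt_at_top[of "norm x"] by eventually_elim
      (simp add: representation_between_shells[OF assms])
  from tendsto_unique[OF trivial_limit_at_top_linorder tendsto_eventually[OF this]
      tendsto_diff[OF tendsto_const integral_shell_tendsto_0]]
  show ?thesis by simp
qed

end

section \<open>The expansion at infinity\<close>

text \<open>For complex \<open>z\<close>, \<open>cdsq a b z\<close> continues \<open>(norm (a - z *\<^sub>R b))\<^sup>2\<close> from real \<open>z\<close>.\<close>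

definition cdsq :: "'a::real_inner \<Rightarrow> 'a \<Rightarrow> complex \<Rightarrow> complex" where
  "cdsq a b z = of_real (a \<bullet> a) - 2 * z * of_real (a \<bullet> b) + z^2 * of_real (b \<bullet> b)"

lemma cdsq_of_real: "cdsq a b (of_real t) = of_real ((norm (a - t *\<^sub>R b))^2)"
  unfolding cdsq_def power2_norm_eq_inner
  by (simp add: inner_diff_left inner_diff_right inner_commute power2_eq_square algebra_simps)

lemma Re_cdsq_pos:
  assumes "a \<noteq> 0" "4 * (cmod z * norm b) \<le> norm a"
  shows "Re (cdsq a b z) > 0"
proof -
  define q where "q = cmod z * norm b"
  have q: "0 \<le> q" "q \<le> norm a / 4" using assms(2) by (auto simp: q_def)
  have "cmod (2 * z * of_real (a \<bullet> b) - z^2 * of_real (b \<bullet> b)) \<le> 2 * cmod z * \<bar>a \<bullet> b\<bar>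
      + (cmod z)^2 * (b \<bullet> b)"
    using norm_triangle_ineq4[of "2 * z * of_real (a \<bullet> b)" "z^2 * of_real (b \<bullet> b)"]
    by (simp add: norm_mult norm_power)
  also have "\<dots> \<le> 2 * cmod z * (norm a * norm b) + (cmod z)^2 * (norm b)^2"
    using Cauchy_Schwarz_ineq2[of a b] by (intro add_mono mult_left_mono)
      (auto simp: power2_norm_eq_inner)
  also have "\<dots> = 2 * norm a * q + q^2" by (simp add: q_def power_mult_distrib)
  also have "\<dots> \<le> 2 * norm a * (norm a / 4) + (norm a / 4)^2"
    using q by (intro add_mono mult_left_mono power_mono) auto
  also have "\<dots> < a \<bullet> a" using assms(1) by (simp add: power2_norm_eq_inner[symmetric] power2_eq_square)
  finally have "\<bar>Re (2 * z * of_real (a \<bullet> b) - z^2 * of_real (b \<bullet> b))\<bar> < a \<bullet> a"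
    using order_le_less_trans[OF abs_Re_le_cmod] by blast
  then show ?thesis by (simp add: cdsq_def)
qed

lemma continuous_on_cdsq [continuous_intros]:
  "continuous_on S f \<Longrightarrow> continuous_on S g \<Longrightarrow> continuous_on S h \<Longrightarrow>
      continuous_on S (\<lambda>x. cdsq (f x) (g x) (h x))"
  unfolding cdsq_def by (intro continuous_intros)

lemma holomorphic_on_cdsq [holomorphic_intros]: "cdsq a b holomorphic_on S"
  unfolding cdsq_def[abs_def] by (intro holomorphic_intros)

lemma csqrt_Re_pos:
  assumes "Re q > 0"
  shows "q \<notin> \<real>\<^sub>\<le>\<^sub>0" "q \<noteq> 0" "csqrt q \<noteq> 0" "csqrt q + 1 \<noteq> 0"
proof -
  show "q \<notin> \<real>\<^sub>\<le>\<^sub>0" using assms by (auto simp: complex_nonpos_Reals_iff)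
  show "q \<noteq> 0" using assms by auto
  then show "csqrt q \<noteq> 0" by simp
  have "Re (csqrt q) \<ge> 0" using csqrt_principal[of q] by auto
  then have "Re (csqrt q + 1) \<noteq> 0" unfolding plus_complex.sel one_complex.sel by linarith
  then show "csqrt q + 1 \<noteq> 0" by force
qed

lemma continuous_on_csqrt_Re_pos:
  assumes "continuous_on S f" "\<And>x. x \<in> S \<Longrightarrow> Re (f x) > 0"
  shows "continuous_on S (\<lambda>x. csqrt (f x))"
  by (rule continuous_on_compose2[of "- \<real>\<^sub>\<le>\<^sub>0" csqrt, OF _ assms(1)])
    (use csqrt_Re_pos(1)[OF assms(2)] in \<open>auto intro: continuous_on_csqrt\<close>)

text \<open>
  For a source at \<open>\<theta> / z\<close> the fundamental solution and its radial derivative, multiplied by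
  \<open>exp (- \<i> k / z) / z\<close>, extend holomorphically to \<open>z = 0\<close>; the phase is \<open>(csqrt q - 1) / z\<close> with
  the numerator rationalised.
\<close>

definition far_fund :: "real \<Rightarrow> real^3 \<Rightarrow> real^3 \<Rightarrow> complex \<Rightarrow> complex" where
  "far_fund k \<theta> y z = exp (\<i> * k * (z * of_real (y \<bullet> y)
      - 2 * of_real (\<theta> \<bullet> y)) / (csqrt (cdsq \<theta> y z) + 1))
     / csqrt (cdsq \<theta> y z)"

definition far_fund_radial :: "real \<Rightarrow> real^3 \<Rightarrow> real^3 \<Rightarrow> complex \<Rightarrow> complex" where
  "far_fund_radial k \<theta> y z = far_fund k \<theta> y z * (\<i> * k * csqrt (cdsq \<theta> y z) - z)
     * (z * of_real (y \<bullet> y) - of_real (\<theta> \<bullet> y)) / cdsq \<theta> y z"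

lemma far_fund_holomorphic:
  assumes "\<And>z. z \<in> S \<Longrightarrow> Re (cdsq \<theta> y z) > 0"
  shows "far_fund k \<theta> y holomorphic_on S" "far_fund_radial k \<theta> y holomorphic_on S"
proof -
  note q = csqrt_Re_pos[OF assms]
  show *: "far_fund k \<theta> y holomorphic_on S"
    unfolding far_fund_def[abs_def] using q by (intro holomorphic_intros) auto
  show "far_fund_radial k \<theta> y holomorphic_on S"
    unfolding far_fund_radial_def[abs_def] using q by (intro holomorphic_intros *) auto
qed

lemma continuous_on_far_fund:
  assumes "continuous_on S f" "continuous_on S g" "continuous_on S h"
    "\<And>x. x \<in> S \<Longrightarrow> Re (cdsq (f x) (g x) (h x)) > 0"
  shows "continuous_on S (\<lambda>x. far_fund k (f x) (g x) (h x))"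
    "continuous_on S (\<lambda>x. far_fund_radial k (f x) (g x) (h x))"
proof -
  note q = csqrt_Re_pos[OF assms(4)]
  show *: "continuous_on S (\<lambda>x. far_fund k (f x) (g x) (h x))"
    unfolding far_fund_def using q by (intro continuous_intros continuous_on_csqrt_Re_pos assms) auto
  show "continuous_on S (\<lambda>x. far_fund_radial k (f x) (g x) (h x))"
    unfolding far_fund_radial_def using q by (intro continuous_intros
      continuous_on_csqrt_Re_pos * assms) auto
qed

lemma far_fund_of_real:
  fixes k :: real
  assumes \<theta>: "norm \<theta> = 1" and t: "t > 0" "t *\<^sub>R y \<noteq> \<theta>"
  defines "e \<equiv> complex_of_real (1 / t) * exp (- \<i> * of_real (k / t))" and "x \<equiv> (1 / t) *\<^sub>R \<theta>"
  shows "far_fund k \<theta> y (of_real t) = e * fund k (dsq x y)"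
    "far_fund_radial k \<theta> y (of_real t) = e * fund_radial k x y"
proof -
  define q where "q = norm (\<theta> - t *\<^sub>R y)"
  have q: "q > 0" using t(2) by (auto simp: q_def)
  have csqrt: "csqrt (cdsq \<theta> y (of_real t)) = of_real q" unfolding cdsq_of_real q_def
    by (subst csqrt_of_real) auto
  have "y - x = (- 1 / t) *\<^sub>R (\<theta> - t *\<^sub>R y)" using t(1) by (simp add: x_def scaleR_diff_right)
  then have dist: "norm (y - x) = q / t" using t(1) by (simp add: q_def)
  have q2: "q^2 = 1 - 2 * t * (\<theta> \<bullet> y) + t^2 * (y \<bullet> y)"
    unfolding q_def power2_norm_eq_inner using norm_eq_1[of \<theta>] \<theta>
    by (simp add: inner_diff_left inner_diff_right inner_commute power2_eq_square algebra_simps)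
  have "(q - 1) / t = (t * (y \<bullet> y) - 2 * (\<theta> \<bullet> y)) / (q + 1)"
    using q2 q t(1) by (simp add: field_simps power2_eq_square)
  then have "k * (t * (y \<bullet> y) - 2 * (\<theta> \<bullet> y)) / (q + 1) = k * (q / t) - k / t"
    by (metis diff_divide_distrib mult.right_neutral right_diff_distrib times_divide_eq_right)
  then have real_phase: "complex_of_real (k * (t * (y \<bullet> y) - 2 * (\<theta> \<bullet> y)) / (q + 1))
      = of_real (k * (q / t) - k / t)"
    by (rule arg_cong)
  have "\<i> * k * (of_real t * of_real (y \<bullet> y) - 2 * of_real (\<theta> \<bullet> y)) / (of_real q + 1)
      = \<i> * complex_of_real (k * (t * (y \<bullet> y) - 2 * (\<theta> \<bullet> y)) / (q + 1))"
    by simp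
  then have phase: "\<i> * k * (of_real t * of_real (y \<bullet> y) - 2 * of_real (\<theta> \<bullet> y)) / (of_real q + 1)
      = - \<i> * of_real (k / t) + \<i> * k * of_real (q / t)"
    unfolding real_phase by (simp add: algebra_simps)
  show far_fund: "far_fund k \<theta> y (of_real t) = e * fund k (dsq x y)"
    unfolding far_fund_def csqrt phase exp_add fund_def phase_def sqrt_dsq dist e_def using t(1) by simp
  have "y \<noteq> x" using dist q t(1) by auto
  moreover have inner: "y \<bullet> (y - x) = (t * (y \<bullet> y) - \<theta> \<bullet> y) / t"
    using t(1) by (simp add: x_def inner_diff_right inner_commute field_simps)
  ultimately have fund_radial: "fund_radial k x y
      = of_real ((t * (y \<bullet> y) - \<theta> \<bullet> y) / t) * (\<i> * k * of_real (q / t)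
        - 1) / of_real ((q / t)^2) * fund k (dsq x y)"
    by (simp only: fund_radial_eq inner dist dsq_def not_False_eq_True)
  show "far_fund_radial k \<theta> y (of_real t) = e * fund_radial k x y"
    unfolding far_fund_radial_def csqrt far_fund cdsq_of_real q_def[symmetric] fund_radial using q t(1)
    by (simp add: field_simps power2_eq_square)
qed

context radiating
begin

definition far_radius :: real where
  "far_radius = 1 / (16 * R)"

definition far_density :: "real^3 \<Rightarrow> complex \<Rightarrow> real^3 \<Rightarrow> complex" where
  "far_density \<theta> z y = 2 * of_real (cutoff1 (2 * R) (dsq 0 y))
     * (far_fund k \<theta> y z * directional y p y - w y * far_fund_radial k \<theta> y z)"

definition far_ext :: "real^3 \<Rightarrow> complex \<Rightarrow> complex" where
  "far_ext \<theta> z = (LINT y:annulus (2 * R) (4 * R)|lborel. far_density \<theta> z y) / of_real source_mass"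

lemma far_radius_pos: "far_radius > 0"
  using R by (simp add: far_radius_def)

lemma Re_cdsq_far:
  assumes "norm \<theta> = 1" "cmod z \<le> far_radius" "y \<in> annulus (2 * R) (4 * R)"
  shows "Re (cdsq \<theta> y z) > 0"
proof (rule Re_cdsq_pos)
  show "\<theta> \<noteq> 0" using assms(1) by auto
  have "cmod z * norm y \<le> far_radius * (4 * R)"
    using assms far_radius_pos by (intro mult_mono) (auto simp: annulus_iff)
  then show "4 * (cmod z * norm y) \<le> norm \<theta>" using assms(1) R by (simp add: far_radius_def)
qed

lemma continuous_on_far_density:
  assumes cont: "continuous_on S f" "continuous_on S g" "continuous_on S h"
    and range: "\<And>x. x \<in> S \<Longrightarrow> norm (f x) = 1" "\<And>x. x \<in> S \<Longrightarrow> cmod (g x) \<le> far_radius"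
      "\<And>x. x \<in> S \<Longrightarrow> h x \<in> annulus (2 * R) (4 * R)"
  shows "continuous_on S (\<lambda>x. far_density (f x) (g x) (h x))"
proof -
  have "annulus (2 * R) (4 * R) \<subseteq> {x. norm x > R}" using R by (intro annulus_exterior) simp
  then have ext: "h ` S \<subseteq> {x. norm x > R}" using range(3) by blast
  have "Re (cdsq (f x) (h x) (g x)) > 0" if "x \<in> S" for x
    using that range by (intro Re_cdsq_far) auto
  then show ?thesis
    unfolding far_density_def using R
    by (intro continuous_intros continuous_on_far_fund cont
      continuous_on_compose2[OF continuous_on_radial_w(1) _ ext]
        continuous_on_compose2[OF continuous_on_radial_w(2) _ ext]) auto
qed

lemma far_ext_holomorphic:
  assumes "norm \<theta> = 1"
  shows "far_ext \<theta> holomorphic_on ball 0 far_radius"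
proof -
  have "(\<lambda>z. LINT y:annulus (2 * R) (4 * R)|lborel. far_density \<theta> z y) holomorphic_on ball 0 far_radius"
  proof (rule holomorphic_on_integral_kernel[OF open_ball compact_annulus])
    show "continuous_on (ball 0 far_radius \<times> annulus (2 * R) (4 * R)) (\<lambda>(z, y). far_density \<theta> z y)"
      unfolding case_prod_unfold by (intro continuous_on_far_density continuous_intros)
        (use assms in auto)
    fix y assume "y \<in> annulus (2 * R) (4 * R)"
    then have "Re (cdsq \<theta> y z) > 0" if "z \<in> ball 0 far_radius" for z using assms that
      by (intro Re_cdsq_far) auto
    then show "(\<lambda>z. far_density \<theta> z y) holomorphic_on ball 0 far_radius"
      unfolding far_density_def by (intro holomorphic_intros far_fund_holomorphic)
  qed
  then show ?thesis unfolding far_ext_def[abs_def] using source_mass_neg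
    by (intro holomorphic_intros) auto
qed

lemma far_ext_bounded:
  obtains M where "\<And>\<theta> z. norm \<theta> = 1 \<Longrightarrow> z \<in> ball 0 far_radius \<Longrightarrow> cmod (far_ext \<theta> z) \<le> M"
proof -
  let ?K = "annulus (2 * R) (4 * R)"
  have "bounded ((\<lambda>(\<theta>, z, y). far_density \<theta> z y) ` (sphere 0 1 \<times> cball 0 far_radius \<times> ?K))"
    unfolding case_prod_unfold
    by (intro compact_imp_bounded compact_continuous_image compact_Times compact_sphere compact_cball
      compact_annulus
        continuous_on_far_density continuous_intros) auto
  then obtain B where "\<forall>s\<in>sphere 0 1 \<times> cball 0 far_radius \<times> ?K. cmod
      (case s of (\<theta>, z, y) \<Rightarrow> far_density \<theta> z y) \<le> B"
    unfolding bounded_iff by auto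
  then have B: "cmod (far_density \<theta> z y) \<le> B" if "norm \<theta> = 1" "cmod z \<le> far_radius" "y \<in> ?K" for \<theta> z y
    using that by force
  have "cmod (far_ext \<theta> z) \<le> B * measure lborel ?K / \<bar>source_mass\<bar>" if "norm \<theta> = 1"
    "z \<in> ball 0 far_radius" for \<theta> z
    unfolding far_ext_def norm_divide norm_of_real using that
    by (intro divide_right_mono norm_set_integral_le compact_annulus B) auto
  then show ?thesis by (rule that)
qed

lemma far_ext_of_real:
  assumes \<theta>: "norm \<theta> = 1" and t: "0 < t" "t < far_radius"
  shows "far_ext \<theta> (of_real t) = of_real (1 / t) * exp (- \<i> * of_real (k / t)) * w ((1 / t) *\<^sub>R \<theta>)"
proof -
  define e where "e = complex_of_real (1 / t) * exp (- \<i> * of_real (k / t))"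
  let ?x = "(1 / t) *\<^sub>R \<theta>" and ?K = "annulus (2 * R) (4 * R)"
  have t_inv: "1 / t > 16 * R" using t R by (simp add: far_radius_def field_simps)
  have "indicator ?K y *\<^sub>R far_density \<theta> (of_real t) y = e * shell (2 * R) ?x y" for y
  proof (cases "y \<in> ?K")
    case True
    then have "norm y < 1 / t" using t_inv R by (auto simp: annulus_iff)
    then have "norm (t *\<^sub>R y) < 1" using t(1) by (simp add: pos_less_divide_eq mult.commute)
    then have "t *\<^sub>R y \<noteq> \<theta>" using \<theta> by auto
    from far_fund_of_real[OF \<theta> t(1) this, of k] True show ?thesis
      by (simp add: far_density_def shell_def e_def scaleR_conv_of_real algebra_simps)
  next
    case False
    then show ?thesis using cutoff1_eq_0_outside_annulus[of "2 * R" y] R by (simp add: shell_def)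
  qed
  then have "far_ext \<theta> (of_real t) * of_real source_mass = e * (LINT y|lborel. shell (2 * R) ?x y)"
    unfolding far_ext_def set_lebesgue_integral_def using source_mass_neg by simp
  also have "(LINT y|lborel. shell (2 * R) ?x y) = of_real source_mass * w ?x"
    by (rule exterior_representation[symmetric]) (use \<theta> t t_inv R in auto)
  finally have "of_real source_mass * far_ext \<theta> (of_real t) = of_real source_mass * (e * w ?x)"
    by (simp only: mult_ac)
  moreover have "complex_of_real source_mass \<noteq> 0" using source_mass_neg by simp
  ultimately show ?thesis unfolding e_def[symmetric] by (metis mult_left_cancel)
qed

end

section \<open>Rellich's lemma\<close>

lemma norm_taylor_remainder_le:
  assumes f: "f holomorphic_on ball 0 r" "\<And>z. z \<in> ball 0 r \<Longrightarrow> cmod (f z) \<le> M"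
    and z: "cmod z \<le> r / 4" "r > 0"
  shows "cmod (f z - (\<Sum>j<n. (deriv ^^ j) f 0 / fact j * z ^ j)) \<le> 2 * M * (2 * cmod z / r) ^ n"
proof -
  define a where "a j = (deriv ^^ j) f 0 / fact j" for j
  define q where "q = 2 * cmod z / r"
  have q: "0 \<le> q" "q \<le> 1/2" using z by (auto simp: q_def field_simps)
  have M: "M \<ge> 0" using order_trans[OF norm_ge_zero f(2)[of 0]] z(2) by simp
  have coeff: "cmod (a j) \<le> M / (r / 2) ^ j" for j
  proof -
    have "cmod ((deriv ^^ j) f 0) \<le> fact j * M / (r / 2) ^ j"
    proof (rule Cauchy_inequality)
      show "f holomorphic_on ball 0 (r / 2)" by (rule holomorphic_on_subset[OF f(1)]) (use z(2) in auto)
      show "continuous_on (cball 0 (r / 2)) f"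
        by (rule continuous_on_subset[OF holomorphic_on_imp_continuous_on[OF f(1)]]) (use z(2) in auto)
    qed (use f z(2) in auto)
    then have "cmod ((deriv ^^ j) f 0) / fact j \<le> fact j * M / (r / 2) ^ j / fact j"
      by (rule divide_right_mono) simp
    then show ?thesis by (simp add: a_def norm_divide)
  qed
  have "cmod (a j * z ^ j) \<le> M * q ^ j" for j
    unfolding norm_mult norm_power using mult_right_mono[OF coeff, of "cmod z ^ j"]
    by (simp add: q_def power_divide power_mult_distrib mult_ac)
  then have tail: "cmod (a (j + n) * z ^ (j + n)) \<le> M * q ^ n * q ^ j" for j
    by (metis mult.assoc mult.commute power_add)
  have "(\<lambda>j. a j * z ^ j) sums f z"
    using holomorphic_power_series[OF f(1), of z] z by (simp add: a_def)
  then have "(\<lambda>j. a (j + n) * z ^ (j + n)) sums (f z - (\<Sum>j<n. a j * z ^ j))"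
    by (rule sums_split_initial_segment)
  moreover have "(\<lambda>j. M * q ^ n * q ^ j) sums (M * q ^ n * (1 / (1 - q)))"
    using q by (intro sums_mult geometric_sums) auto
  ultimately have "cmod (f z - (\<Sum>j<n. a j * z ^ j)) \<le> M * q ^ n * (1 / (1 - q))"
    by (rule norm_sums_le[OF _ _ tail])
  also have "\<dots> \<le> M * q ^ n * 2" using q M by (intro mult_left_mono) (auto simp: field_simps)
  finally show ?thesis by (simp add: a_def q_def mult_ac)
qed

definition dilates :: "(real^3) set \<Rightarrow> (real^3) set" where
  "dilates K = (\<lambda>(s, x). s *\<^sub>R x) ` ({1/2..2::real} \<times> K)"

lemma compact_dilates: "compact K \<Longrightarrow> compact (dilates K)"
  unfolding dilates_def case_prod_unfold
  by (intro compact_continuous_image compact_Times compact_Icc continuous_intros)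

lemma dilates_subset_cone: "(\<And>s x. s > 0 \<Longrightarrow> x \<in> C \<Longrightarrow> s *\<^sub>R x \<in> C) \<Longrightarrow> K \<subseteq> C \<Longrightarrow> dilates K \<subseteq> C"
  by (auto simp: dilates_def)

lemma scaleR_notin_of_notin_dilates:
  assumes "y \<notin> dilates K" "t \<in> {1/2..2}"
  shows "t *\<^sub>R y \<notin> K"
proof
  assume "t *\<^sub>R y \<in> K"
  have "y \<in> dilates K"
    unfolding dilates_def by (rule image_eqI[of _ _ "(1 / t, t *\<^sub>R y)"])
      (use assms(2) \<open>t *\<^sub>R y \<in> K\<close> in \<open>auto simp: field_simps\<close>)
  then show False using assms(1) by blast
qed

lemma integrable_mult_dilation:
  fixes g \<psi> :: "real^3 \<Rightarrow> complex"
  assumes "continuous_on C g" "\<And>s x. s > 0 \<Longrightarrow> x \<in> C \<Longrightarrow> s *\<^sub>R x \<in> C" "continuous_on UNIV \<psi>"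
    and K: "compact K" "K \<subseteq> C" "\<And>x. x \<notin> K \<Longrightarrow> \<psi> x = 0" and t: "t \<in> {1/2..2}"
  shows "integrable lborel (\<lambda>y. g y * \<psi> (t *\<^sub>R y))"
proof (rule integrable_continuous_compact_support[OF _ compact_dilates[OF K(1)]
  dilates_subset_cone[OF assms(2) K(2)]])
  show "continuous_on C (\<lambda>y. g y * \<psi> (t *\<^sub>R y))"
    by (intro continuous_on_mult assms(1) continuous_on_compose2[OF assms(3)] continuous_intros) auto
  show "g y * \<psi> (t *\<^sub>R y) = 0" if "y \<notin> dilates K" for y
    using K(3)[OF scaleR_notin_of_notin_dilates[OF that t]] by simp
qed

lemma integral_homogeneous_dilation:
  fixes g \<psi> :: "real^3 \<Rightarrow> complex"
  assumes g: "continuous_on C g" and cone: "\<And>s x. s > 0 \<Longrightarrow> x \<in> C \<Longrightarrow> s *\<^sub>R x \<in> C"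
    and homogeneous: "\<And>s x. s > 0 \<Longrightarrow> x \<in> C \<Longrightarrow> g (s *\<^sub>R x) = g x / of_real (s ^ (m + 3))"
    and \<psi>: "continuous_on UNIV \<psi>" and K: "compact K" "K \<subseteq> C" "\<And>x. x \<notin> K \<Longrightarrow> \<psi> x = 0" and t: "t \<in> {1/2..2}"
  shows "(LINT y|lborel. g y * \<psi> (t *\<^sub>R y)) = of_real (t ^ m) * (LINT x|lborel. g x * \<psi> x)"
proof -
  let ?f = "\<lambda>y. g y * \<psi> (t *\<^sub>R y)"
  have "?f \<in> borel_measurable borel"
    using borel_measurable_integrable[OF integrable_mult_dilation[OF g cone \<psi> K t]] by simp
  from lborel_integral_affine[OF this, of "1 / t" 0]
  have "(LINT y|lborel. ?f y) = \<bar>1 / t\<bar> ^ 3 *\<^sub>R (LINT x|lborel. ?f ((1 / t) *\<^sub>R x))" using t by simp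
  moreover have "?f ((1 / t) *\<^sub>R x) = of_real (t ^ (m + 3)) * (g x * \<psi> x)" for x
  proof (cases "x \<in> K")
    case True
    then have "g ((1 / t) *\<^sub>R x) = g x / of_real ((1 / t) ^ (m + 3))" using t K(2)
      by (intro homogeneous) auto
    then show ?thesis using t by (simp add: power_divide)
  qed (use K(3) t in simp)
  ultimately show ?thesis using t by (simp add: power_add scaleR_conv_of_real power_divide)
qed

lemma directional_dilation_bounded:
  assumes \<psi>: "C1_on UNIV \<psi> D\<psi>" and K: "compact K"
  obtains B where "\<And>s y. s \<in> {1/2..2} \<Longrightarrow> y \<in> dilates K \<Longrightarrow> cmod (directional y D\<psi> (s *\<^sub>R y)) \<le> B"
proof -
  have "continuous_on ({1/2..2} \<times> dilates K) (\<lambda>(s, y). directional y D\<psi> (s *\<^sub>R y))"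
    unfolding directional_def case_prod_unfold
    by (intro continuous_intros continuous_on_compose2[OF C1_onD(3)[OF \<psi>]]) auto
  from compact_imp_bounded[OF compact_continuous_image[OF this
    compact_Times[OF compact_Icc compact_dilates[OF K]]]]
  obtain B where "\<forall>(s, y)\<in>{1/2..2} \<times> dilates K. cmod (directional y D\<psi> (s *\<^sub>R y)) \<le> B"
    unfolding bounded_iff by auto
  then show ?thesis by (intro that[of B]) blast
qed

lemma has_vector_derivative_integral_dilation:
  fixes g :: "real^3 \<Rightarrow> complex"
  assumes g: "continuous_on C g" and cone: "\<And>s x. s > 0 \<Longrightarrow> x \<in> C \<Longrightarrow> s *\<^sub>R x \<in> C"
    and \<psi>: "C1_on UNIV \<psi> D\<psi>" and K: "compact K" "K \<subseteq> C" "\<And>x. x \<notin> K \<Longrightarrow> \<psi> x = 0"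
  shows "((\<lambda>t. LINT y|lborel. g y * \<psi> (t *\<^sub>R y))
      has_vector_derivative (LINT y|lborel. g y * directional y D\<psi> y)) (at 1)"
proof -
  note K' = compact_dilates[OF K(1)] dilates_subset_cone[OF cone K(2)]
  obtain B where B: "\<And>s y. s \<in> {1/2..2} \<Longrightarrow> y \<in> dilates K \<Longrightarrow> cmod (directional y D\<psi> (s *\<^sub>R y)) \<le> B"
    by (rule directional_dilation_bounded[OF \<psi> K(1)]) (rule that)
  have ray: "((\<lambda>t. \<psi> (t *\<^sub>R y)) has_vector_derivative directional y D\<psi> (t *\<^sub>R y)) (at t)" for t y
    using C1_on_has_vector_derivative_line[OF open_UNIV \<psi>, of 0 t y] by simp
  have "((\<lambda>t. LINT y|lborel. g y * \<psi> (t *\<^sub>R y))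
      has_vector_derivative (LINT y|lborel. g y * directional y D\<psi> (1 *\<^sub>R y))) (at 1)"
  proof (rule has_vector_derivative_integral)
    show "integrable lborel (\<lambda>y. norm (indicator (dilates K) y *\<^sub>R g y) * B)"
      using set_integrable_continuous_compact[OF g K'] unfolding set_integrable_def
      by (intro integrable_mult_left integrable_norm)
    show "((\<lambda>t. g y * \<psi> (t *\<^sub>R y)) has_vector_derivative g y * directional y D\<psi> (1 *\<^sub>R y)) (at 1)" for y
      by (rule has_vector_derivative_mult_right[OF ray])
    fix t :: real and y assume "\<bar>t - 1\<bar> < 1 / 2"
    then have t: "t \<in> {1/2..2}" unfolding atLeastAtMost_iff by linarith
    show "integrable lborel (\<lambda>y. g y * \<psi> (t *\<^sub>R y))"
      by (rule integrable_mult_dilation[OF g cone C1_onD(1)[OF \<psi>] K t])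
    show "norm (g y * \<psi> (t *\<^sub>R y) - g y * \<psi> (1 *\<^sub>R y))
        \<le> \<bar>t - 1\<bar> * (norm (indicator (dilates K) y *\<^sub>R g y) * B)"
    proof (cases "y \<in> dilates K")
      case True
      have "closed_segment 1 t \<subseteq> {1/2..2}" using t by (auto simp: closed_segment_eq_real_ivl)
      then have "norm (\<psi> (t *\<^sub>R y) - \<psi> (1 *\<^sub>R y)) \<le> B * \<bar>t - 1\<bar>"
        by (intro norm_diff_le_vector_derivative_bound[OF ray]) (use True in \<open>auto intro!: B\<close>)
      from mult_left_mono[OF this norm_ge_zero[of "g y"]] True show ?thesis
        unfolding right_diff_distrib[symmetric] norm_mult by (simp add: mult_ac)
    next
      case False
      then show ?thesis
        using K(3)[OF scaleR_notin_of_notin_dilates[OF False t]]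
          K(3)[OF scaleR_notin_of_notin_dilates[OF False, of 1]] by simp
    qed
  qed simp
  then show ?thesis by simp
qed

lemma integral_homogeneous_euler:
  fixes g :: "real^3 \<Rightarrow> complex"
  assumes g: "continuous_on C g" and cone: "\<And>s x. s > 0 \<Longrightarrow> x \<in> C \<Longrightarrow> s *\<^sub>R x \<in> C"
    and homogeneous: "\<And>s x. s > 0 \<Longrightarrow> x \<in> C \<Longrightarrow> g (s *\<^sub>R x) = g x / of_real (s ^ (m + 3))"
    and \<psi>: "C1_on UNIV \<psi> D\<psi>" and K: "compact K" "K \<subseteq> C" "\<And>x. x \<notin> K \<Longrightarrow> \<psi> x = 0"
  shows "(LINT x|lborel. g x * directional x D\<psi> x) = of_nat m * (LINT x|lborel. g x * \<psi> x)"
proof (rule vector_derivative_unique_at[OF has_vector_derivative_integral_dilation[OF g cone \<psi> K]])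
  let ?I = "LINT x|lborel. g x * \<psi> x"
  show "((\<lambda>t. LINT y|lborel. g y * \<psi> (t *\<^sub>R y)) has_vector_derivative of_nat m * ?I) (at 1)"
  proof (rule has_vector_derivative_transform_within_open)
    have "((\<lambda>t. t ^ m) has_real_derivative real m) (at (1::real))"
      by (auto intro!: derivative_eq_intros)
    from has_vector_derivative_mult_left[OF has_vector_derivative_of_real[OF this]]
    show "((\<lambda>t. of_real (t ^ m) * ?I) has_vector_derivative of_nat m * ?I) (at 1)" by simp
    show "of_real (t ^ m) * ?I = (LINT y|lborel. g y * \<psi> (t *\<^sub>R y))" if "t \<in> {1/2<..<2}" for t
      by (rule integral_homogeneous_dilation[OF g cone homogeneous C1_onD(1)[OF \<psi>] K, symmetric])
        (use that in auto)
  qed auto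
qed

text \<open>
  Up to a factor, \<open>conjugated_op k t\<close> is the Helmholtz operator in the variable \<open>x = t *\<^sub>R y\<close>,
  conjugated with the incoming wave \<open>fund (- k)\<close>; only the first-order radial term survives as \<open>t\<close>
  tends to \<open>0\<close>.
\<close>

definition conjugated_op ::
  "real \<Rightarrow> real \<Rightarrow> (3 \<Rightarrow> real^3 \<Rightarrow> complex) \<Rightarrow> (3 \<Rightarrow> real^3 \<Rightarrow> complex) \<Rightarrow> real^3 \<Rightarrow> complex" where
  "conjugated_op k t De DDe x =
     of_real (t * norm x) * ((\<Sum>i\<in>UNIV. DDe i x) - 2 * directional x De x / of_real ((norm x)^2))
     - 2 * \<i> * k * directional x De x"

lemma continuous_on_conjugated_op:
  assumes "C2_fun e De DDe" "0 \<notin> S"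
  shows "continuous_on S (conjugated_op k t De DDe)"
proof -
  note cont = C1_onD(3)[OF C2_funD(1)[OF assms(1)]] C2_funD(3)[OF assms(1)]
  have "continuous_on S (De i)" "continuous_on S (DDe i)" for i using cont[of i]
    by (auto intro: continuous_on_subset)
  moreover have "norm x \<noteq> 0" if "x \<in> S" for x using that assms(2) by auto
  ultimately show ?thesis unfolding conjugated_op_def[abs_def] directional_def
    by (intro continuous_intros) auto
qed

lemma helmholtz_op_incoming_product:
  fixes k :: real and e :: "real^3 \<Rightarrow> complex" and De DDe :: "3 \<Rightarrow> real^3 \<Rightarrow> complex"
  assumes "a > 0" "dsq 0 y \<ge> 2 * a^2" and t: "t > 0"
  defines "f \<equiv> \<lambda>y. regfund (- k) a (dsq 0 y)" and "Df \<equiv> radial_partial (regfund1 (- k) a) 0"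
    and "DDf \<equiv> radial_partial2 (regfund1 (- k) a) (regfund2 (- k) a) 0"
    and "Dg \<equiv> \<lambda>i y. of_real t * De i (t *\<^sub>R y)"
      and "DDg \<equiv> \<lambda>i y. of_real t * (of_real t * DDe i (t *\<^sub>R y))"
  shows "helmholtz_op k (\<lambda>y. f y * e (t *\<^sub>R y))
      (\<lambda>i y. (DDf i y * e (t *\<^sub>R y) + Df i y * Dg i y) + (Df i y * Dg i y + f y * DDg i y)) y
    = fund (- k) (dsq 0 y) / of_real (norm y) * conjugated_op k t De DDe (t *\<^sub>R y)"
proof -
  define n where "n = norm y"
  define F where "F = fund (- k) (n^2)"
  let ?E = "directional (t *\<^sub>R y) De (t *\<^sub>R y)" and ?L = "\<Sum>i\<in>UNIV. DDe i (t *\<^sub>R y)"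
  have dsq: "dsq 0 y = n^2" by (simp add: dsq_0 n_def)
  have "n^2 > 0" using assms(1,2) unfolding dsq
    by (meson less_le_trans mult_pos_pos zero_less_numeral zero_less_power)
  then have n: "n > 0" by (simp add: n_def)
  have "helmholtz_op k f DDf y = source (- k) a (dsq 0 y)"
    unfolding f_def DDf_def helmholtz_op_radial source_def by simp
  then have "helmholtz_op k f DDf y = 0" using source_eq_0[OF assms(1)] assms(2) by simp
  moreover have "(\<Sum>i\<in>UNIV. Df i y * Dg i y) = 2 * fund1 (- k) (n^2) * ?E"
    using regfund_eq_fund(2)[OF assms(1,2)]
    by (simp add: Df_def Dg_def radial_partial_def directional_def dsq sum_3 algebra_simps)
  moreover have "f y = F" using regfund_eq_fund(1)[OF assms(1,2)] by (simp add: f_def F_def dsq)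
  moreover have "(\<Sum>i\<in>UNIV. DDg i y) = of_real (t^2) * ?L"
    by (simp add: DDg_def sum_distrib_left power2_eq_square mult.assoc)
  ultimately have product: "helmholtz_op k (\<lambda>y. f y * e (t *\<^sub>R y))
      (\<lambda>i y. (DDf i y * e (t *\<^sub>R y) + Df i y * Dg i y) + (Df i y * Dg i y + f y * DDg i y)) y
    = 4 * fund1 (- k) (n^2) * ?E + F * (of_real (t^2) * ?L)"
    unfolding helmholtz_op_mult by simp
  have F1: "fund1 (- k) (n^2) = F * (- \<i> * k * of_real n - 1) / of_real (2 * n^2)"
    using fund1_eq[OF \<open>n^2 > 0\<close>, of "- k"] n by (simp add: F_def)
  show ?thesis
    unfolding product F1 conjugated_op_def norm_scaleR n_def[symmetric] dsq F_def[symmetric] using n t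
    by (simp add: field_simps power2_eq_square)
qed

context radiating
begin

definition far_coeff :: "nat \<Rightarrow> real^3 \<Rightarrow> complex" where
  "far_coeff m \<theta> = (deriv ^^ m) (far_ext \<theta>) 0 / fact m"

definition far_vanishes :: "nat \<Rightarrow> real^3 \<Rightarrow> bool" where
  "far_vanishes m \<theta> \<longleftrightarrow> norm \<theta> = 1 \<and> (\<forall>j<m. far_coeff j \<theta> = 0)"

lemma far_ext_taylor_remainder:
  obtains B :: "nat \<Rightarrow> real" where "\<And>n. B n \<ge> 0"
    "\<And>n \<theta> s. norm \<theta> = 1 \<Longrightarrow> 0 < s \<Longrightarrow> s \<le> far_radius / 4 \<Longrightarrow>
      cmod (far_ext \<theta> (of_real s) - (\<Sum>j<n. far_coeff j \<theta> * of_real s ^ j)) \<le> B n * s ^ n"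
proof -
  obtain M where M: "\<And>\<theta> z. norm \<theta> = 1 \<Longrightarrow> z \<in> ball 0 far_radius \<Longrightarrow> cmod (far_ext \<theta> z) \<le> M"
    using far_ext_bounded by blast
  define B where "B n = 2 * \<bar>M\<bar> * (2 / far_radius) ^ n" for n
  have B: "B n \<ge> 0" for n using far_radius_pos by (simp add: B_def)
  have "cmod (far_ext \<theta> (of_real s) - (\<Sum>j<n. far_coeff j \<theta> * of_real s ^ j)) \<le> B n * s ^ n"
    if "norm \<theta> = 1" "0 < s" "s \<le> far_radius / 4" for \<theta> s n
  proof -
    have "cmod (far_ext \<theta> (of_real s) - (\<Sum>j<n. far_coeff j \<theta> * of_real s ^ j))
        \<le> 2 * M * (2 * s / far_radius) ^ n"
      using norm_taylor_remainder_le[OF far_ext_holomorphic[OF that(1)] M[OF that(1)], of "of_real s" n]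
        that far_radius_pos
      by (simp add: far_coeff_def)
    also have "\<dots> \<le> 2 * \<bar>M\<bar> * (2 * s / far_radius) ^ n" using that far_radius_pos
      by (intro mult_right_mono) auto
    finally show ?thesis by (simp add: B_def power_divide power_mult_distrib)
  qed
  with B show ?thesis by (rule that)
qed

lemma far_ext_leading_bounds:
  obtains B where "B > 0"
    "\<And>\<theta> s. far_vanishes m \<theta> \<Longrightarrow> 0 < s \<Longrightarrow> s \<le> far_radius / 4 \<Longrightarrow>
        cmod (far_ext \<theta> (of_real s) / of_real s ^ m) \<le> B"
    "\<And>\<theta> s. far_vanishes m \<theta> \<Longrightarrow> 0 < s \<Longrightarrow> s \<le> far_radius / 4 \<Longrightarrow>
      cmod (far_ext \<theta> (of_real s) / of_real s ^ m - far_coeff m \<theta>) \<le> B * s"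
proof -
  obtain B where B: "\<And>n. B n \<ge> 0"
    and remainder: "\<And>n \<theta> s. norm \<theta> = 1 \<Longrightarrow> 0 < s \<Longrightarrow> s \<le> far_radius / 4 \<Longrightarrow>
      cmod (far_ext \<theta> (of_real s) - (\<Sum>j<n. far_coeff j \<theta> * of_real s ^ j)) \<le> B n * s ^ n"
    by (rule far_ext_taylor_remainder) (rule that)
  show ?thesis
  proof (rule that[of "B m + B (Suc m) + 1"])
    fix \<theta> s assume \<theta>: "far_vanishes m \<theta>" and s: "0 < s" "s \<le> far_radius / 4"
    have \<theta>1: "norm \<theta> = 1" and zero: "(\<Sum>j<m. far_coeff j \<theta> * of_real s ^ j) = 0"
      using \<theta> by (auto simp: far_vanishes_def)
    have "cmod (far_ext \<theta> (of_real s)) \<le> B m * s ^ m" using remainder[OF \<theta>1 s, of m] by (simp add: zero)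
    then have "cmod (far_ext \<theta> (of_real s) / of_real s ^ m) \<le> B m"
      using s by (simp add: norm_divide norm_power pos_divide_le_eq)
    then show "cmod (far_ext \<theta> (of_real s) / of_real s ^ m) \<le> B m + B (Suc m) + 1"
      using B[of "Suc m"] by simp
    have "far_ext \<theta> (of_real s) / of_real s ^ m - far_coeff m \<theta>
        = (far_ext \<theta> (of_real s) - far_coeff m \<theta> * of_real s ^ m) / of_real s ^ m"
      using s by (simp add: diff_divide_distrib)
    then have "cmod (far_ext \<theta> (of_real s) / of_real s ^ m - far_coeff m \<theta>)
        = cmod (far_ext \<theta> (of_real s) - far_coeff m \<theta> * of_real s ^ m) / s ^ m"
      using s by (simp add: norm_divide norm_power)
    also have "\<dots> \<le> B (Suc m) * s ^ Suc m / s ^ m"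
      using remainder[OF \<theta>1 s, of "Suc m"] s unfolding sum.lessThan_Suc zero
      by (intro divide_right_mono) auto
    also have "\<dots> = B (Suc m) * s" using s by simp
    also have "\<dots> \<le> (B m + B (Suc m) + 1) * s" using B[of m] s by (intro mult_right_mono) auto
    finally show "cmod (far_ext \<theta> (of_real s) / of_real s ^ m - far_coeff m \<theta>)
        \<le> (B m + B (Suc m) + 1) * s" .
  qed (use B[of m] B[of "Suc m"] in simp)
qed

lemma uniform_limit_far_coeff:
  "uniform_limit {\<theta>. far_vanishes m \<theta>} (\<lambda>s \<theta>. far_ext \<theta> (of_real s) / of_real s ^ m)
      (far_coeff m) (at_right 0)"
proof (rule uniform_limitI)
  fix e :: real assume e: "e > 0"
  obtain B where B: "B > 0"
    "\<And>\<theta> s. far_vanishes m \<theta> \<Longrightarrow> 0 < s \<Longrightarrow> s \<le> far_radius / 4 \<Longrightarrow>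
        cmod (far_ext \<theta> (of_real s) / of_real s ^ m) \<le> B"
    "\<And>\<theta> s. far_vanishes m \<theta> \<Longrightarrow> 0 < s \<Longrightarrow> s \<le> far_radius / 4 \<Longrightarrow>
      cmod (far_ext \<theta> (of_real s) / of_real s ^ m - far_coeff m \<theta>) \<le> B * s"
    by (rule far_ext_leading_bounds[of m]) (rule that)
  show "\<forall>\<^sub>F s in at_right 0. \<forall>\<theta>\<in>{\<theta>. far_vanishes m \<theta>}. dist (far_ext \<theta> (of_real s) / of_real s ^ m)
      (far_coeff m \<theta>) < e"
    unfolding eventually_at_right_field
  proof (intro exI[of _ "min (far_radius / 4) (e / B)"] conjI allI impI ballI)
    show "0 < min (far_radius / 4) (e / B)" using far_radius_pos e B(1) by simp
    fix s \<theta> assume s: "0 < s" "s < min (far_radius / 4) (e / B)" and "\<theta> \<in> {\<theta>. far_vanishes m \<theta>}"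
    then have "cmod (far_ext \<theta> (of_real s) / of_real s ^ m - far_coeff m \<theta>) \<le> B * s"
      by (intro B(3)) auto
    also have "\<dots> < e" using s B(1) by (simp add: pos_less_divide_eq mult.commute)
    finally show "dist (far_ext \<theta> (of_real s) / of_real s ^ m) (far_coeff m \<theta>) < e"
      by (simp add: dist_norm)
  qed
qed

lemma far_ext_tendsto_far_coeff:
  assumes "far_vanishes m \<theta>"
  shows "((\<lambda>s. far_ext \<theta> (of_real s) / of_real s ^ m) \<longlongrightarrow> far_coeff m \<theta>) (at_right 0)"
  by (rule tendsto_uniform_limitI[OF uniform_limit_far_coeff]) (use assms in simp)

lemma continuous_on_far_coeff: "continuous_on {\<theta>. far_vanishes m \<theta>} (far_coeff m)"
proof (rule uniform_limit_theorem[OF _ uniform_limit_far_coeff])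
  show "\<forall>\<^sub>F s in at_right 0. continuous_on {\<theta>. far_vanishes m \<theta>}
      (\<lambda>\<theta>. far_ext \<theta> (of_real s) / of_real s ^ m)"
    unfolding eventually_at_right_field
  proof (intro exI[of _ far_radius] conjI far_radius_pos allI impI)
    fix s assume s: "0 < s" "s < far_radius"
    have "s * R < 1" using s R by (simp add: far_radius_def field_simps)
    then have "continuous_on {\<theta>. far_vanishes m \<theta>} (\<lambda>\<theta>. w ((1 / s) *\<^sub>R \<theta>))"
      by (intro continuous_on_compose2[OF continuous_on_radial_w(1)] continuous_intros)
        (use s in \<open>auto simp: far_vanishes_def pos_less_divide_eq mult.commute\<close>)
    then have "continuous_on {\<theta>. far_vanishes m \<theta>}
        (\<lambda>\<theta>. of_real (1 / s) * exp (- \<i> * of_real (k / s)) * w ((1 / s) *\<^sub>R \<theta>) / of_real s ^ m)"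
      using s by (intro continuous_intros) auto
    then show "continuous_on {\<theta>. far_vanishes m \<theta>} (\<lambda>\<theta>. far_ext \<theta> (of_real s) / of_real s ^ m)"
      by (rule continuous_on_eq) (use s far_ext_of_real in \<open>auto simp: far_vanishes_def\<close>)
  qed
qed simp

definition far_weight :: "real^3 \<Rightarrow> complex" where
  "far_weight y = w y * fund (- k) (dsq 0 y) / of_real (norm y)"

definition leading_term :: "nat \<Rightarrow> real^3 \<Rightarrow> complex" where
  "leading_term m x = far_coeff m (sgn x) / of_real (norm x ^ (m + 3))"

definition rescaled_weight :: "nat \<Rightarrow> real \<Rightarrow> real^3 \<Rightarrow> complex" where
  "rescaled_weight m t x = far_weight ((1 / t) *\<^sub>R x) / of_real (t ^ (m + 3))"

lemma rescaled_weight_eq: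
  assumes x: "x \<noteq> 0" and t: "0 < t" "t < far_radius * norm x"
  shows "rescaled_weight m t x
    = far_ext (sgn x) (of_real (t / norm x)) / of_real (t / norm x) ^ m / of_real (norm x ^ (m + 3))"
proof -
  define s where "s = t / norm x"
  have s: "0 < s" "s < far_radius" using x t by (auto simp: s_def pos_divide_less_eq)
  have t_eq: "t = s * norm x" using x by (simp add: s_def)
  have "(1 / s) *\<^sub>R sgn x = (1 / t) *\<^sub>R x" using x by (simp add: s_def sgn_div_norm)
  then have "far_ext (sgn x) (of_real s) = of_real (1 / s) * exp (- \<i> * of_real (k / s))
      * w ((1 / t) *\<^sub>R x)"
    using far_ext_of_real[OF _ s, of "sgn x"] x by (simp add: norm_sgn)
  moreover have "norm ((1 / t) *\<^sub>R x) = 1 / s" using t by (simp add: s_def)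
  ultimately have "far_weight ((1 / t) *\<^sub>R x) = of_real (s ^ 3) * far_ext (sgn x) (of_real s)"
    using s by (simp add: far_weight_def fund_def phase_def sqrt_dsq power3_eq_cube)
  then show ?thesis
    unfolding rescaled_weight_def s_def[symmetric] using s x
    by (simp add: t_eq power_mult_distrib power_add)
qed

lemma continuous_on_far_weight: "continuous_on {x. norm x > R} far_weight"
  unfolding far_weight_def[abs_def] using R
  by (intro continuous_intros continuous_on_radial_w continuous_on_compose2[OF continuous_on_fund(2)])
    (auto simp: dsq_0)

lemma far_weight_integrable:
  assumes e: "C2_fun e De DDe" "compact K" "\<And>x. x \<notin> K \<Longrightarrow> e x = 0" and t: "t > 0"
    "\<And>x. x \<in> K \<Longrightarrow> t * R < norm x"
  shows "integrable lborel (\<lambda>x. far_weight ((1 / t) *\<^sub>R x) * conjugated_op k t De DDe x)"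
proof (rule integrable_continuous_compact_support[OF _ e(2)])
  show "K \<subseteq> {x. norm x > t * R}" using t(2) by blast
  have "continuous_on {x. norm x > t * R} (\<lambda>x. far_weight ((1 / t) *\<^sub>R x))"
    by (rule continuous_on_compose2[OF continuous_on_far_weight])
      (use t(1) in \<open>auto intro!: continuous_intros simp: pos_less_divide_eq mult.commute\<close>)
  moreover have "0 \<notin> {x::real^3. norm x > t * R}" using mult_pos_pos[OF t(1) R] by simp
  ultimately show "continuous_on {x. norm x > t * R}
      (\<lambda>x. far_weight ((1 / t) *\<^sub>R x) * conjugated_op k t De DDe x)"
    by (intro continuous_on_mult continuous_on_conjugated_op[OF e(1)])
qed (simp add: conjugated_op_def directional_def C2_fun_partials_eq_0_outside[OF e])

lemma integral_far_weight_dilated_eq_0: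
  assumes e: "C2_fun e De DDe" "compact K" "\<And>x. x \<notin> K \<Longrightarrow> e x = 0" and t: "t > 0"
    "\<And>x. x \<in> K \<Longrightarrow> t * R < norm x"
  shows "(LINT y|lborel. far_weight y * conjugated_op k t De DDe (t *\<^sub>R y)) = 0"
proof -
  let ?f = "\<lambda>y. regfund (- k) (R / 2) (dsq 0 y)" and ?Df = "radial_partial (regfund1 (- k) (R / 2)) 0"
    and ?DDf = "radial_partial2 (regfund1 (- k) (R / 2)) (regfund2 (- k) (R / 2)) 0"
    and ?Dg = "\<lambda>i y. of_real t * De i (t *\<^sub>R y)"
      and ?DDg = "\<lambda>i y. of_real t * (of_real t * DDe i (t *\<^sub>R y))"
  let ?op = "helmholtz_op k (\<lambda>y. ?f y * e (t *\<^sub>R y))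
      (\<lambda>i y. (?DDf i y * e (t *\<^sub>R y) + ?Df i y * ?Dg i y) + (?Df i y * ?Dg i y + ?f y * ?DDg i y))"
  define K' where "K' = (\<lambda>x. (1 / t) *\<^sub>R x) ` K"
  have "compact K'" unfolding K'_def by (intro compact_continuous_image continuous_intros e(2))
  have ext: "K' \<subseteq> {x. norm x > R}" using t by (auto simp: K'_def pos_less_divide_eq mult.commute)
  have outside: "t *\<^sub>R y \<notin> K" if "y \<notin> K'" for y
    using that t(1) image_eqI[of y "\<lambda>x. (1 / t) *\<^sub>R x" "t *\<^sub>R y" K] by (auto simp: K'_def)
  have "R / 2 > 0" using R by simp
  note C2 = C2_fun_mult[OF C2_fun_radial[OF has_vector_derivative_regfund[OF \<open>R / 2 > 0\<close>]
        continuous_on_regfund(3)[OF \<open>R / 2 > 0\<close>], of "- k" 0] C2_fun_scale[OF e(1), of t]]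
  have "?f y * e (t *\<^sub>R y) = 0" if "y \<notin> K'" for y using e(3)[OF outside[OF that]] by simp
  then have test: "(LINT y|lborel. w y * ?op y) = 0"
    by (rule integral_helmholtz_op_eq_0[OF C2 \<open>compact K'\<close> ext])
  have integrand: "w y * ?op y = far_weight y * conjugated_op k t De DDe (t *\<^sub>R y)" for y
  proof (cases "y \<in> K'")
    case True
    then have "norm y > R" using ext by blast
    then have "R^2 \<le> dsq 0 y" using R by (auto simp: dsq_0 intro!: power_mono)
    moreover have "2 * (R / 2)^2 \<le> R^2" by (simp add: power_divide)
    ultimately have "2 * (R / 2)^2 \<le> dsq 0 y" by linarith
    from helmholtz_op_incoming_product[OF \<open>R / 2 > 0\<close> this t(1)] show ?thesis
      by (simp add: far_weight_def)
  next
    case False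
    from C2_fun_partials_eq_0_outside[OF e outside[OF this]] e(3)[OF outside[OF this]] show ?thesis
      by (simp add: helmholtz_op_def conjugated_op_def directional_def)
  qed
  show ?thesis using test unfolding integrand .
qed

lemma integral_far_weight_eq_0:
  assumes e: "C2_fun e De DDe" "compact K" "\<And>x. x \<notin> K \<Longrightarrow> e x = 0" and t: "t > 0"
    "\<And>x. x \<in> K \<Longrightarrow> t * R < norm x"
  shows "(LINT x|lborel. far_weight ((1 / t) *\<^sub>R x) * conjugated_op k t De DDe x) = 0"
proof -
  let ?h = "\<lambda>y. far_weight y * conjugated_op k t De DDe (t *\<^sub>R y)"
  have scaled: "?h ((1 / t) *\<^sub>R x) = far_weight ((1 / t) *\<^sub>R x) * conjugated_op k t De DDe x" for x
    using t(1) by simp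
  have "(\<lambda>x. ?h ((1 / t) *\<^sub>R x)) \<in> borel_measurable borel"
    using borel_measurable_integrable[OF far_weight_integrable[OF assms]] unfolding scaled by simp
  then have "(\<lambda>y. ?h ((1 / t) *\<^sub>R (t *\<^sub>R y))) \<in> borel_measurable borel"
    by (rule measurable_compose[rotated]) simp
  then have "?h \<in> borel_measurable borel" using t(1) by simp
  from lborel_integral_affine[OF this, of "1 / t" 0] show ?thesis
    using integral_far_weight_dilated_eq_0[OF assms] t(1) by (simp add: scaled)
qed

end

lemma conjugated_op_tendsto:
  fixes k :: real
  shows "((\<lambda>t. conjugated_op k t De DDe x) \<longlongrightarrow> - 2 * \<i> * k * directional x De x) (at_right 0)"
  unfolding conjugated_op_def by (auto intro!: tendsto_eq_intros)

lemma conjugated_op_dominated: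
  assumes e: "C2_fun e De DDe" and K: "compact K" "0 \<notin> K"
  obtains G where "integrable lborel G" "\<And>x. 0 \<le> G x"
    "\<And>t x. 0 < t \<Longrightarrow> t \<le> T \<Longrightarrow> x \<in> K \<Longrightarrow> cmod (conjugated_op k t De DDe x) \<le> G x"
proof -
  have "continuous_on ({0..T} \<times> K) (\<lambda>(t, x). conjugated_op k t De DDe x)"
    unfolding conjugated_op_def directional_def case_prod_unfold using K(2)
    by (intro continuous_intros continuous_on_compose2[OF C1_onD(3)[OF C2_funD(1)[OF e]]]
        continuous_on_compose2[OF C2_funD(3)[OF e]]) auto
  from compact_imp_bounded[OF compact_continuous_image[OF this compact_Times[OF compact_Icc K(1)]]]
  obtain B where bound: "\<forall>(t, x)\<in>{0..T} \<times> K. cmod (conjugated_op k t De DDe x) \<le> B"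
    unfolding bounded_iff by auto
  have B: "cmod (conjugated_op k t De DDe x) \<le> \<bar>B\<bar> * indicator K x" if "0 < t" "t \<le> T" "x \<in> K" for t x
    using bspec[OF bound, of "(t, x)"] that by simp
  have "integrable lborel (\<lambda>x. \<bar>B\<bar> * indicator K x)"
    by (rule integrable_indicator_compact[OF K(1)])
  then show ?thesis by (rule that[of "\<lambda>x. \<bar>B\<bar> * indicator K x"]) (use B in auto)
qed

lemma eq_0_of_integral_bump_eq_0:
  fixes f :: "real^3 \<Rightarrow> complex"
  assumes C: "open C" "c \<in> C" and f: "continuous_on C f"
    and zero: "\<And>r. r > 0 \<Longrightarrow> cball c r \<subseteq> C \<Longrightarrow> (LINT x|lborel. f x * of_real (1 - cutoff (r / 2) (dsq c x)))
        = 0"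
  shows "f c = 0"
proof (rule ccontr)
  assume nz: "f c \<noteq> 0"
  let ?g = "\<lambda>x. Re (f x * cnj (f c))"
  have g: "continuous_on C ?g" by (intro continuous_intros f)
  have "?g c = (cmod (f c))^2" by (simp add: cmod_power2 flip: power2_eq_square)
  then have "c \<in> C \<inter> ?g -` {0<..}" using nz C(2) by simp
  moreover have "open (C \<inter> ?g -` {0<..})" by (rule continuous_open_preimage[OF g C(1)]) simp
  ultimately obtain r where r: "r > 0" "cball c r \<subseteq> C \<inter> ?g -` {0<..}" using open_contains_cball by blast
  then have g_pos: "?g x > 0" if "x \<in> cball c r" for x using that by auto
  have ball: "cball c r \<subseteq> C" using r(2) by auto
  let ?b = "\<lambda>x. 1 - cutoff (r / 2) (dsq c x)"
  have supp: "?b x = 0" if "x \<notin> cball c r" for x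
    using cutoff_dsq_eq(3)[of "r / 2" x c] that r(1) by (simp add: dist_norm norm_minus_commute)
  have int: "integrable lborel (\<lambda>x. f x * of_real (?b x))"
    by (rule integrable_continuous_compact_support[OF _ compact_cball ball])
      (use supp r(1) in \<open>auto intro!: continuous_intros f\<close>)
  have Re_eq: "?g x * ?b x = Re (f x * of_real (?b x) * cnj (f c))" for x by (simp add: algebra_simps)
  have "Re (LINT x|lborel. f x * of_real (?b x) * cnj (f c)) = (LINT x|lborel. ?g x * ?b x)"
    unfolding Re_eq by (rule integral_Re[symmetric, OF integrable_mult_left[OF int]])
  also have "\<dots> > 0"
  proof (rule integral_pos_continuous)
    show "continuous_on UNIV (\<lambda>x. ?g x * ?b x)"
      by (rule continuous_on_UNIV_compact_support[OF C(1) _ closed_cball ball])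
        (use r(1) supp in \<open>auto intro!: continuous_intros f\<close>)
    show "integrable lborel (\<lambda>x. ?g x * ?b x)"
      unfolding Re_eq by (rule integrable_Re[OF integrable_mult_left[OF int]])
    show "?g x * ?b x \<ge> 0" for x
      using less_imp_le[OF g_pos[of x]] cutoff_le_1[of "r / 2" "dsq c x"] supp[of x]
      by (cases "x \<in> cball c r") auto
    show "?g c * ?b c > 0" using g_pos[of c] r(1) cutoff_dsq_eq(1)[of "r / 2" c c] by simp
  qed
  finally show False unfolding integral_mult_left_zero zero[OF r(1) ball] by simp
qed

context radiating
begin

lemma rescaled_weight_tendsto:
  assumes x: "x \<noteq> 0" "far_vanishes m (sgn x)"
  shows "((\<lambda>t. rescaled_weight m t x) \<longlongrightarrow> leading_term m x) (at_right 0)"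
proof (rule Lim_transform_eventually)
  have "filterlim (\<lambda>t. 1 / norm x * t) (at_right 0) (at_right 0)"
    by (rule filterlim_times_pos[OF filterlim_ident]) (use x(1) in auto)
  from filterlim_compose[OF far_ext_tendsto_far_coeff[OF x(2)] this]
  have "((\<lambda>t. far_ext (sgn x) (of_real (t / norm x)) / of_real (t / norm x) ^ m)
      \<longlongrightarrow> far_coeff m (sgn x)) (at_right 0)"
    by simp
  then show "((\<lambda>t. far_ext (sgn x) (of_real (t / norm x)) / of_real (t / norm x) ^ m
      / of_real (norm x ^ (m + 3)))
      \<longlongrightarrow> leading_term m x) (at_right 0)"
    unfolding leading_term_def by (rule tendsto_divide[OF _ tendsto_const]) (use x(1) in simp)
  show "\<forall>\<^sub>F t in at_right 0. far_ext (sgn x) (of_real (t / norm x)) / of_real (t / norm x) ^ m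
      / of_real (norm x ^ (m + 3))
      = rescaled_weight m t x"
    unfolding eventually_at_right_field
    using rescaled_weight_eq[OF x(1)] far_radius_pos x(1)
    by (intro exI[of _ "far_radius * norm x"]) simp
qed

lemma rescaled_weight_bounded:
  assumes "\<delta> > 0"
  obtains B where "\<And>t x. 0 < t \<Longrightarrow> t < \<delta> * far_radius / 4 \<Longrightarrow> \<delta> \<le> norm x \<Longrightarrow> far_vanishes m (sgn x) \<Longrightarrow>
    cmod (rescaled_weight m t x) \<le> B"
proof -
  obtain B where B: "B > 0"
    "\<And>\<theta> s. far_vanishes m \<theta> \<Longrightarrow> 0 < s \<Longrightarrow> s \<le> far_radius / 4 \<Longrightarrow>
        cmod (far_ext \<theta> (of_real s) / of_real s ^ m) \<le> B"
    "\<And>\<theta> s. far_vanishes m \<theta> \<Longrightarrow> 0 < s \<Longrightarrow> s \<le> far_radius / 4 \<Longrightarrow>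
      cmod (far_ext \<theta> (of_real s) / of_real s ^ m - far_coeff m \<theta>) \<le> B * s"
    by (rule far_ext_leading_bounds[of m]) (rule that)
  have "cmod (rescaled_weight m t x) \<le> B / \<delta> ^ (m + 3)"
    if t: "0 < t" "t < \<delta> * far_radius / 4" and x: "\<delta> \<le> norm x" "far_vanishes m (sgn x)" for t x
  proof -
    have "x \<noteq> 0" using x(1) assms by auto
    have "\<delta> * far_radius / 4 \<le> far_radius / 4 * norm x" using x(1) far_radius_pos by simp
    then have "t < far_radius / 4 * norm x" using t(2) by simp
    then have s: "t < far_radius * norm x" "0 < t / norm x" "t / norm x \<le> far_radius / 4"
      using t(1) far_radius_pos \<open>x \<noteq> 0\<close> by (auto simp: pos_divide_le_eq)
    have "cmod (far_ext (sgn x) (of_real (t / norm x)) / of_real (t / norm x) ^ m) / norm x ^ (m + 3)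
        \<le> B / \<delta> ^ (m + 3)"
      using x(1) assms B(1) by (intro frac_le B(2)[OF x(2) s(2,3)] power_mono) auto
    then show ?thesis
      unfolding rescaled_weight_eq[OF \<open>x \<noteq> 0\<close> t(1) s(1)] norm_divide[of _ "of_real (norm x ^ (m + 3))"]
      by (simp add: norm_power)
  qed
  then show ?thesis by (rule that)
qed

lemma rescaled_weight_conjugated_dominated:
  assumes e: "C2_fun e De DDe" "compact K" "\<And>x. x \<notin> K \<Longrightarrow> e x = 0"
    and K: "0 \<notin> K" "\<And>x. x \<in> K \<Longrightarrow> far_vanishes m (sgn x)"
  obtains T G where "T > 0" "integrable lborel G"
    "\<And>t. 0 < t \<Longrightarrow> t < T \<Longrightarrow> (\<lambda>x. rescaled_weight m t x * conjugated_op k t De DDe x)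
        \<in> borel_measurable lborel"
    "\<And>t x. 0 < t \<Longrightarrow> t < T \<Longrightarrow> cmod (rescaled_weight m t x * conjugated_op k t De DDe x) \<le> G x"
proof -
  obtain \<delta> where \<delta>: "\<delta> > 0" "\<And>x. x \<in> K \<Longrightarrow> \<delta> \<le> norm x"
    using separate_point_closed[OF compact_imp_closed[OF e(2)] K(1)] by auto
  obtain B where B: "\<And>t x. 0 < t \<Longrightarrow> t < \<delta> * far_radius / 4 \<Longrightarrow> \<delta> \<le> norm x \<Longrightarrow> far_vanishes m (sgn x) \<Longrightarrow>
      cmod (rescaled_weight m t x) \<le> B"
    by (rule rescaled_weight_bounded[OF \<delta>(1)]) (rule that)
  define T where "T = \<delta> * far_radius / 4"
  obtain G where G: "integrable lborel G" "\<And>x. 0 \<le> G x"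
    "\<And>t x. 0 < t \<Longrightarrow> t \<le> T \<Longrightarrow> x \<in> K \<Longrightarrow> cmod (conjugated_op k t De DDe x) \<le> G x"
    by (rule conjugated_op_dominated[OF e(1,2) K(1)]) (rule that)
  show ?thesis
  proof (rule that)
    show "T > 0" using \<delta>(1) far_radius_pos by (simp add: T_def)
    show "integrable lborel (\<lambda>x. \<bar>B\<bar> * G x)" using G(1) by (rule integrable_mult_right)
    fix t :: real assume t: "0 < t" "t < T"
    have scale: "t * R < norm x" if "x \<in> K" for x
    proof -
      have "t * R < T * R" using t R by simp
      also have "T * R \<le> \<delta>" using R \<delta>(1) by (simp add: T_def far_radius_def)
      finally show ?thesis using \<delta>(2)[OF that] by simp
    qed
    show "(\<lambda>x. rescaled_weight m t x * conjugated_op k t De DDe x) \<in> borel_measurable lborel"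
      unfolding rescaled_weight_def times_divide_eq_left
      by (intro borel_measurable_divide borel_measurable_integrable[OF far_weight_integrable[OF e
        t(1) scale]]) auto
    show "cmod (rescaled_weight m t x * conjugated_op k t De DDe x) \<le> \<bar>B\<bar> * G x" for x
    proof (cases "x \<in> K")
      case True
      have "cmod (rescaled_weight m t x) \<le> \<bar>B\<bar>"
        using B[of t x] \<delta>(2)[OF True] K(2)[OF True] t by (simp add: T_def)
      then show ?thesis unfolding norm_mult using G(3)[OF _ _ True, of t] t by (intro mult_mono) auto
    qed (simp add: G(2) conjugated_op_def directional_def C2_fun_partials_eq_0_outside[OF e])
  qed
qed

lemma rescaled_weight_conjugated_integral_tendsto:
  assumes e: "C2_fun e De DDe" "compact K" "\<And>x. x \<notin> K \<Longrightarrow> e x = 0"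
    and K: "0 \<notin> K" "\<And>x. x \<in> K \<Longrightarrow> far_vanishes m (sgn x)"
  shows "((\<lambda>t. LINT x|lborel. rescaled_weight m t x * conjugated_op k t De DDe x)
    \<longlongrightarrow> (LINT x|lborel. leading_term m x * (- 2 * \<i> * k * directional x De x))) (at_right 0)"
proof -
  let ?F = "\<lambda>t x. rescaled_weight m t x * conjugated_op k t De DDe x"
    and ?L = "\<lambda>x. leading_term m x * (- 2 * \<i> * k * directional x De x)"
  obtain T G where T: "T > 0" and G: "integrable lborel G"
      "\<And>t. 0 < t \<Longrightarrow> t < T \<Longrightarrow> ?F t \<in> borel_measurable lborel" "\<And>t x. 0 < t \<Longrightarrow> t < T \<Longrightarrow> cmod (?F t x) \<le> G x"
    by (rule rescaled_weight_conjugated_dominated[OF e K]) (assumption | rule that)+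
  have within: "at 0 within {0<..<T} = at_right 0"
    using T by (intro at_within_nhd[of _ "{..<T}"]) auto
  have "((\<lambda>t. LINT x|lborel. ?F t x) \<longlongrightarrow> (LINT x|lborel. ?L x)) (at 0 within {0<..<T})"
  proof (rule tendsto_integral_dominated[OF G(1)])
    show "((\<lambda>t. ?F t x) \<longlongrightarrow> ?L x) (at 0 within {0<..<T})" for x
    proof (cases "x \<in> K")
      case True
      then have "x \<noteq> 0" using K(1) by auto
      from tendsto_mult[OF rescaled_weight_tendsto[OF this K(2)[OF True]] conjugated_op_tendsto]
      show ?thesis unfolding within .
    qed (simp add: conjugated_op_def directional_def C2_fun_partials_eq_0_outside[OF e])
  qed (use G(2,3) in auto)
  then show ?thesis unfolding within .
qed

lemma integral_leading_term_eq_0: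
  assumes e: "C2_fun e De DDe" "compact K" "\<And>x. x \<notin> K \<Longrightarrow> e x = 0"
    and K: "0 \<notin> K" "\<And>x. x \<in> K \<Longrightarrow> far_vanishes m (sgn x)"
  shows "(LINT x|lborel. leading_term m x * directional x De x) = 0"
proof -
  obtain \<delta> where \<delta>: "\<delta> > 0" "\<And>x. x \<in> K \<Longrightarrow> \<delta> \<le> norm x"
    using separate_point_closed[OF compact_imp_closed[OF e(2)] K(1)] by auto
  have "(LINT x|lborel. rescaled_weight m t x * conjugated_op k t De DDe x) = 0"
    if "0 < t" "t < \<delta> / R" for t
  proof -
    have "t * R < norm x" if "x \<in> K" for x using \<delta>(2)[OF that] \<open>t < \<delta> / R\<close> R
      by (simp add: pos_less_divide_eq)
    then have "(LINT x|lborel. far_weight ((1 / t) *\<^sub>R x) * conjugated_op k t De DDe x) = 0"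
      by (intro integral_far_weight_eq_0[OF e \<open>0 < t\<close>])
    then show ?thesis unfolding rescaled_weight_def times_divide_eq_left integral_divide_zero by simp
  qed
  then have "\<forall>\<^sub>F t in at_right 0.
      (LINT x|lborel. rescaled_weight m t x * conjugated_op k t De DDe x) = 0"
    unfolding eventually_at_right_field using \<delta>(1) R by (intro exI[of _ "\<delta> / R"]) simp
  from tendsto_unique[OF trivial_limit_at_right_real rescaled_weight_conjugated_integral_tendsto[OF e K]
    tendsto_eventually[OF this]]
  have "- 2 * \<i> * k * (LINT x|lborel. leading_term m x * directional x De x) = 0"
    by (subst integral_mult_right_zero[symmetric]) (simp add: mult_ac)
  then show ?thesis using k by simp
qed

lemma leading_term_scaleR: "s > 0 \<Longrightarrow> leading_term m (s *\<^sub>R x) = leading_term m x / of_real (s ^ (m + 3))"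
  by (simp add: leading_term_def sgn_scaleR power_mult_distrib)

lemma continuous_on_leading_term:
  assumes "0 \<notin> C" "\<And>x. x \<in> C \<Longrightarrow> far_vanishes m (sgn x)"
  shows "continuous_on C (leading_term m)"
proof -
  have sgn: "continuous_on C sgn" by (intro continuous_intros) (use assms(1) in auto)
  have "continuous_on C (\<lambda>x. far_coeff m (sgn x))"
    by (rule continuous_on_compose2[OF continuous_on_far_coeff sgn])
      (use assms in \<open>auto simp: norm_sgn\<close>)
  then show ?thesis
    unfolding leading_term_def[abs_def] by (intro continuous_intros) (use assms(1) in auto)
qed

lemma far_coeff_eq_0:
  assumes V: "open V" "\<And>\<theta>. \<theta> \<in> V \<Longrightarrow> norm \<theta> = 1 \<Longrightarrow> far_vanishes m \<theta>" and m: "m \<ge> 1"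
    and \<theta>: "\<theta> \<in> V" "norm \<theta> = 1"
  shows "far_coeff m \<theta> = 0"
proof -
  define C where "C = (- {0}) \<inter> sgn -` V"
  have "continuous_on (- {0::real^3}) sgn" by (intro continuous_intros) auto
  then have C: "open C" "0 \<notin> C" unfolding C_def using V(1) by (auto intro: continuous_open_preimage)
  have cone: "s *\<^sub>R x \<in> C" if "s > 0" "x \<in> C" for s x using that by (auto simp: C_def sgn_scaleR)
  have vanishes: "far_vanishes m (sgn x)" if "x \<in> C" for x using that V(2)[of "sgn x"]
    by (simp add: C_def norm_sgn)
  note lead = continuous_on_leading_term[OF C(2) vanishes]
  have "sgn \<theta> = \<theta>" using \<theta>(2) by (simp add: sgn_div_norm)
  then have "\<theta> \<in> C" and lead_\<theta>: "leading_term m \<theta> = far_coeff m \<theta>"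
    using \<theta> by (auto simp: C_def leading_term_def)
  have "leading_term m \<theta> = 0"
  proof (rule eq_0_of_integral_bump_eq_0[OF C(1) \<open>\<theta> \<in> C\<close> lead])
    fix r :: real assume r: "r > 0" "cball \<theta> r \<subseteq> C"
    let ?h = "\<lambda>x. complex_of_real (1 - cutoff (r / 2) (dsq \<theta> x))"
      and ?Dh = "radial_partial (\<lambda>s. complex_of_real (- cutoff1 (r / 2) s)) \<theta>"
    have bump: "C2_fun ?h ?Dh (radial_partial2 (\<lambda>s. of_real (- cutoff1 (r / 2) s))
        (\<lambda>s. of_real (- cutoff2 (r / 2) s)) \<theta>)"
      using r(1) by (intro C2_fun_bump) simp
    have supp: "?h x = 0" if "x \<notin> cball \<theta> r" for x
      using cutoff_dsq_eq(3)[of "r / 2" x \<theta>] that r(1) by (simp add: dist_norm norm_minus_commute)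
    have "(LINT x|lborel. leading_term m x * directional x ?Dh x) = 0"
      by (rule integral_leading_term_eq_0[OF bump compact_cball supp _ vanishes])
        (use r(2) C(2) in blast)+
    moreover have "(LINT x|lborel. leading_term m x * directional x ?Dh x)
        = of_nat m * (LINT x|lborel. leading_term m x * ?h x)"
      by (rule integral_homogeneous_euler[OF lead cone leading_term_scaleR C2_funD(1)[OF bump]
        compact_cball r(2) supp])
    ultimately show "(LINT x|lborel. leading_term m x * ?h x) = 0" using m by simp
  qed
  then show ?thesis by (simp add: lead_\<theta>)
qed

lemma eq_0_of_far_coeff_eq_0:
  assumes x: "norm x > 1 / far_radius" and zero: "\<And>m. far_coeff m (sgn x) = 0"
  shows "w x = 0"
proof -
  have "norm x > 0" using x far_radius_pos by (meson less_trans zero_less_divide_1_iff)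
  then have \<theta>: "norm (sgn x) = 1" and s: "0 < 1 / norm x" "1 / norm x < far_radius"
    using x far_radius_pos by (auto simp: norm_sgn field_simps)
  have "(\<lambda>j. far_coeff j (sgn x) * (of_real (1 / norm x) - 0) ^ j)
      sums far_ext (sgn x) (of_real (1 / norm x))"
    unfolding far_coeff_def by (rule holomorphic_power_series[OF far_ext_holomorphic[OF \<theta>]])
      (use s in \<open>simp add: norm_divide\<close>)
  then have "far_ext (sgn x) (of_real (1 / norm x)) = 0"
    by (simp add: zero sums_unique2[OF _ sums_zero])
  then show ?thesis using far_ext_of_real[OF \<theta> s] \<open>norm x > 0\<close> by (simp add: sgn_div_norm)
qed

theorem rellich:
  assumes V: "open V"
    and far: "\<And>\<theta>. \<theta> \<in> V \<Longrightarrow> norm \<theta> = 1 \<Longrightarrow>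
      ((\<lambda>r. of_real r * exp (- \<i> * of_real (k * r)) * w (r *\<^sub>R \<theta>)) \<longlongrightarrow> 0) at_top"
  obtains \<rho> where "\<And>x. norm x > \<rho> \<Longrightarrow> sgn x \<in> V \<Longrightarrow> w x = 0"
proof -
  have coeff_0: "far_coeff m \<theta> = 0" if "\<theta> \<in> V" "norm \<theta> = 1" for m \<theta>
    using that
  proof (induction m arbitrary: \<theta> rule: less_induct)
    case (less m)
    show ?case
    proof (cases "m = 0")
      case True
      have "((\<lambda>s. of_real (1 / s) * exp (- \<i> * of_real (k * (1 / s))) * w ((1 / s) *\<^sub>R \<theta>))
          \<longlongrightarrow> 0) (at_right 0)"
        using filterlim_compose[OF far[OF less.prems] filterlim_inverse_at_top_right]
        by (simp add: inverse_eq_divide)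
      moreover have "\<forall>\<^sub>F s in at_right 0. of_real (1 / s) * exp (- \<i> * of_real (k * (1 / s)))
          * w ((1 / s) *\<^sub>R \<theta>) = far_ext \<theta> (of_real s)"
        unfolding eventually_at_right_field using far_ext_of_real[OF less.prems(2)] far_radius_pos
        by auto
      ultimately have "((\<lambda>s. far_ext \<theta> (of_real s)) \<longlongrightarrow> 0) (at_right (0::real))"
        by (rule Lim_transform_eventually)
      moreover have "((\<lambda>s. far_ext \<theta> (of_real s)) \<longlongrightarrow> far_coeff 0 \<theta>) (at_right (0::real))"
        using far_ext_tendsto_far_coeff[of 0 \<theta>] less.prems by (simp add: far_vanishes_def)
      ultimately show ?thesis using tendsto_unique[OF trivial_limit_at_right_real] True by blast
    next
      case False
      then show ?thesis
        using less by (intro far_coeff_eq_0[OF V]) (auto simp: far_vanishes_def)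
    qed
  qed
  have "w x = 0" if "norm x > 1 / far_radius" "sgn x \<in> V" for x
  proof (rule eq_0_of_far_coeff_eq_0[OF that(1)])
    have "norm x > 0" using that(1) far_radius_pos by (meson less_trans zero_less_divide_1_iff)
    then show "far_coeff m (sgn x) = 0" for m by (intro coeff_0 that(2)) (simp add: norm_sgn)
  qed
  then show ?thesis by (rule that)
qed

end

section \<open>Unique continuation along rays\<close>

definition cfund :: "real \<Rightarrow> complex \<Rightarrow> complex" where
  "cfund k q = exp (\<i> * k * csqrt q) / csqrt q"

definition cfund1 :: "real \<Rightarrow> complex \<Rightarrow> complex" where
  "cfund1 k q = exp (\<i> * k * csqrt q) * (\<i> * k * csqrt q - 1) / (2 * csqrt q ^ 3)"

lemma cfund_of_real:
  assumes "s \<ge> 0"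
  shows "cfund k (of_real s) = fund k s" "cfund1 k (of_real s) = fund1 k s"
  unfolding cfund_def cfund1_def fund_defs Let_def csqrt_of_real[OF assms] by simp_all

lemma cfund_holomorphic:
  assumes "f holomorphic_on S" "\<And>z. z \<in> S \<Longrightarrow> Re (f z) > 0"
  shows "(\<lambda>z. cfund k (f z)) holomorphic_on S" "(\<lambda>z. cfund1 k (f z)) holomorphic_on S"
  unfolding cfund_def cfund1_def using csqrt_Re_pos[OF assms(2)]
  by (auto intro!: holomorphic_intros assms(1))

lemma continuous_on_cfund:
  assumes "continuous_on S f" "\<And>x. x \<in> S \<Longrightarrow> Re (f x) > 0"
  shows "continuous_on S (\<lambda>x. cfund k (f x))" "continuous_on S (\<lambda>x. cfund1 k (f x))"
  unfolding cfund_def cfund1_def using csqrt_Re_pos(3)[OF assms(2)]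
  by (auto intro!: continuous_intros continuous_on_csqrt_Re_pos assms)

definition line_density ::
  "real \<Rightarrow> (real^3 \<Rightarrow> complex) \<Rightarrow> (3 \<Rightarrow> real^3 \<Rightarrow> complex) \<Rightarrow> real^3 \<Rightarrow> real^3 \<Rightarrow> real \<Rightarrow> complex \<Rightarrow>
      real^3 \<Rightarrow> complex"
  where
  "line_density k w p x v \<delta> z y = - 2 * of_real (cutoff1 \<delta> (dsq x y)) *
     (cfund k (cdsq (y - x) v z) * directional (y - x) p y
      - 2 * w y * (of_real (dsq x y) - z * of_real ((y - x) \<bullet> v)) * cfund1 k (cdsq (y - x) v z))"

lemma line_density_of_real:
  "line_density k w p x v \<delta> (of_real t) y = (\<Sum>i\<in>UNIV.
      (fund k (dsq (x + t *\<^sub>R v) y) * p i y - w y * radial_partial (fund1 k) (x + t *\<^sub>R v) i y)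
      * radial_partial (\<lambda>s. of_real (- cutoff1 \<delta> s)) x i y)"
proof -
  let ?x = "x + t *\<^sub>R v"
  have fund1_part: "directional (y - x) (radial_partial (fund1 k) ?x) y
      = 2 * (of_real (dsq x y) - of_real t * of_real ((y - x) \<bullet> v)) * fund1 k (dsq ?x y)"
    unfolding directional_radial_partial dsq_def power2_norm_eq_inner
    by (simp add: inner_diff_right inner_add_right algebra_simps)
  have cdsq: "cdsq (y - x) v (of_real t) = of_real (dsq ?x y)"
    by (simp add: cdsq_of_real dsq_def algebra_simps)
  have "line_density k w p x v \<delta> (of_real t) y
      = - 2 * of_real (cutoff1 \<delta> (dsq x y)) * (fund k (dsq ?x y) * directional (y - x) p y
        - w y * directional (y - x) (radial_partial (fund1 k) ?x) y)"
    by (simp add: line_density_def cfund_of_real fund1_part cdsq mult_ac)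
  also have "\<dots> = (\<Sum>i\<in>UNIV. (fund k (dsq ?x y) * p i y - w y * radial_partial (fund1 k) ?x i y)
      * radial_partial (\<lambda>s. of_real (- cutoff1 \<delta> s)) x i y)"
    by (simp add: directional_def radial_partial_def sum_3 algebra_simps)
  finally show ?thesis .
qed

lemma (in weak_helmholtz) line_representation:
  assumes w: "continuous_on D w" and \<delta>: "\<delta> > 0" "cball x (2 * \<delta>) \<subseteq> D" and v: "norm v = 1"
    and t: "\<bar>t\<bar> < \<delta> / 4"
  shows "of_real source_mass * w (x + t *\<^sub>R v)
    = (LINT y:cball x (2 * \<delta>) - ball x \<delta>|lborel. line_density k w p x v \<delta> (of_real t) y)"
proof -
  let ?x = "x + t *\<^sub>R v" and ?K = "cball x (2 * \<delta>) - ball x \<delta>"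
    and ?D\<eta> = "radial_partial (\<lambda>s. of_real (- cutoff1 \<delta> s)) x"
  have near: "ball ?x (\<delta> / 2) \<subseteq> ball x \<delta>"
  proof
    fix y assume "y \<in> ball ?x (\<delta> / 2)"
    moreover have "dist x ?x = \<bar>t\<bar>" using v by (simp add: dist_norm)
    ultimately show "y \<in> ball x \<delta>" using t dist_triangle[of x y ?x] by auto
  qed
  have "of_real source_mass * w ?x = (LINT y|lborel. (\<Sum>i\<in>UNIV.
      (fund k (dsq ?x y) * p i y - w y * radial_partial (fund1 k) ?x i y) * ?D\<eta> i y))"
  proof (rule green_representation[OF _ _ C2_funD(1)[OF C2_fun_bump[OF \<delta>(1), of x]] _
    compact_cball \<delta>(2)])
    show "\<delta> / 2 > 0" using \<delta>(1) by simp
    have "ball ?x (\<delta> / 2) \<subseteq> D" using near \<delta> by force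
    then show "continuous_on (ball ?x (\<delta> / 2)) w" by (rule continuous_on_subset[OF w])
    show "complex_of_real (1 - cutoff \<delta> (dsq x y)) = 1" if "y \<in> ball ?x (\<delta> / 2)" for y
      using subsetD[OF near that] cutoff_dsq_eq(1)[OF \<delta>(1), of y x]
      by (simp add: dist_norm norm_minus_commute)
    show "complex_of_real (1 - cutoff \<delta> (dsq x y)) = 0" if "y \<notin> cball x (2 * \<delta>)" for y
      using that cutoff_dsq_eq(3)[OF \<delta>(1), of y x] by (simp add: dist_norm norm_minus_commute)
  qed
  also have "\<dots> = (LINT y|lborel. indicator ?K y *\<^sub>R line_density k w p x v \<delta> (of_real t) y)"
  proof (rule Bochner_Integration.integral_cong[OF refl])
    fix y
    have "line_density k w p x v \<delta> (of_real t) y = 0" if "y \<notin> ?K"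
      using that cutoff_dsq_eq(2,4)[OF \<delta>(1), of y x]
      by (auto simp: line_density_def dist_norm norm_minus_commute)
    then show "(\<Sum>i\<in>UNIV. (fund k (dsq ?x y) * p i y - w y * radial_partial (fund1 k) ?x i y) * ?D\<eta> i y)
        = indicator ?K y *\<^sub>R line_density k w p x v \<delta> (of_real t) y"
      unfolding line_density_of_real[symmetric] by (cases "y \<in> ?K") auto
  qed
  finally show ?thesis unfolding set_lebesgue_integral_def .
qed

lemma helmholtz_holomorphic_along_line:
  assumes D: "open D" and w: "helmholtz_C2 k D w p" and \<delta>: "\<delta> > 0" "cball x (2 * \<delta>) \<subseteq> D"
    and v: "norm v = 1"
  obtains F where "F holomorphic_on ball 0 (\<delta> / 4)" "\<And>t. \<bar>t\<bar> < \<delta> / 4 \<Longrightarrow> w (x + t *\<^sub>R v) = F (of_real t)"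
proof
  note w1 = C1_onD[OF helmholtz_C2_imp_C1_on[OF w]]
  let ?K = "cball x (2 * \<delta>) - ball x \<delta>" and ?B = "ball (0::complex) (\<delta> / 4)"
  have pos: "Re (cdsq (y - x) v z) > 0" if "z \<in> ?B" "y \<in> ?K" for z y
    by (rule Re_cdsq_pos) (use that v \<delta>(1) in \<open>auto simp: dist_norm norm_minus_commute\<close>)
  have "(\<lambda>z. LINT y:?K|lborel. line_density k w p x v \<delta> z y) holomorphic_on ?B"
  proof (rule holomorphic_on_integral_kernel)
    have "compact (cball x (2 * \<delta>))" by simp
    then show "compact ?K" by (rule compact_diff) simp
    have "?K \<subseteq> D" using \<delta>(2) by blast
    then have "continuous_on ?K w" "continuous_on ?K (p i)" for i using w1
      by (auto intro: continuous_on_subset)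
    then have "continuous_on (?B \<times> ?K) (\<lambda>s. w (snd s))"
      "continuous_on (?B \<times> ?K) (\<lambda>s. p i (snd s))" for i
      by (auto intro!: continuous_on_compose2[of ?K _ _ snd] continuous_intros)
    then show "continuous_on (?B \<times> ?K) (\<lambda>(z, y). line_density k w p x v \<delta> z y)"
      unfolding line_density_def directional_def case_prod_unfold using pos \<delta>(1)
      by (intro continuous_intros continuous_on_cfund) auto
    show "(\<lambda>z. line_density k w p x v \<delta> z y) holomorphic_on ?B" if "y \<in> ?K" for y
      unfolding line_density_def using pos[OF _ that]
      by (intro holomorphic_intros cfund_holomorphic) auto
  qed simp
  then show "(\<lambda>z. (LINT y:?K|lborel. line_density k w p x v \<delta> z y) / of_real source_mass)
      holomorphic_on ?B"
    using source_mass_neg by (intro holomorphic_intros) auto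
  fix t assume "\<bar>t\<bar> < \<delta> / 4"
  from weak_helmholtz.line_representation[OF weak_helmholtz_classical[OF D w] w1(1) \<delta> v this]
    source_mass_neg
  show "w (x + t *\<^sub>R v) = (LINT y:?K|lborel. line_density k w p x v \<delta> (of_real t) y)
      / of_real source_mass"
    by (simp add: field_simps)
qed

lemma helmholtz_vanishing_across_point:
  assumes D: "open D" and w: "helmholtz_C2 k D w p" and x: "x \<in> D" and v: "norm v = 1"
    and zero: "\<And>t. t > 0 \<Longrightarrow> w (x + t *\<^sub>R v) = 0"
  obtains r where "r > 0" "\<And>t. \<bar>t\<bar> < r \<Longrightarrow> w (x + t *\<^sub>R v) = 0"
proof -
  obtain e where e: "e > 0" "cball x e \<subseteq> D" using D x open_contains_cball by blast
  define \<delta> where "\<delta> = e / 2"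
  have \<delta>: "\<delta> > 0" "cball x (2 * \<delta>) \<subseteq> D" using e by (auto simp: \<delta>_def)
  obtain F where F: "F holomorphic_on ball 0 (\<delta> / 4)" "\<And>t. \<bar>t\<bar> < \<delta> / 4 \<Longrightarrow>
      w (x + t *\<^sub>R v) = F (of_real t)"
    using helmholtz_holomorphic_along_line[OF D w \<delta> v] by blast
  let ?U = "complex_of_real ` {0<..<\<delta> / 4}"
  have "F z = 0" if "z \<in> ball 0 (\<delta> / 4)" for z
  proof (rule analytic_continuation[OF F(1), of ?U 0])
    have "complex_of_real -` ?U \<inter> UNIV = {0<..<\<delta> / 4}" by auto
    then have limpt: "0 islimpt complex_of_real -` ?U \<inter> UNIV" using \<delta>(1)
      by (simp add: islimpt_greaterThanLessThan1)
    have "complex_of_real 0 islimpt ?U" by (rule islimpt_image[OF limpt])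
      (auto intro!: continuous_intros)
    then show "0 islimpt ?U" by simp
    show "F z = 0" if "z \<in> ?U" for z using that zero by (auto simp flip: F(2))
  qed (use that \<delta> in auto)
  then have "w (x + t *\<^sub>R v) = 0" if "\<bar>t\<bar> < \<delta> / 4" for t using F(2)[OF that] that by simp
  then show ?thesis using that[of "\<delta> / 4"] \<delta>(1) by simp
qed

lemma helmholtz_unique_continuation_ray:
  assumes D: "open D" and w: "helmholtz_C2 k D w p" and v: "norm v = 1"
    and ray: "\<And>s. s \<ge> 0 \<Longrightarrow> x + s *\<^sub>R v \<in> D" and far: "\<And>s. s \<ge> S \<Longrightarrow> w (x + s *\<^sub>R v) = 0"
  shows "w x = 0"
proof -
  define Z where "Z = {s. s \<ge> 0 \<and> (\<forall>t\<ge>s. w (x + t *\<^sub>R v) = 0)}"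
  define a where "a = Inf Z"
  have "max 0 S \<in> Z" using far by (simp add: Z_def)
  then have Z: "Z \<noteq> {}" by blast
  have a: "a \<ge> 0" unfolding a_def by (rule cInf_greatest[OF Z]) (simp add: Z_def)
  have above: "w (x + t *\<^sub>R v) = 0" if "t > a" for t
    using cInf_lessD[OF Z, of t] that by (auto simp: a_def Z_def)
  have shift: "x + a *\<^sub>R v + t *\<^sub>R v = x + (a + t) *\<^sub>R v" for t by (simp add: algebra_simps)
  obtain r where r: "r > 0" "\<And>t. \<bar>t\<bar> < r \<Longrightarrow> w (x + (a + t) *\<^sub>R v) = 0"
    using helmholtz_vanishing_across_point[OF D w ray[OF a] v, unfolded shift] above by auto
  define b where "b = max 0 (a - r / 2)"
  have "w (x + t *\<^sub>R v) = 0" if "t \<ge> b" for t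
    using r(2)[of "t - a"] above[of t] that r(1) by (cases "t > a") (auto simp: b_def abs_less_iff)
  then have "b \<in> Z" by (simp add: Z_def b_def)
  moreover have "bdd_below Z" by (rule bdd_belowI[of _ 0]) (simp add: Z_def)
  ultimately have "a \<le> b" unfolding a_def by (rule cInf_lower)
  then have "a = 0" using r(1) a by (auto simp: b_def)
  then show ?thesis using r(2)[of 0] r(1) by simp
qed

section \<open>The difference of two scattered fields\<close>

lemma tendsto_0_at_infinity_of_off_plane:
  fixes h :: "real^3 \<Rightarrow> complex"
  assumes h: "continuous_on {x. norm x > R} h"
    and lim: "\<And>e. e > 0 \<Longrightarrow> \<exists>\<rho>. \<forall>x. norm x > \<rho> \<longrightarrow> x $ 3 \<noteq> 0 \<longrightarrow> cmod (h x) \<le> e"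
  shows "(h \<longlongrightarrow> 0) at_infinity"
proof (rule tendstoI)
  fix e :: real assume "e > 0"
  then obtain \<rho> where \<rho>: "\<And>x. norm x > \<rho> \<Longrightarrow> x $ 3 \<noteq> 0 \<Longrightarrow> cmod (h x) \<le> e / 2" using lim[of "e / 2"] by auto
  have "continuous_on {x. norm x > max \<rho> R} h" by (rule continuous_on_subset[OF h]) auto
  from norm_le_of_off_plane[OF this, of "e / 2"] have bound: "cmod (h x) \<le> e / 2"
    if "norm x > max \<rho> R" for x
    using \<rho> that by simp
  show "\<forall>\<^sub>F x in at_infinity. dist (h x) 0 < e"
    unfolding eventually_at_infinity dist_norm diff_zero
    by (intro exI[of _ "max \<rho> R + 1"] allI impI order_le_less_trans[OF bound]) (use \<open>e > 0\<close> in auto)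
qed

lemma even_ext_radiation:
  assumes upper: "\<And>x. x \<in> upper_half \<Longrightarrow> norm x > \<rho> \<Longrightarrow>
      cmod (directional x p x - \<i> * of_real (k * norm x) * u x) \<le> e"
    and x: "norm x > \<rho>" "x $ 3 \<noteq> 0"
  shows "cmod (directional x (even_ext_partial p) x - \<i> * of_real (k * norm x) * even_ext u x) \<le> e"
proof -
  have upper': "cmod (directional y (even_ext_partial p) y - \<i> * of_real (k * norm y) * even_ext u y)
      \<le> e"
    if "y $ 3 > 0" "norm y > \<rho>" for y
    using upper[of y] that even_ext_upper[of y] by (simp add: directional_def upper_half_def)
  show ?thesis
  proof (cases "x $ 3 > 0")
    case False
    then have "reflect x $ 3 > 0" using x(2) by simp
    from upper'[OF this] x(1) show ?thesis by (simp add: directional_even_ext_reflect even_ext_reflect)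
  qed (use upper' x(1) in blast)
qed

lemma even_ext_radiation_tendsto:
  assumes w: "C1_on {x. norm x > R} w q"
    and eq: "\<And>x. norm x > R \<Longrightarrow> x $ 3 \<noteq> 0 \<Longrightarrow> w x = even_ext u x"
      "\<And>x i. norm x > R \<Longrightarrow> x $ 3 \<noteq> 0 \<Longrightarrow> q i x = even_ext_partial p i x"
    and radiation: "\<And>e. e > 0 \<Longrightarrow> \<exists>\<rho>. \<forall>x\<in>upper_half. norm x > \<rho> \<longrightarrow>
      cmod (directional x p x - \<i> * of_real (k * norm x) * u x) < e"
  shows "((\<lambda>x. directional x q x - \<i> * of_real (k * norm x) * w x) \<longlongrightarrow> 0) at_infinity"
proof (rule tendsto_0_at_infinity_of_off_plane)
  show "continuous_on {x. norm x > R} (\<lambda>x. directional x q x - \<i> * of_real (k * norm x) * w x)"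
    unfolding directional_def using C1_onD[OF w] by (intro continuous_intros)
  fix e :: real assume "e > 0"
  then obtain \<rho> where \<rho>: "\<And>x. x \<in> upper_half \<Longrightarrow> norm x > \<rho> \<Longrightarrow>
      cmod (directional x p x - \<i> * of_real (k * norm x) * u x) \<le> e"
    using radiation less_imp_le by metis
  have "cmod (directional x q x - \<i> * of_real (k * norm x) * w x) \<le> e"
    if "norm x > max \<rho> R" "x $ 3 \<noteq> 0" for x
    using even_ext_radiation[OF \<rho> _ that(2)] that eq[of x] by (simp add: directional_def)
  then show "\<exists>\<rho>. \<forall>x. norm x > \<rho> \<longrightarrow> x $ 3 \<noteq> 0 \<longrightarrow>
      cmod (directional x q x - \<i> * of_real (k * norm x) * w x) \<le> e" by blast
qed

lemma radiating_mollify_even_ext: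
  assumes k: "k > 0" and R: "R > 0"
    and weak: "weak_helmholtz k {x. norm x > R} (even_ext u) (even_ext_partial p)"
    and C1: "C1_on (upper_half \<inter> {x. norm x > R}) u p"
    and radiation: "\<And>e. e > 0 \<Longrightarrow> \<exists>\<rho>. \<forall>x\<in>upper_half. norm x > \<rho> \<longrightarrow>
      cmod (directional x p x - \<i> * of_real (k * norm x) * u x) < e"
  obtains w pw where "radiating k (R + 2) w pw" "\<And>x. x \<in> upper_half \<Longrightarrow> norm x > R + 2 \<Longrightarrow> w x = u x"
proof -
  let ?E = "{x::real^3. norm x > R + 2}"
  interpret weak_helmholtz k "{x. norm x > R}" "even_ext u" "even_ext_partial p" by (rule weak)
  have E_sub: "?E \<subseteq> {x. cball x (2 * 1) \<subseteq> {x. norm x > R}}"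
  proof safe
    fix x y :: "real^3" assume "norm x > R + 2" "y \<in> cball x (2 * 1)"
    then show "norm y > R" using norm_triangle_ineq2[of x y] by (auto simp: dist_norm)
  qed
  define V where "V = {x \<in> ?E. x $ 3 \<noteq> 0}"
  have E: "open ?E" and V: "open V" "V \<subseteq> ?E"
    unfolding V_def by (auto intro!: open_Collect_conj open_Collect_less open_Collect_neq
      continuous_intros)
  have "C1_on V (even_ext u) (even_ext_partial p)"
    by (rule C1_on_subset[OF C1_on_even_ext[OF C1]])
      (auto simp: V_def intro!: open_Collect_less continuous_intros)
  note C1_V = this and V_sub = subset_trans[OF V(2) E_sub]
  have eq: "mollify 1 x = even_ext u x" "mollify_partial 1 i x = even_ext_partial p i x"
    if "x \<in> V" for x i
    using mollify_eq[OF zero_less_one V(1) V_sub C1_onD(1)[OF C1_V] that]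
      mollify_partial_eq[OF zero_less_one V(1) V_sub C1_V that] by auto
  have w_C1: "C1_on ?E (mollify 1) (mollify_partial 1)"
    by (rule C1_on_subset[OF C1_on_mollify E_sub]) simp
  have "radiating k (R + 2) (mollify 1) (mollify_partial 1)"
  proof (intro radiating.intro radiating_axioms.intro w_C1)
    show "weak_helmholtz k ?E (mollify 1) (mollify_partial 1)"
      by (rule weak_helmholtz_mollify[OF zero_less_one E E_sub V C1_V])
        (use AE_height_nonzero in \<open>auto simp: V_def elim: eventually_mono\<close>)
    show "((\<lambda>x. directional x (mollify_partial 1) x - \<i> * of_real (k * norm x) * mollify 1 x)
        \<longlongrightarrow> 0) at_infinity"
      by (rule even_ext_radiation_tendsto[OF w_C1 eq radiation]) (auto simp: V_def)
  qed (use k R in auto)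
  moreover have "mollify 1 x = u x" if "x \<in> upper_half" "norm x > R + 2" for x
    using eq(1)[of x] that even_ext_upper[of x] by (simp add: V_def upper_half_def)
  ultimately show ?thesis by (rule that)
qed

lemma radiating_difference:
  assumes k: "k > 0" and R: "R > 0"
    and S: "\<And>x. norm x > R \<Longrightarrow> x \<in> S \<longleftrightarrow> x \<in> upper_half" and T: "\<And>x. norm x > R \<Longrightarrow> x \<in> T \<longleftrightarrow> x \<in> upper_half"
    and u: "helmholtz_C2 k S u p" "weak_neumann k S u p" and v: "helmholtz_C2 k T v q"
      "weak_neumann k T v q"
    and radiation: "\<And>e. e > 0 \<Longrightarrow> \<exists>\<rho>. \<forall>x\<in>S \<inter> T. norm x > \<rho> \<longrightarrow>
      cmod (directional x (\<lambda>i x. p i x - q i x) x - \<i> * of_real (k * norm x) * (u x - v x)) < e"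
  obtains w pw where "radiating k (R + 2) w pw" "\<And>x. x \<in> upper_half \<Longrightarrow> norm x > R + 2 \<Longrightarrow> w x = u x - v x"
proof -
  let ?D = "{x::real^3. norm x > R}"
  have D: "open ?D" "\<And>x. x \<in> ?D \<Longrightarrow> reflect x \<in> ?D" by (auto intro!: open_Collect_less continuous_intros)
  have u_ext: "weak_helmholtz k ?D (even_ext u) (even_ext_partial p)"
    by (rule weak_helmholtz_neumann[OF u D S]) simp_all
  have v_ext: "weak_helmholtz k ?D (even_ext v) (even_ext_partial q)"
    by (rule weak_helmholtz_neumann[OF v D T]) simp_all
  from weak_helmholtz_diff[OF u_ext v_ext]
  have weak: "weak_helmholtz k ?D (even_ext (\<lambda>x. u x - v x)) (even_ext_partial (\<lambda>i x. p i x - q i x))"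
    by (simp only: even_ext_diff[abs_def])
  have C1: "C1_on (upper_half \<inter> ?D) (\<lambda>x. u x - v x) (\<lambda>i x. p i x - q i x)"
    by (intro C1_on_diff C1_on_subset[OF helmholtz_C2_imp_C1_on[OF u(1)]]
      C1_on_subset[OF helmholtz_C2_imp_C1_on[OF v(1)]])
      (use S T in auto)
  have far: "\<exists>\<rho>. \<forall>x\<in>upper_half. norm x > \<rho> \<longrightarrow>
      cmod (directional x (\<lambda>i x. p i x - q i x) x - \<i> * of_real (k * norm x) * (u x - v x)) < e"
    if "e > 0" for e
  proof -
    from radiation[OF that] obtain \<rho> where "\<forall>x\<in>S \<inter> T. norm x > \<rho> \<longrightarrow>
      cmod (directional x (\<lambda>i x. p i x - q i x) x - \<i> * of_real (k * norm x) * (u x - v x)) < e"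
    by blast
    then show ?thesis using S T by (intro exI[of _ "max \<rho> R"]) auto
  qed
  show ?thesis by (rule radiating_mollify_even_ext[OF k R weak C1 far]) (assumption | rule that)+
qed

section \<open>Scattering by locally perturbed surfaces\<close>

lemma continuous_on_horiz: "continuous_on S horiz"
  unfolding horiz_def vector_def
proof (rule continuous_on_vec_lambda)
  fix i :: 2
  show "continuous_on S (\<lambda>x::real^3. foldr (\<lambda>x f n. (f (n + 1))(n := x)) [x $ 1, x $ 2] (\<lambda>n x. 0) 1 i)"
    by (cases "i = 1"; cases "i = 2") (simp_all add: fun_upd_def continuous_intros)
qed

lemma norm_horiz: "(norm x)^2 = (norm (horiz x))^2 + (x $ 3)^2"
  by (simp add: horiz_def norm_vec_def L2_set_def sum_2 sum_3 sum_nonneg)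

lemma open_region:
  assumes "locally_perturbed f"
  shows "open (region f)"
proof -
  obtain L where "L-lipschitz_on UNIV f" using assms by (auto simp: locally_perturbed_def)
  then have "continuous_on UNIV (\<lambda>x. f (horiz x))"
    by (intro continuous_on_compose2[OF lipschitz_on_continuous_on continuous_on_horiz]) auto
  then show ?thesis unfolding region_def by (intro open_Collect_less continuous_intros)
qed

lemma region_above: "x \<in> region f \<Longrightarrow> s \<ge> 0 \<Longrightarrow> x + s *\<^sub>R axis 3 1 \<in> region f"
  by (simp add: region_def horiz_def axis_def)

lemma region_exterior:
  assumes "locally_perturbed f"
  obtains R where "R > 0" "\<And>x. norm x > R \<Longrightarrow> x \<in> region f \<longleftrightarrow> x \<in> upper_half"
proof -
  obtain R where R: "\<And>y. \<bar>f y\<bar> < R" "\<And>y. norm y > R \<Longrightarrow> f y = 0"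
    using assms by (auto simp: locally_perturbed_def)
  have "R > 0" using R(1)[of 0] by linarith
  have "x \<in> region f \<longleftrightarrow> x \<in> upper_half" if x: "norm x > 2 * R" for x
  proof (cases "norm (horiz x) > R")
    case True
    then show ?thesis using R(2) by (simp add: region_def upper_half_def)
  next
    case False
    then have "(norm (horiz x))^2 \<le> R^2" by (intro power_mono) auto
    moreover have "(2 * R)^2 < (norm x)^2" using x \<open>R > 0\<close> by (intro power_strict_mono) auto
    moreover have "R^2 > 0" "(2 * R)^2 = 4 * R^2" using \<open>R > 0\<close> by (auto simp: power_mult_distrib)
    ultimately have "R^2 < (x $ 3)^2" using norm_horiz[of x] by linarith
    then have "R < \<bar>x $ 3\<bar>" using power2_le_iff_abs_le[of R "x $ 3"] \<open>R > 0\<close> by linarith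
    then show ?thesis using R(1)[of "horiz x"] by (auto simp: region_def upper_half_def)
  qed
  then show ?thesis using that[of "2 * R"] \<open>R > 0\<close> by simp
qed

lemma helmholtz_C2_diff:
  assumes u: "helmholtz_C2 k S u p" and v: "helmholtz_C2 k T v q"
  shows "helmholtz_C2 k (S \<inter> T) (\<lambda>x. u x - v x) (\<lambda>i x. p i x - q i x)"
proof -
  obtain a where a: "\<And>i j. has_partial_on (p i) j (a i j) S" "\<And>i j. continuous_on S (a i j)"
    "\<And>x. x \<in> S \<Longrightarrow> (\<Sum>i\<in>UNIV. a i i x) + of_real (k^2) * u x = 0"
    using u unfolding helmholtz_C2_def by blast
  obtain b where b: "\<And>i j. has_partial_on (q i) j (b i j) T" "\<And>i j. continuous_on T (b i j)"
    "\<And>x. x \<in> T \<Longrightarrow> (\<Sum>i\<in>UNIV. b i i x) + of_real (k^2) * v x = 0"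
    using v unfolding helmholtz_C2_def by blast
  have diff: "C1_on (S \<inter> T) (\<lambda>x. f x - g x) (\<lambda>i x. Df i x - Dg i x)"
    if "C1_on S f Df" "C1_on T g Dg" for f g Df Dg
    by (rule C1_on_diff[OF C1_on_subset[OF that(1) Int_lower1] C1_on_subset[OF that(2) Int_lower2]])
  have "C1_on S (p i) (a i)" "C1_on T (q i) (b i)" for i
    using C1_onD(3)[OF helmholtz_C2_imp_C1_on[OF u]] C1_onD(3)[OF helmholtz_C2_imp_C1_on[OF v]] a(1,2)
      b(1,2)
    by (auto simp: C1_on_def)
  note C1 = diff[OF helmholtz_C2_imp_C1_on[OF u] helmholtz_C2_imp_C1_on[OF v]] diff[OF this]
  have "(\<Sum>i\<in>UNIV. a i i x - b i i x) + of_real (k^2) * (u x - v x)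
      = ((\<Sum>i\<in>UNIV. a i i x) + of_real (k^2) * u x) - ((\<Sum>i\<in>UNIV. b i i x) + of_real (k^2) * v x)" for x
    by (simp add: sum_subtractf algebra_simps)
  then have "(\<Sum>i\<in>UNIV. a i i x - b i i x) + of_real (k^2) * (u x - v x) = 0" if "x \<in> S \<inter> T" for x
    using a(3)[of x] b(3)[of x] that by simp
  with C1 show ?thesis unfolding helmholtz_C2_def C1_on_def
    by (auto intro!: exI[of _ "\<lambda>i j x. a i j x - b i j x"])
qed

lemma radial_deriv_add:
  assumes S: "open S" "C1_on S (\<lambda>x. h x + v x) p" and x: "x \<in> S" "x \<noteq> 0"
    and h: "((\<lambda>t. h (t *\<^sub>R sgn x)) has_vector_derivative h') (at (norm x))"
  shows "of_real (norm x) * radial_deriv v x = directional x p x - of_real (norm x) * h'"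
proof -
  have sgn: "norm x *\<^sub>R sgn x = x" using x(2) by (simp add: sgn_div_norm)
  have "((\<lambda>t. h (t *\<^sub>R sgn x) + v (t *\<^sub>R sgn x))
      has_vector_derivative directional (sgn x) p x) (at (norm x))"
    using C1_on_has_vector_derivative_line[OF S, of 0 "norm x" "sgn x"] x(1) by (simp add: sgn)
  from has_vector_derivative_diff[OF this h] have "radial_deriv v x = directional (sgn x) p x - h'"
    unfolding radial_deriv_def by (intro vector_derivative_at) simp
  moreover have "of_real (norm x) * directional (sgn x) p x = directional x p x"
    using arg_cong[OF sgn, of "\<lambda>y. directional y p x"]
    by (simp add: directional_def sum_distrib_left mult.assoc)
  ultimately show ?thesis by (simp add: right_diff_distrib)
qed

lemma sommerfeld_diff:
  assumes S: "open S" "C1_on S (\<lambda>x. h x + u x) p" "sommerfeld k S u"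
    and T: "open T" "C1_on T (\<lambda>x. h x + v x) q" "sommerfeld k T v"
    and h: "\<And>y r. (\<lambda>t. h (t *\<^sub>R y)) differentiable at r" and e: "e > 0"
  shows "\<exists>\<rho>. \<forall>x\<in>S \<inter> T. norm x > \<rho> \<longrightarrow>
    cmod (directional x (\<lambda>i x. p i x - q i x) x - \<i> * of_real (k * norm x) * ((h x + u x)
      - (h x + v x))) < e"
proof -
  obtain \<rho>1 \<rho>2 where
    \<rho>1: "\<And>x. x \<in> S \<Longrightarrow> norm x > \<rho>1 \<Longrightarrow> norm x * cmod (radial_deriv u x - \<i> * of_real k * u x) < e / 2" and
    \<rho>2: "\<And>x. x \<in> T \<Longrightarrow> norm x > \<rho>2 \<Longrightarrow> norm x * cmod (radial_deriv v x - \<i> * of_real k * v x) < e / 2"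
    using S(3) T(3) e unfolding sommerfeld_def by (meson half_gt_zero)
  have "cmod (directional x (\<lambda>i x. p i x - q i x) x - \<i> * of_real (k * norm x) * ((h x + u x)
      - (h x + v x))) < e"
    if x: "x \<in> S \<inter> T" "norm x > max 0 (max \<rho>1 \<rho>2)" for x
  proof -
    have x': "x \<in> S" "x \<in> T" "x \<noteq> 0" using x by auto
    obtain h' where h': "((\<lambda>t. h (t *\<^sub>R sgn x)) has_vector_derivative h') (at (norm x))"
      using h vector_derivative_works by blast
    have "directional x (\<lambda>i x. p i x - q i x) x = directional x p x - directional x q x"
      by (simp add: directional_def sum_subtractf right_diff_distrib)
    also have "\<dots> = of_real (norm x) * radial_deriv u x - of_real (norm x) * radial_deriv v x"
      using radial_deriv_add[OF S(1,2) x'(1,3) h'] radial_deriv_add[OF T(1,2) x'(2,3) h'] by simp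
    finally have "directional x (\<lambda>i x. p i x - q i x) x - \<i> * of_real (k * norm x) * ((h x + u x)
        - (h x + v x))
        = of_real (norm x) * (radial_deriv u x - \<i> * of_real k * u x)
          - of_real (norm x) * (radial_deriv v x - \<i> * of_real k * v x)"
      by (simp add: algebra_simps)
    also have "cmod \<dots> \<le> norm x * cmod (radial_deriv u x - \<i> * of_real k * u x)
        + norm x * cmod (radial_deriv v x - \<i> * of_real k * v x)"
      by (rule order_trans[OF norm_triangle_ineq4]) (simp add: norm_mult)
    also have "\<dots> < e" using \<rho>1[OF x'(1)] \<rho>2[OF x'(2)] x(2) by simp
    finally show ?thesis .
  qed
  then show ?thesis by blast
qed

lemma incident_field_differentiable_ray:
  "(\<lambda>t. u_in k d (t *\<^sub>R y) + u_re_neumann k d (t *\<^sub>R y)) differentiable at r"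
proof -
  have "(\<lambda>t. exp (\<i> * complex_of_real (k * (t * a)))) differentiable at r" for a
  proof -
    have "((\<lambda>z. exp (\<i> * (of_real k * (z * of_real a)))) has_field_derivative
        \<i> * of_real (k * a) * exp (\<i> * of_real (k * (r * a)))) (at (complex_of_real r))"
      by (auto intro!: derivative_eq_intros)
    from has_vector_derivative_real_field[OF this] show ?thesis by (intro differentiableI_vector) simp
  qed
  from differentiable_add[OF this this, of "y \<bullet> d" "d $ 1 * y $ 1 + d $ 2 * y $ 2 - d $ 3 * y $ 3"]
  show ?thesis by (simp add: u_in_def u_re_neumann_def algebra_simps)
qed

lemma scattered_difference_radiating:
  assumes k: "k > 0" and f: "locally_perturbed f1" "locally_perturbed f2"
    and usc: "neumann_scattered k f1 d usc1" "neumann_scattered k f2 d usc2"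
  obtains R w pw where "radiating k R w pw" "\<And>x. x \<in> upper_half \<Longrightarrow> norm x > R \<Longrightarrow> w x = usc1 x - usc2 x"
proof -
  let ?h = "\<lambda>x. u_in k d x + u_re_neumann k d x"
  obtain p1 where p1: "helmholtz_C2 k (region f1) (\<lambda>x. ?h x + usc1 x) p1"
      "weak_neumann k (region f1) (\<lambda>x. ?h x + usc1 x) p1" "sommerfeld k (region f1) usc1"
    using usc(1) unfolding neumann_scattered_def Let_def by blast
  obtain p2 where p2: "helmholtz_C2 k (region f2) (\<lambda>x. ?h x + usc2 x) p2"
      "weak_neumann k (region f2) (\<lambda>x. ?h x + usc2 x) p2" "sommerfeld k (region f2) usc2"
    using usc(2) unfolding neumann_scattered_def Let_def by blast
  obtain R1 where R1: "R1 > 0" "\<And>x. norm x > R1 \<Longrightarrow> x \<in> region f1 \<longleftrightarrow> x \<in> upper_half"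
    using region_exterior[OF f(1)] by blast
  obtain R2 where R2: "R2 > 0" "\<And>x. norm x > R2 \<Longrightarrow> x \<in> region f2 \<longleftrightarrow> x \<in> upper_half"
    using region_exterior[OF f(2)] by blast
  define R where "R = max R1 R2"
  have R: "R > 0" "\<And>x. norm x > R \<Longrightarrow> x \<in> region f1 \<longleftrightarrow> x \<in> upper_half"
    "\<And>x. norm x > R \<Longrightarrow> x \<in> region f2 \<longleftrightarrow> x \<in> upper_half"
    using R1 R2 by (auto simp: R_def)
  note radiation = sommerfeld_diff[OF open_region[OF f(1)] helmholtz_C2_imp_C1_on[OF p1(1)] p1(3)
      open_region[OF f(2)] helmholtz_C2_imp_C1_on[OF p2(1)] p2(3) incident_field_differentiable_ray]
  obtain w pw where w: "radiating k (R + 2) w pw"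
    "\<And>x. x \<in> upper_half \<Longrightarrow> norm x > R + 2 \<Longrightarrow> w x = (?h x + usc1 x) - (?h x + usc2 x)"
    by (rule radiating_difference[OF k R(1,2,3) p1(1,2) p2(1,2) radiation]) (assumption | rule that)+
  from w(2) have "w x = usc1 x - usc2 x" if "x \<in> upper_half" "norm x > R + 2" for x using that by simp
  with w(1) show ?thesis by (rule that)
qed

lemma far_field_diff_tendsto_0:
  assumes far: "has_far_field k u F" "has_far_field k v F" and \<theta>: "\<theta> \<in> upper_sphere"
  shows "((\<lambda>r. of_real r * exp (- \<i> * of_real (k * r)) * (u (r *\<^sub>R \<theta>) - v (r *\<^sub>R \<theta>))) \<longlongrightarrow> 0) at_top"
proof -
  have "((\<lambda>r. of_real r * exp (- \<i> * of_real (k * r)) * u (r *\<^sub>R \<theta>)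
      - of_real r * exp (- \<i> * of_real (k * r)) * v (r *\<^sub>R \<theta>)) \<longlongrightarrow> F \<theta> - F \<theta>) at_top"
    using far \<theta> unfolding has_far_field_def by (intro tendsto_diff) blast+
  then show ?thesis by (simp add: right_diff_distrib)
qed

lemma scattered_fields_eq_far:
  assumes k: "k > 0" and f: "locally_perturbed f1" "locally_perturbed f2"
    and usc: "neumann_scattered k f1 d usc1" "neumann_scattered k f2 d usc2"
    and far: "has_far_field k usc1 F" "has_far_field k usc2 F"
  obtains \<rho> where "\<And>x. x \<in> upper_half \<Longrightarrow> norm x > \<rho> \<Longrightarrow> usc1 x = usc2 x"
proof -
  obtain R w pw where w: "radiating k R w pw" "\<And>x. x \<in> upper_half \<Longrightarrow> norm x > R \<Longrightarrow> w x = usc1 x - usc2 x"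
    by (rule scattered_difference_radiating[OF k f usc]) (rule that)
  interpret radiating k R w pw by (rule w(1))
  have "((\<lambda>r. of_real r * exp (- \<i> * of_real (k * r)) * w (r *\<^sub>R \<theta>)) \<longlongrightarrow> 0) at_top"
    if \<theta>: "\<theta> \<in> upper_half" "norm \<theta> = 1" for \<theta>
  proof (rule Lim_transform_eventually[OF far_field_diff_tendsto_0[OF far]])
    show "\<theta> \<in> upper_sphere" using \<theta> by (simp add: upper_sphere_def upper_half_def)
    have "w (r *\<^sub>R \<theta>) = usc1 (r *\<^sub>R \<theta>) - usc2 (r *\<^sub>R \<theta>)" if "r > R" for r
      using w(2)[of "r *\<^sub>R \<theta>"] that \<theta> R by (simp add: upper_half_def)
    then show "\<forall>\<^sub>F r in at_top. of_real r * exp (- \<i> * of_real (k * r)) * (usc1 (r *\<^sub>R \<theta>)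
        - usc2 (r *\<^sub>R \<theta>))
        = of_real r * exp (- \<i> * of_real (k * r)) * w (r *\<^sub>R \<theta>)"
      by (intro eventually_mono[OF eventually_gt_at_top[of R]]) simp
  qed
  then obtain \<rho> where \<rho>: "\<And>x. norm x > \<rho> \<Longrightarrow> sgn x \<in> upper_half \<Longrightarrow> w x = 0"
    using rellich[OF open_upper_half] by blast
  have "usc1 x = usc2 x" if x: "x \<in> upper_half" "norm x > max \<rho> R" for x
  proof -
    have "norm x > 0" using x(2) R unfolding max_less_iff_conj by linarith
    then have "sgn x \<in> upper_half" using x(1) by (simp add: upper_half_def sgn_div_norm)
    then show ?thesis using \<rho>[of x] w(2)[of x] x by simp
  qed
  then show ?thesis by (rule that)
qed

theorem mainTheorem7:
  fixes k :: real and f1 f2 :: "real^2 \<Rightarrow> real" and d :: "real^3"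
    and usc1 usc2 F1 F2 :: "real^3 \<Rightarrow> complex"
  assumes "k > 0"
    and "locally_perturbed f1" and "locally_perturbed f2"
    and "d \<in> lower_sphere"
    and "neumann_scattered k f1 d usc1" and "neumann_scattered k f2 d usc2"
    and "has_far_field k usc1 F1" and "has_far_field k usc2 F2"
    and "\<forall>xh\<in>upper_sphere. F1 xh = F2 xh"
  shows "\<forall>x\<in>region f1 \<inter> region f2. usc1 x = usc2 x"
proof
  fix x assume x: "x \<in> region f1 \<inter> region f2"
  let ?h = "\<lambda>x. u_in k d x + u_re_neumann k d x" and ?up = "\<lambda>s. x + s *\<^sub>R axis 3 (1::real)"
  have "has_far_field k usc2 F1" using assms(8,9) by (simp add: has_far_field_def)
  then obtain \<rho> where far: "\<And>x. x \<in> upper_half \<Longrightarrow> norm x > \<rho> \<Longrightarrow> usc1 x = usc2 x"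
    using scattered_fields_eq_far[OF assms(1-3,5-7)] by blast
  obtain p where "helmholtz_C2 k (region f1 \<inter> region f2) (\<lambda>x. (?h x + usc1 x) - (?h x + usc2 x)) p"
    using assms(5,6) helmholtz_C2_diff unfolding neumann_scattered_def Let_def by blast
  then have "(?h x + usc1 x) - (?h x + usc2 x) = 0"
  proof (rule helmholtz_unique_continuation_ray[rotated])
    show "open (region f1 \<inter> region f2)" using assms(2,3) by (intro open_Int open_region)
    show "?up s \<in> region f1 \<inter> region f2" if "s \<ge> 0" for s using x region_above[OF _ that] by blast
    show "(?h (?up s) + usc1 (?up s)) - (?h (?up s) + usc2 (?up s)) = 0"
      if s: "s \<ge> \<bar>\<rho>\<bar> + \<bar>x $ 3\<bar> + 1" for s
    proof -
      have "?up s $ 3 = x $ 3 + s" by (simp add: axis_def)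
      then have "?up s $ 3 > 0" "?up s $ 3 > \<rho>" using s by linarith+
      moreover have "norm (?up s) \<ge> ?up s $ 3" using component_le_norm_cart[of "?up s" 3] by linarith
      ultimately show ?thesis using far[of "?up s"] by (simp add: upper_half_def)
    qed
  qed simp
  then show "usc1 x = usc2 x" by simp
qed

end
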